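(* Let $k\ge1$ and $\lambda_1,\dots,\lambda_k\in\mathbb{R}$, and write $t^+:=\max\{0,t\}$. If $$\sum_{i=1}^k\lambda_i^+<\gamma_H,$$ then the quadratic form $Q_{\lambda_1,\dots,\lambda_k,a_1,\dots,a_k}$ is positive definite for all (pairwise distinct) $a_1,\dots,a_k\in\mathbb{R}^N$. Conversely, if $$\sum_{i=1}^k\lambda_i^+>\gamma_H,$$ then there exists a configuration of (pairwise distinct) poles $(a_1,\dots,a_k)$ in $\mathbb{R}^N$ such that $Q_{\lambda_1,\dots,\lambda_k,a_1,\dots,a_k}$ is not positive definite.
   Context: Let $s\in(0,1)$ and let $N\ge1$ be an integer with $N>2s$. Functions are real-valued. $\mathcal{D}^{s,2}(\mathbb{R}^N)$ is the completion of $C_c^\infty(\mathbb{R}^N)$ with respect to the norm $\|u\|_{\mathcal{D}^{s,2}(\mathbb{R}^N)}^2=\frac12 C(N,s)\int_{\mathbb{R}^{2N}}\frac{|u(x)-u(y)|^2}{|x-y|^{N+2s}}\,dx\,dy$, where $C(N,s)=\pi^{-N/2}2^{2s}\frac{\Gamma(\frac{N+2s}{2})}{\Gamma(2-s)}s(1-s)$. Let $\gamma_H=2^{2s}\frac{\Gamma^2(\frac{N+2s}{4})}{\Gamma^2(\frac{N-2s}{4})}$ be the optimal constant in the fractional Hardy inequality $\gamma_H\int_{\mathbb{R}^N}\frac{|u|^2}{|x|^{2s}}dx\le\|u\|^2_{\mathcal{D}^{s,2}(\mathbb{R}^N)}$, $u\in\mathcal{D}^{s,2}(\mathbb{R}^N)$.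 For $u\in\mathcal{D}^{s,2}(\mathbb{R}^N)$ put $Q_{\lambda_1,\dots,\lambda_k,a_1,\dots,a_k}(u)=\|u\|^2_{\mathcal{D}^{s,2}(\mathbb{R}^N)}-\sum_{i=1}^k\lambda_i\int_{\mathbb{R}^N}\frac{|u(x)|^2}{|x-a_i|^{2s}}\,dx$. This quadratic form is called positive definite if $\inf_{u\in\mathcal{D}^{s,2}(\mathbb{R}^N)\setminus\{0\}}\frac{Q_{\lambda_1,\dots,\lambda_k,a_1,\dots,a_k}(u)}{\|u\|^2_{\mathcal{D}^{s,2}(\mathbb{R}^N)}}>0$. *)

theory Defs
  imports "HOL-Analysis.Analysis"
begin

text \<open>The space \<open>\<real>\<^sup>N\<close> is a Euclidean space \<open>'a\<close> with \<open>N = DIM('a)\<close>.\<close>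

definition C_Ns :: "nat \<Rightarrow> real \<Rightarrow> real" where
  "C_Ns N s = pi powr (- real N / 2) * 2 powr (2 * s)
     * (Gamma ((real N + 2 * s) / 2) / Gamma (2 - s)) * s * (1 - s)"

definition gamma_H :: "nat \<Rightarrow> real \<Rightarrow> real" where
  "gamma_H N s = 2 powr (2 * s)
     * ((Gamma ((real N + 2 * s) / 4))\<^sup>2 / (Gamma ((real N - 2 * s) / 4))\<^sup>2)"

text \<open>Functions of class \<open>C\<^sup>n\<close>: differentiable with all partial derivatives of class \<open>C\<^sup>n\<^sup>-\<^sup>1\<close>.\<close>

primrec class_C :: "nat \<Rightarrow> ('a::euclidean_space \<Rightarrow> real) \<Rightarrow> bool" where
  "class_C 0 f \<longleftrightarrow> continuous_on UNIV f"
| "class_C (Suc n) f \<longleftrightarrow> (\<forall>x. f differentiable (at x)) \<and>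
     (\<forall>b\<in>Basis. class_C n (\<lambda>x. frechet_derivative f (at x) b))"

definition Cc_inf :: "('a::euclidean_space \<Rightarrow> real) set" where
  "Cc_inf = {f. (\<forall>n. class_C n f) \<and> compact (closure {x. f x \<noteq> 0})}"

text \<open>On the diagonal, a null set, the integrand is \<open>0 / 0 = 0\<close>. The integral is finite for all
  functions in \<open>Cc_inf\<close> and, by Fatou's lemma, for all functions in \<open>Ds2\<close> below.\<close>

definition Ds2_norm :: "real \<Rightarrow> ('a::euclidean_space \<Rightarrow> real) \<Rightarrow> real" where
  "Ds2_norm s u = sqrt (C_Ns DIM('a) s / 2 *
     (LINT p|(lborel \<Otimes>\<^sub>M lborel).
        \<bar>u (fst p) - u (snd p)\<bar>\<^sup>2 / norm (fst p - snd p) powr (real DIM('a) + 2 * s)))"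

text \<open>The completion of \<open>Cc_inf\<close>, realized as a space of functions. By the Hardy (or Sobolev)
  inequality, valid for \<open>N > 2 s\<close>, every Cauchy sequence in \<open>Cc_inf\<close> has a subsequence
  converging almost everywhere, and by Fatou's lemma two Cauchy sequences with a.e. limits are
  equivalent iff these limits agree almost everywhere. So the elements of the completion are the
  a.e. limits of Cauchy sequences, represented here by Borel functions that are
  not identified when they agree almost everywhere.\<close>

definition Ds2 :: "real \<Rightarrow> ('a::euclidean_space \<Rightarrow> real) set" where
  "Ds2 s = {u \<in> borel_measurable borel. \<exists>\<phi>::nat \<Rightarrow> 'a \<Rightarrow> real.
     (\<forall>n. \<phi> n \<in> Cc_inf) \<and>
     (\<forall>e>0. \<exists>M. \<forall>m\<ge>M. \<forall>n\<ge>M. Ds2_norm s (\<lambda>x. \<phi> m x - \<phi> n x) < e) \<and>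
     (AE x in lborel. (\<lambda>n. \<phi> n x) \<longlonglongrightarrow> u x)}"

definition Q_form ::
  "real \<Rightarrow> nat \<Rightarrow> (nat \<Rightarrow> real) \<Rightarrow> (nat \<Rightarrow> 'a::euclidean_space) \<Rightarrow> ('a \<Rightarrow> real) \<Rightarrow> real" where
  "Q_form s k lam a u = (Ds2_norm s u)\<^sup>2
     - (\<Sum>i=1..k. lam i * (LINT x|lborel. \<bar>u x\<bar>\<^sup>2 / norm (x - a i) powr (2 * s)))"

text \<open>\<open>u\<close> is the zero element of the space iff it vanishes almost everywhere. The infimum is
  taken in the extended reals, where it exists without a boundedness condition.\<close>

definition Q_positive_definite ::
  "real \<Rightarrow> nat \<Rightarrow> (nat \<Rightarrow> real) \<Rightarrow> (nat \<Rightarrow> 'a::euclidean_space) \<Rightarrow> bool" where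
  "Q_positive_definite s k lam a \<longleftrightarrow>
     (INF u\<in>{u \<in> Ds2 s. \<not> (AE x in lborel. u x = 0)}.
        ereal (Q_form s k lam a u / (Ds2_norm s u)\<^sup>2)) > 0"

end

theory Submission
  imports Defs "HOL-Probability.Distributions"
begin

text \<open>
  The kernel \<open>\<bar>z\<bar>\<^sup>-\<^sup>N\<^sup>-\<^sup>2\<^sup>s\<close> is a superposition of heat kernels \<open>p\<^sub>t\<close>, so the energy of \<open>u\<close> is a constant times
  the integral of \<open>t\<^sup>-\<^sup>1\<^sup>-\<^sup>s D\<^sub>t(u)\<close> over \<open>t > 0\<close>, where \<open>D\<^sub>t(u) = \<integral>\<integral> \<bar>u(x) - u(y)\<bar>\<^sup>2 p\<^sub>t(x - y) dx dy\<close>.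

  Hardy inequality: let \<open>w = \<integral>\<^sub>0\<^sup>\<infinity> r\<^sup>b\<^sup>-\<^sup>1 p\<^sub>r dr\<close> with \<open>b = (N + 2s)/4\<close>, a multiple of \<open>\<bar>x\<bar>\<close> to the power
  \<open>-(N - 2s)/2\<close>. By AM-GM, \<open>D\<^sub>t(u)\<close> is at least \<open>2 \<integral> u\<^sup>2 (w - P\<^sub>t w)/w\<close>. Since \<open>P\<^sub>t\<close> only shifts the
  time variable of \<open>w\<close>, integrating over \<open>t\<close> leaves a one-dimensional Beta integral, which produces the
  constant \<open>\<gamma>\<^sub>H\<close>. Integrating first over \<open>t \<ge> \<delta>\<close> and cancelling finite terms keeps all
  integrands nonnegative, so no principal values occur.

  Optimality: for a sum of the Gaussians \<open>p\<^sub>a\<close> with variances in geometric progression, suitably weighted, both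
  quadratic forms are Toeplitz sums of powers of \<open>sech\<close>, and in the limit their quotient becomes a quotient
  of Beta integrals equal to \<open>\<gamma>\<^sub>H\<close>. A cutoff gives a test function in \<open>Cc_inf\<close>.

  If the sum of the positive parts exceeds \<open>\<gamma>\<^sub>H\<close>, such a test function makes the form negative once the
  poles with positive coefficients are close to the origin and the other poles are far away.
\<close>

text \<open>The power of \<open>norm x\<close> with exponent \<open>-(N - 2s)/2\<close> is the
  virtual ground state of the Hardy quotient: it solves the Euler equation with constant
  \<open>gamma_H\<close>, but its energy and its Hardy integral both diverge. Both halves rest on
  it. In the lower bound it is the comparison function \<open>w\<close>. In the upper bound the
  Gaussian sums are, up to a factor, finite Riemann sums of \<open>w\<close>: in the variable
  \<open>log r\<close> its representation has density \<open>r powr b\<close> times the heat kernel,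
  so variances in geometric progression are equidistant nodes, and dilation invariance becomes
  translation invariance in the index, whence Toeplitz sums. In the lower bound,
  \<open>t powr (- 1 - s)\<close> is not integrable at 0, so the two parts of
  \<open>w - P_t w\<close> cannot be integrated separately. Truncation at \<delta> makes them finite
  only against a square-integrable \<open>u\<close>; the inequality is therefore proved for such
  functions and reaches the completion by Fatou's lemma. For several poles no interaction has to be
  estimated: translation invariance bounds each Hardy term by the same multiple of the energy,
  wherever its pole is.\<close>

section \<open>Gamma, Beta and Gaussian integrals\<close>

lemma nn_integral_Gamma:
  fixes a q :: real
  assumes "a > 0" "q > 0"
  shows "(\<integral>\<^sup>+t\<in>{0<..}. ennreal (t powr (q - 1) * exp (- (a * t))) \<partial>lborel) = ennreal (Gamma q * a powr (- q))"
proof -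
  have "ennreal (Gamma q) = (\<integral>\<^sup>+t. ennreal (indicator {0..} t * t powr (q - 1) / exp t) \<partial>lborel)"
    using Gamma_conv_nn_integral_real[OF assms(2)] .
  also have "\<dots> = ennreal \<bar>a\<bar> * (\<integral>\<^sup>+t. ennreal (indicator {0..} (0 + a * t) * (0 + a * t) powr (q - 1) / exp (0 + a * t)) \<partial>lborel)"
    using assms by (subst nn_integral_real_affine[where c = a and t = 0]) auto
  also have "\<dots> = (\<integral>\<^sup>+t. ennreal (\<bar>a\<bar> * (indicator {0..} (0 + a * t) * (0 + a * t) powr (q - 1) / exp (0 + a * t))) \<partial>lborel)"
    by (subst nn_integral_cmult[symmetric]) (auto simp: ennreal_mult'[symmetric])
  also have "\<dots> = (\<integral>\<^sup>+t. ennreal (a powr q) * (ennreal (t powr (q - 1) * exp (- (a * t))) * indicator {0<..} t) \<partial>lborel)"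
    using assms
    by (intro nn_integral_cong_AE, use AE_lborel_singleton[of "0::real"] in eventually_elim)
       (auto simp: indicator_def powr_mult exp_minus field_simps powr_diff zero_le_mult_iff ennreal_mult'[symmetric] ennreal_mult''[symmetric])
  also have "\<dots> = ennreal (a powr q) * (\<integral>\<^sup>+t\<in>{0<..}. ennreal (t powr (q - 1) * exp (- (a * t))) \<partial>lborel)"
    by (subst nn_integral_cmult) auto
  finally have *: "ennreal (Gamma q) = ennreal (a powr q) * (\<integral>\<^sup>+t\<in>{0<..}. ennreal (t powr (q - 1) * exp (- (a * t))) \<partial>lborel)" .
  have "ennreal (Gamma q * a powr (- q)) = ennreal (a powr (- q)) * ennreal (Gamma q)"
    by (simp add: ennreal_mult'' mult.commute)
  also have "\<dots> = (\<integral>\<^sup>+t\<in>{0<..}. ennreal (t powr (q - 1) * exp (- (a * t))) \<partial>lborel)"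
    unfolding * using assms by (simp add: mult.assoc[symmetric] ennreal_mult'[symmetric] powr_add[symmetric])
  finally show ?thesis by simp
qed

text \<open>By the Gamma integral, \<open>(\<sigma> + x) powr (- p)\<close> is a superposition of
  the exponentials \<open>exp (- ((\<sigma> + x) * y))\<close>. After the order of integration is
  exchanged, the integrals over \<open>x\<close> and then over \<open>y\<close> are again Gamma
  integrals, with parameters \<open>q\<close> and \<open>p - q\<close>; this is where
  \<open>q < p\<close> enters.\<close>

lemma nn_integral_beta_prime:
  fixes p q \<sigma> :: real
  assumes "0 < q" "q < p" "\<sigma> > 0"
  shows "(\<integral>\<^sup>+x\<in>{0<..}. ennreal (x powr (q - 1) * (\<sigma> + x) powr (- p)) \<partial>lborel)
     = ennreal (\<sigma> powr (q - p) * Gamma q * Gamma (p - q) / Gamma p)"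
proof -
  have Gp: "Gamma p > 0" using assms by (simp add: Gamma_real_pos)
  then have Gp0: "Gamma p \<noteq> 0" by linarith
  have "ennreal (Gamma p) * (\<integral>\<^sup>+x\<in>{0<..}. ennreal (x powr (q - 1) * (\<sigma> + x) powr (- p)) \<partial>lborel)
     = (\<integral>\<^sup>+x\<in>{0<..}. ennreal (x powr (q - 1)) * ennreal (Gamma p * (\<sigma> + x) powr (- p)) \<partial>lborel)"
    using Gp by (subst nn_integral_cmult[symmetric])
      (auto intro!: nn_integral_cong simp: ennreal_mult'[symmetric] indicator_def mult_ac)
  also have "\<dots> = (\<integral>\<^sup>+x\<in>{0<..}. ennreal (x powr (q - 1)) *
      (\<integral>\<^sup>+y\<in>{0<..}. ennreal (y powr (p - 1) * exp (- ((\<sigma> + x) * y))) \<partial>lborel) \<partial>lborel)"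
    using assms by (intro nn_integral_cong) (auto simp: indicator_def nn_integral_Gamma[symmetric])
  also have "\<dots> = (\<integral>\<^sup>+x. (\<integral>\<^sup>+y. indicator {0<..} x * indicator {0<..} y *
        ennreal (x powr (q - 1) * y powr (p - 1) * exp (- ((\<sigma> + x) * y))) \<partial>lborel) \<partial>lborel)"
    by (subst nn_integral_cmult[symmetric], (measurable)[1], subst nn_integral_multc[symmetric])
       (auto intro!: nn_integral_cong simp: ennreal_mult'[symmetric] indicator_def mult_ac)
  also have "\<dots> = (\<integral>\<^sup>+y. (\<integral>\<^sup>+x. indicator {0<..} x * indicator {0<..} y *
        ennreal (x powr (q - 1) * y powr (p - 1) * exp (- ((\<sigma> + x) * y))) \<partial>lborel) \<partial>lborel)"
    by (rule lborel_pair.Fubini') measurable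
  also have "\<dots> = (\<integral>\<^sup>+y. indicator {0<..} y * ennreal (y powr (p - 1) * exp (- (\<sigma> * y))) *
        (\<integral>\<^sup>+x\<in>{0<..}. ennreal (x powr (q - 1) * exp (- (y * x))) \<partial>lborel) \<partial>lborel)"
    by (subst nn_integral_cmult[symmetric])
       (auto intro!: nn_integral_cong simp: ennreal_mult'[symmetric] indicator_def mult_ac mult_exp_exp algebra_simps)
  also have "\<dots> = (\<integral>\<^sup>+y. ennreal (Gamma q) * (ennreal (y powr (p - q - 1) * exp (- (\<sigma> * y))) * indicator {0<..} y) \<partial>lborel)"
  proof (intro nn_integral_cong, goal_cases)
    case (1 y)
    have "y powr (p - 1) * y powr - q = y powr (p - q - 1)"
      by (simp add: powr_add[symmetric] algebra_simps)
    then show ?case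
      using assms nn_integral_Gamma[of y q]
      by (cases "y > 0") (simp_all add: ennreal_mult'[symmetric] ennreal_mult''[symmetric] mult_ac Gamma_real_pos less_imp_le)
  qed
  also have "\<dots> = ennreal (Gamma q) * ennreal (Gamma (p - q) * \<sigma> powr (- (p - q)))"
    using assms by (subst nn_integral_cmult) (auto simp: nn_integral_Gamma)
  also have "\<dots> = ennreal (Gamma p) * ennreal (\<sigma> powr (q - p) * Gamma q * Gamma (p - q) / Gamma p)"
    using assms Gp0 Gamma_real_pos[of q] Gamma_real_pos[of "p - q"]
    by (simp add: ennreal_mult'[symmetric] less_imp_le)
  finally show ?thesis
    using Gp by (simp add: ennreal_mult_cancel_left)
qed

text \<open>The substitution \<open>t \<mapsto> A / t\<close> turns the integral into the Gamma
  integral. The integrand is the time dependence of a heat kernel at a fixed point, multiplied by a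
  power of time.\<close>

lemma nn_integral_Gamma_inverse:
  fixes A p :: real
  assumes "A > 0" "p > 0"
  shows "(\<integral>\<^sup>+t\<in>{0<..}. ennreal (t powr (- p - 1) * exp (- (A / t))) \<partial>lborel) = ennreal (Gamma p * A powr (- p))"
proof -
  have "((\<lambda>t. t powr (p - 1) / exp t) has_integral Gamma p) {0<..}"
    by (subst has_integral_spike_set_eq[of _ "{0..}"])
       (auto intro!: Gamma_integral_real assms negligible_subset[OF negligible_sing[of "0::real"]] split: if_splits)
  then have "((\<lambda>t. A powr (- p) * (t powr (p - 1) / exp t)) has_integral A powr (- p) * Gamma p) {0<..}"
    by (rule has_integral_mult_right)
  then have 1: "((\<lambda>t. \<bar>- (A / t\<^sup>2)\<bar> * ((A / t) powr (- p - 1) * exp (- (A / (A / t))))) has_integral A powr (- p) * Gamma p) {0<..}"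
    using assms by (subst has_integral_cong) (auto simp: powr_divide powr_minus powr_diff exp_minus field_simps power2_eq_square powr_add)
  have im: "(\<lambda>t. A / t) ` {0<..} = {0<..}"
    using assms by (auto simp: image_iff intro!: bexI[of _ "A / x" for x])
  have "(\<lambda>t. \<bar>- (A / t\<^sup>2)\<bar> * ((A / t) powr (- p - 1) * exp (- (A / (A / t))))) absolutely_integrable_on {0<..} \<and>
     integral {0<..} (\<lambda>t. \<bar>- (A / t\<^sup>2)\<bar> * ((A / t) powr (- p - 1) * exp (- (A / (A / t))))) = A powr (- p) * Gamma p"
    using 1 by (auto intro!: nonnegative_absolutely_integrable_1 simp: integral_unique has_integral_integrable)
  then have "(\<lambda>t. t powr (- p - 1) * exp (- (A / t))) absolutely_integrable_on {0<..} \<and>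
     integral {0<..} (\<lambda>t. t powr (- p - 1) * exp (- (A / t))) = A powr (- p) * Gamma p"
    by (subst (asm) has_absolute_integral_change_of_variables_1')
       (use assms in \<open>auto simp: im inj_on_def power2_eq_square intro!: derivative_eq_intros\<close>)
  then have "((\<lambda>t. t powr (- p - 1) * exp (- (A / t))) has_integral A powr (- p) * Gamma p) {0<..}"
    by (metis has_integral_integral set_lebesgue_integral_eq_integral(1))
  from nn_integral_has_integral_lebesgue'[OF _ this] show ?thesis by (simp add: mult.commute)
qed

text \<open>The integrand is a product over the coordinates; in each of them it is a multiple of the
  normal density with variance \<open>1 / (2 * a)\<close>, whose mass is one.\<close>

lemma nn_integral_gaussian:
  fixes a :: real
  assumes "a > 0"
  shows "(\<integral>\<^sup>+x. ennreal (exp (- (a * (norm (x::'a::euclidean_space))\<^sup>2))) \<partial>lborel) = ennreal ((pi / a) powr (DIM('a) / 2))"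
proof -
  have 1: "(\<integral>\<^sup>+(x::real). ennreal (exp (- (a * x\<^sup>2))) \<partial>lborel) = ennreal (sqrt (pi / a))"
  proof -
    define \<sigma> where "\<sigma> = sqrt (1 / (2 * a))"
    have \<sigma>: "\<sigma> > 0" "\<sigma>\<^sup>2 = 1 / (2 * a)" using assms by (auto simp: \<sigma>_def)
    have "(\<integral>\<^sup>+(x::real). ennreal (exp (- (a * x\<^sup>2))) \<partial>lborel) = (\<integral>\<^sup>+x. ennreal (sqrt (pi / a)) * ennreal (normal_density 0 \<sigma> x) \<partial>lborel)"
      using assms by (intro nn_integral_cong) (simp add: normal_density_def \<sigma> ennreal_mult'[symmetric] real_sqrt_divide field_simps)
    also have "\<dots> = ennreal (sqrt (pi / a))"
      using \<sigma>(1) by (subst nn_integral_cmult) (auto simp: nn_integral_eq_integral)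
    finally show ?thesis .
  qed
  have sq: "(norm x)\<^sup>2 = (\<Sum>b\<in>Basis. (x \<bullet> b)\<^sup>2)" for x :: 'a
    unfolding power2_norm_eq_inner by (subst euclidean_inner) (simp add: power2_eq_square)
  have "(\<integral>\<^sup>+x. ennreal (exp (- (a * (norm (x::'a::euclidean_space))\<^sup>2))) \<partial>lborel)
     = (\<integral>\<^sup>+(x::'a). (\<Prod>b\<in>Basis. ennreal (exp (- (a * (x \<bullet> b)\<^sup>2)))) \<partial>lborel)"
    by (intro nn_integral_cong)
       (simp add: prod_ennreal sq sum_distrib_left sum_negf flip: exp_sum)
  also have "\<dots> = (\<Prod>b\<in>(Basis::'a set). (\<integral>\<^sup>+(x::real). ennreal (exp (- (a * x\<^sup>2))) \<partial>lborel))"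
    by (rule nn_integral_lborel_prod) auto
  also have "\<dots> = ennreal ((pi / a) powr (DIM('a) / 2))"
    using assms unfolding 1 by (simp add: ennreal_power flip: powr_half_sqrt, simp add: powr_powr flip: powr_realpow)
  finally show ?thesis .
qed

section \<open>The heat kernel\<close>

text \<open>Fundamental solution of the heat equation for the Laplacian, that is, the Gaussian
  density with variance \<open>2 * t\<close> in each coordinate.\<close>

definition heat_kernel :: "real \<Rightarrow> 'a::euclidean_space \<Rightarrow> real" where
  "heat_kernel t z = (4 * pi * t) powr (- (DIM('a) / 2)) * exp (- (norm z)\<^sup>2 / (4 * t))"

lemma heat_kernel_measurable [measurable (raw)]:
  assumes [measurable]: "f \<in> borel_measurable M" "g \<in> borel_measurable M"
  shows "(\<lambda>x. heat_kernel (f x) (g x :: 'a::euclidean_space)) \<in> borel_measurable M"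
  unfolding heat_kernel_def by measurable

lemma heat_kernel_nonneg [simp]: "heat_kernel t z \<ge> 0"
  by (simp add: heat_kernel_def)

lemma heat_kernel_minus: "heat_kernel t (x - y) = heat_kernel t (y - x)"
  by (simp add: heat_kernel_def norm_minus_commute)

lemma nn_integral_lborel_translate:
  fixes f :: "'a::euclidean_space \<Rightarrow> ennreal"
  assumes [measurable]: "f \<in> borel_measurable borel"
  shows "(\<integral>\<^sup>+x. f (x + c) \<partial>lborel) = (\<integral>\<^sup>+x. f x \<partial>lborel)"
proof -
  have "(\<integral>\<^sup>+x. f x \<partial>lborel) = (\<integral>\<^sup>+x. f x \<partial>(distr lborel borel (\<lambda>x. c + x)))"
    using lborel_affine[of 1 c] by (simp add: density_1)
  also have "\<dots> = (\<integral>\<^sup>+x. f (c + x) \<partial>lborel)"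
    by (subst nn_integral_distr) auto
  finally show ?thesis by (simp add: add.commute)
qed

lemma nn_integral_heat_kernel:
  assumes "t > 0"
  shows "(\<integral>\<^sup>+x. ennreal (heat_kernel t (x - y :: 'a::euclidean_space)) \<partial>lborel) = 1"
proof -
  have "(\<integral>\<^sup>+x. ennreal (heat_kernel t (x - y)) \<partial>lborel) = (\<integral>\<^sup>+x. ennreal (heat_kernel t (x :: 'a)) \<partial>lborel)"
    using nn_integral_lborel_translate[of "\<lambda>x. ennreal (heat_kernel t x)" "-y"] by simp
  also have "\<dots> = (\<integral>\<^sup>+(x::'a). ennreal ((4 * pi * t) powr (- (DIM('a) / 2))) * ennreal (exp (- (1 / (4 * t) * (norm x)\<^sup>2))) \<partial>lborel)"
    by (intro nn_integral_cong) (simp add: heat_kernel_def ennreal_mult'[symmetric])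
  also have "\<dots> = 1"
    using nn_integral_gaussian[of "1 / (4 * t)", where 'a = 'a] assms
    by (subst nn_integral_cmult) (measurable, simp add: ennreal_mult'[symmetric] powr_add[symmetric] mult_ac)
  finally show ?thesis .
qed

text \<open>The semigroup law, by completing the square in \<open>y\<close>: the product is a
  Gaussian in \<open>y\<close> centred at \<open>m *\<^sub>R x\<close> times a factor that depends
  on \<open>x\<close> only.\<close>

lemma heat_kernel_convolution:
  assumes "t > 0" "r > 0"
  shows "(\<integral>\<^sup>+y. ennreal (heat_kernel t (x - y :: 'a::euclidean_space) * heat_kernel r y) \<partial>lborel) = ennreal (heat_kernel (t + r) x)"
proof -
  \<comment> \<open>\<open>b\<close> is the sum of \<open>1 / (4 * t)\<close> and
    \<open>1 / (4 * r)\<close>, the coefficients of the two squares, and \<open>m\<close> is the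
    share of the first one in it.\<close>
  define m where "m = r / (t + r)"
  define b where "b = (t + r) / (4 * t * r)"
  have b: "b > 0" using assms by (simp add: b_def)
  have sq: "(norm (x - y))\<^sup>2 / (4 * t) + (norm y)\<^sup>2 / (4 * r) = (norm x)\<^sup>2 / (4 * (t + r)) + b * (norm (y - m *\<^sub>R x))\<^sup>2" for y
  proof -
    have "(norm (x - y))\<^sup>2 = (norm x)\<^sup>2 - 2 * (x \<bullet> y) + (norm y)\<^sup>2"
      "(norm (y - m *\<^sub>R x))\<^sup>2 = (norm y)\<^sup>2 - 2 * m * (x \<bullet> y) + m\<^sup>2 * (norm x)\<^sup>2"
      unfolding power2_norm_eq_inner
      by (simp_all add: inner_diff inner_commute[of y x] power2_eq_square[of m] algebra_simps)
    moreover have "(X - 2 * P + Y) / (4 * t) + Y / (4 * r) = X / (4 * (t + r)) + b * (Y - 2 * m * P + m\<^sup>2 * X)" for X Y P :: real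
    proof -
      have "t + r \<noteq> 0" using assms by auto
      then show ?thesis
        using assms by (simp add: m_def b_def divide_simps power2_eq_square) algebra
    qed
    ultimately show ?thesis by simp
  qed
  define K where "K = (4 * pi * t) powr (- (DIM('a) / 2)) * (4 * pi * r) powr (- (DIM('a) / 2)) * exp (- ((norm x)\<^sup>2 / (4 * (t + r))))"
  have eq: "heat_kernel t (x - y) * heat_kernel r y = K * exp (- (b * (norm (y - m *\<^sub>R x))\<^sup>2))" for y
  proof -
    have "exp (- (norm (x - y))\<^sup>2 / (4 * t)) * exp (- (norm y)\<^sup>2 / (4 * r)) = exp (- ((norm x)\<^sup>2 / (4 * (t + r)))) * exp (- (b * (norm (y - m *\<^sub>R x))\<^sup>2))"
      unfolding mult_exp_exp using sq[of y] by simp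
    then show ?thesis by (simp add: heat_kernel_def K_def mult_ac)
  qed
  have "(\<integral>\<^sup>+y. ennreal (heat_kernel t (x - y) * heat_kernel r y) \<partial>lborel) = ennreal K * (\<integral>\<^sup>+y. ennreal (exp (- (b * (norm (y - m *\<^sub>R x))\<^sup>2))) \<partial>lborel)"
    unfolding eq by (subst nn_integral_cmult[symmetric]) (auto simp: K_def ennreal_mult'[symmetric])
  also have "(\<integral>\<^sup>+y. ennreal (exp (- (b * (norm (y - m *\<^sub>R x))\<^sup>2))) \<partial>lborel) = (\<integral>\<^sup>+(y::'a). ennreal (exp (- (b * (norm y)\<^sup>2))) \<partial>lborel)"
    using nn_integral_lborel_translate[of "\<lambda>y. ennreal (exp (- (b * (norm y)\<^sup>2)))" "- m *\<^sub>R x"] by simp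
  also have "\<dots> = ennreal ((pi / b) powr (DIM('a) / 2))" using b by (rule nn_integral_gaussian)
  also have "ennreal K * \<dots> = ennreal (heat_kernel (t + r) x)"
  proof -
    have "(4 * pi * t) powr (- (DIM('a) / 2)) * (4 * pi * r) powr (- (DIM('a) / 2)) * (pi / b) powr (DIM('a) / 2) = (4 * pi * (t + r)) powr (- (DIM('a) / 2))"
    proof -
      have "t + r \<noteq> 0" using assms by linarith
      then have pb: "pi / b = (4 * pi * t) * (4 * pi * r) / (4 * pi * (t + r))"
        using assms by (simp add: b_def divide_simps)
      have "u powr (- p) * v powr (- p) * (u * v / w) powr p = w powr (- p)"
        if "u > 0" "v > 0" "w > 0" for u v w p :: real
        using that by (simp add: powr_divide powr_mult powr_minus field_simps)
      then show ?thesis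
        unfolding pb using assms by (metis add_pos_pos mult_pos_pos pi_gt_zero zero_less_numeral)
    qed
    then show ?thesis
      by (simp add: K_def heat_kernel_def ennreal_mult'[symmetric] mult_ac)
  qed
  finally show ?thesis .
qed

text \<open>For fixed \<open>z\<close> the kernel is a power of \<open>t\<close> times
  \<open>exp (- (A / t))\<close> with \<open>A = (norm z)\<^sup>2 / 4\<close>, which
  \<open>nn_integral_Gamma_inverse\<close> integrates. Two ranges of \<open>q\<close> matter:
  \<open>q = - s\<close> produces the kernel of the energy, and positive \<open>q\<close> below
  \<open>DIM('a) / 2\<close> the comparison functions of the Hardy inequality.\<close>

lemma nn_integral_heat_kernel_time:
  fixes q :: real
  assumes "q < DIM('a) / 2" "z \<noteq> (0::'a::euclidean_space)"
  shows "(\<integral>\<^sup>+t\<in>{0<..}. ennreal (t powr (q - 1) * heat_kernel t z) \<partial>lborel)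
    = ennreal (pi powr (- (DIM('a) / 2)) * 4 powr (- q) * Gamma (DIM('a) / 2 - q) * norm z powr (2 * q - DIM('a)))"
proof -
  let ?\<nu> = "DIM('a) / 2"
  define A where "A = (norm z)\<^sup>2 / 4"
  have A: "A > 0" and p: "?\<nu> - q > 0" using assms by (simp_all add: A_def)
  have "(\<integral>\<^sup>+t\<in>{0<..}. ennreal (t powr (q - 1) * heat_kernel t z) \<partial>lborel)
     = (\<integral>\<^sup>+t. ennreal ((4 * pi) powr (- ?\<nu>)) * (ennreal (t powr (- (?\<nu> - q) - 1) * exp (- (A / t))) * indicator {0<..} t) \<partial>lborel)"
  proof (intro nn_integral_cong, goal_cases)
    case (1 t)
    have e1: "t powr (q - 1) * t powr (- ?\<nu>) = t powr (- (?\<nu> - q) - 1)"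
      unfolding powr_add[symmetric] by (rule arg_cong2[where f = "(powr)"]) simp_all
    have e2: "- (norm z)\<^sup>2 / (4 * t) = - (A / t)" by (simp add: A_def)
    have "t powr (q - 1) * heat_kernel t z = (4 * pi) powr (- ?\<nu>) * (t powr (- (?\<nu> - q) - 1) * exp (- (A / t)))" if "t > 0"
      unfolding heat_kernel_def e2 e1[symmetric] powr_mult[of "4 * pi" t] by (simp only: mult_ac)
    then show ?case
      by (cases "t > 0") (simp_all flip: ennreal_mult')
  qed
  also have "\<dots> = ennreal ((4 * pi) powr (- ?\<nu>)) * ennreal (Gamma (?\<nu> - q) * A powr (- (?\<nu> - q)))"
    unfolding nn_integral_Gamma_inverse[OF A p, symmetric] by (rule nn_integral_cmult) measurable
  also have "\<dots> = ennreal (pi powr (- ?\<nu>) * 4 powr (- q) * Gamma (?\<nu> - q) * norm z powr (2 * q - DIM('a)))"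
  proof -
    have g: "(x\<^sup>2 / 4) powr (- r) = x powr (- (2 * r)) * 4 powr r" if "x > 0" for x r :: real
    proof -
      have "(x\<^sup>2) powr (- r) = x powr (- (2 * r))"
        using that by (simp add: powr_powr flip: powr_numeral)
      then show ?thesis by (simp add: powr_divide powr_minus_divide)
    qed
    have e: "- (2 * (?\<nu> - q)) = 2 * q - DIM('a)" by simp
    have "A powr (- (?\<nu> - q)) = norm z powr (2 * q - DIM('a)) * 4 powr (?\<nu> - q)"
      using g[of "norm z" "?\<nu> - q"] assms(2) unfolding A_def e zero_less_norm_iff by iprover
    moreover have "4 powr (- ?\<nu>) * 4 powr (?\<nu> - q) = 4 powr (- q)"
      unfolding powr_add[symmetric] by simp
    ultimately have "(4 * pi) powr (- ?\<nu>) * (Gamma (?\<nu> - q) * A powr (- (?\<nu> - q))) = pi powr (- ?\<nu>) * 4 powr (- q) * Gamma (?\<nu> - q) * norm z powr (2 * q - DIM('a))"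
      unfolding powr_mult by algebra
    then show ?thesis
      by (metis ennreal_mult' powr_ge_zero)
  qed
  finally show ?thesis .
qed

section \<open>Fractional integrals in the time variable\<close>

lemma nn_integral_power_tail:
  fixes s \<delta> :: real
  assumes "s > 0" "\<delta> > 0"
  shows "(\<integral>\<^sup>+t\<in>{\<delta>..}. ennreal (t powr (- 1 - s)) \<partial>lborel) = ennreal (\<delta> powr (- s) / s)"
proof -
  have "((\<lambda>t. - (t powr (- s) / s)) \<longlongrightarrow> - (0 / s)) at_top"
    using assms by (intro tendsto_intros tendsto_neg_powr filterlim_ident) auto
  moreover have "((\<lambda>t. - (t powr (- s) / s)) has_real_derivative x powr (- 1 - s)) (at x)" if "x \<ge> \<delta>" for x
  proof -
    have "((\<lambda>t. t powr (- s)) has_real_derivative - s * x powr (- s - 1)) (at x)"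
      using that assms by (intro has_real_derivative_powr) auto
    from DERIV_cmult[OF this, of "- 1 / s"] show ?thesis
      using assms by (simp add: minus_diff_commute)
  qed
  ultimately have "(\<integral>\<^sup>+t\<in>{\<delta>..}. ennreal (t powr (- 1 - s)) \<partial>lborel) = ennreal (- (0 / s) - - (\<delta> powr (- s) / s))"
    by (intro nn_integral_FTC_atLeast) auto
  then show ?thesis by simp
qed

lemma nn_integral_Beta_scaled:
  fixes a b r :: real
  assumes "a > 0" "b > 0" "r > 0"
  shows "(\<integral>\<^sup>+t\<in>{0<..<r}. ennreal (t powr (a - 1) * (r - t) powr (b - 1)) \<partial>lborel) = ennreal (Beta a b * r powr (a + b - 1))"
proof -
  have "(\<integral>\<^sup>+t\<in>{0<..<r}. ennreal (t powr (a - 1) * (r - t) powr (b - 1)) \<partial>lborel)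
    = ennreal \<bar>r\<bar> * (\<integral>\<^sup>+t. ennreal ((0 + r * t) powr (a - 1) * (r - (0 + r * t)) powr (b - 1)) * indicator {0<..<r} (0 + r * t) \<partial>lborel)"
    using assms by (subst nn_integral_real_affine[where c = r and t = 0]) auto
  also have "\<dots> = ennreal r * (\<integral>\<^sup>+t. ennreal (r powr (a - 1) * r powr (b - 1)) * (ennreal (t powr (a - 1) * (1 - t) powr (b - 1)) * indicator {0..1} t) \<partial>lborel)"
  proof -
    have "ennreal ((0 + r * t) powr (a - 1) * (r - (0 + r * t)) powr (b - 1)) * indicator {0<..<r} (0 + r * t)
      = ennreal (r powr (a - 1) * r powr (b - 1)) * (ennreal (t powr (a - 1) * (1 - t) powr (b - 1)) * indicator {0..1} t)"
      if "t \<noteq> 0" "t \<noteq> 1" for t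
    proof (cases "0 < t \<and> t < 1")
      case True
      have "r - (0 + r * t) = r * (1 - t)" by (simp add: algebra_simps)
      then have "(0 + r * t) powr (a - 1) * (r - (0 + r * t)) powr (b - 1) = (r powr (a - 1) * r powr (b - 1)) * (t powr (a - 1) * (1 - t) powr (b - 1))"
        by (simp add: powr_mult)
      then show ?thesis using True assms by (simp add: ennreal_mult')
    next
      case False
      then have "0 + r * t \<notin> {0<..<r}" "t \<notin> {0..1}"
        using assms that by (auto simp: zero_less_mult_iff)
      then show ?thesis by simp
    qed
    moreover have "AE t in lborel. t \<noteq> (0::real)" "AE t in lborel. t \<noteq> (1::real)"
      by (rule AE_lborel_singleton)+
    ultimately have "(\<integral>\<^sup>+t. ennreal ((0 + r * t) powr (a - 1) * (r - (0 + r * t)) powr (b - 1)) * indicator {0<..<r} (0 + r * t) \<partial>lborel)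
      = (\<integral>\<^sup>+t. ennreal (r powr (a - 1) * r powr (b - 1)) * (ennreal (t powr (a - 1) * (1 - t) powr (b - 1)) * indicator {0..1} t) \<partial>lborel)"
      by (intro nn_integral_cong_AE) (auto elim: eventually_elim2)
    then show ?thesis using assms by simp
  qed
  also have "\<dots> = ennreal r * (ennreal (r powr (a - 1) * r powr (b - 1)) * ennreal (Beta a b))"
    using nn_integral_has_integral_lebesgue'[OF _ has_integral_Beta_real[OF assms(1,2)]]
    by (subst nn_integral_cmult) auto
  also have "\<dots> = ennreal (Beta a b * r powr (a + b - 1))"
  proof -
    have "r * (r powr (a - 1) * r powr (b - 1)) = r powr 1 * (r powr (a - 1) * r powr (b - 1))"
      using assms by simp
    also have "\<dots> = r powr (1 + ((a - 1) + (b - 1)))" by (simp only: powr_add)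
    also have "1 + ((a - 1) + (b - 1)) = a + b - 1" by simp
    finally have e: "r * (r powr (a - 1) * r powr (b - 1)) * Beta a b = Beta a b * r powr (a + b - 1)"
      by (simp only: mult.commute)
    have "ennreal r * (ennreal (r powr (a - 1) * r powr (b - 1)) * ennreal (Beta a b)) = ennreal (r * (r powr (a - 1) * r powr (b - 1)) * Beta a b)"
      using assms by (simp flip: ennreal_mult' add: mult.assoc)
    then show ?thesis unfolding e .
  qed
  finally show ?thesis .
qed

text \<open>The derivative of \<open>- t\<^sup>-\<^sup>s (r - t)\<^sup>b / (s r)\<close> is the sum of the two integrands.\<close>

lemma nn_integral_power_kernel_le:
  fixes s b \<delta> r :: real
  assumes "0 < s" "s < b" "0 < \<delta>" "0 < r"
  shows "(\<integral>\<^sup>+t\<in>{\<delta>..<r}. ennreal (t powr (- 1 - s) * (r - t) powr (b - 1)) \<partial>lborel)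
     + ennreal ((b - s) / (s * r)) * (\<integral>\<^sup>+t\<in>{\<delta>..<r}. ennreal (t powr (- s) * (r - t) powr (b - 1)) \<partial>lborel)
     \<le> ennreal (r powr (b - 1)) * ennreal (\<delta> powr (- s) / s)"
proof (cases "\<delta> < r")
  case False
  then show ?thesis by simp
next
  case True
  define F where "F t = - (t powr (- s) * (r - t) powr b / (s * r))" for t
  define f where "f t = t powr (- 1 - s) * (r - t) powr (b - 1) + (b - s) / (s * r) * (t powr (- s) * (r - t) powr (b - 1))" for t
  have f0: "f t \<ge> 0" for t using assms by (auto simp: f_def intro!: add_nonneg_nonneg)
  have "(f has_integral (F r - F \<delta>)) {\<delta>..r}"
  \<comment> \<open>For \<open>b < 1\<close> the derivative of \<open>F\<close> is singular at
    \<open>t = r\<close>; continuity on the closed interval and differentiability in its interior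
    suffice.\<close>
  proof (rule fundamental_theorem_of_calculus_interior)
    show "\<delta> \<le> r" using True by simp
    have "isCont F t" if "\<delta> \<le> t" "t < r" for t
      unfolding F_def using that assms by (intro continuous_intros) auto
    moreover have "continuous_on {\<delta>..r} F"
      unfolding F_def using assms by (intro continuous_intros continuous_on_powr') auto
    ultimately show "continuous_on {\<delta>..r} F" by simp
    fix t assume t: "t \<in> {\<delta><..<r}"
    have t0: "t > 0" "r - t > 0" using t assms by auto
    have 1: "((\<lambda>t. t powr (- s)) has_real_derivative - s * t powr (- s - 1)) (at t)"
      using t0 by (intro has_real_derivative_powr) auto
    have 2: "((\<lambda>t. (r - t) powr b) has_real_derivative (b * (r - t) powr (b - 1) * (0 - 1))) (at t)"
      using t0 by (intro DERIV_chain'[of "\<lambda>t. r - t" _ _ _ "\<lambda>t. t powr b", THEN DERIV_cong] derivative_intros has_real_derivative_powr) auto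
    have "(F has_real_derivative - ((- s * t powr (- s - 1) * (r - t) powr b + b * (r - t) powr (b - 1) * (0 - 1) * t powr (- s)) / (s * r))) (at t)"
      unfolding F_def by (intro DERIV_minus DERIV_cdivide DERIV_mult 1 2)
    moreover have "- ((- s * t powr (- s - 1) * (r - t) powr b + b * (r - t) powr (b - 1) * (0 - 1) * t powr (- s)) / (s * r)) = f t"
    proof -
      define X where "X = t powr (- s - 1)"
      define Y where "Y = (r - t) powr (b - 1)"
      have e1: "t powr (- s) = t * X" unfolding X_def using t0 by (simp add: powr_diff)
      have e2: "(r - t) powr b = (r - t) * Y" unfolding Y_def using t0 by (simp add: powr_diff)
      have e3: "t powr (- 1 - s) = X" unfolding X_def by (simp add: minus_diff_commute)
      show ?thesis unfolding f_def e1 e2 e3 Y_def[symmetric] X_def[symmetric]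
        using assms by (simp add: divide_simps) (simp add: algebra_simps)
    qed
    ultimately show "(F has_vector_derivative f t) (at t)"
      by (simp add: has_real_derivative_iff_has_vector_derivative)
  qed
  then have I: "(\<integral>\<^sup>+t\<in>{\<delta>..r}. ennreal (f t) \<partial>lborel) = ennreal (F r - F \<delta>)"
    by (rule nn_integral_has_integral_lebesgue'[rotated]) (rule f0)
  have "(\<integral>\<^sup>+t\<in>{\<delta>..<r}. ennreal (t powr (- 1 - s) * (r - t) powr (b - 1)) \<partial>lborel)
     + ennreal ((b - s) / (s * r)) * (\<integral>\<^sup>+t\<in>{\<delta>..<r}. ennreal (t powr (- s) * (r - t) powr (b - 1)) \<partial>lborel)
     = (\<integral>\<^sup>+t\<in>{\<delta>..<r}. ennreal (f t) \<partial>lborel)"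
    unfolding f_def using assms
    by (subst nn_integral_cmult[symmetric], (measurable)[1], subst nn_integral_add[symmetric], (measurable)[2],
        intro nn_integral_cong, case_tac "x \<in> {\<delta>..<r}")
       (simp_all flip: ennreal_mult' ennreal_plus)
  also have "\<dots> \<le> (\<integral>\<^sup>+t\<in>{\<delta>..r}. ennreal (f t) \<partial>lborel)"
    by (rule nn_set_integral_set_mono) auto
  also have "\<dots> = ennreal (\<delta> powr (- s) * (r - \<delta>) powr b / (s * r))"
    unfolding I using assms by (simp add: F_def)
  also have "\<dots> \<le> ennreal (r powr (b - 1) * (\<delta> powr (- s) / s))"
  proof (rule ennreal_leI)
    \<comment> \<open>Replacing \<open>r - \<delta>\<close> by \<open>r\<close> is the loss due to
      the truncation. For fixed \<open>r\<close> it is of order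
      \<open>\<delta> powr (1 - s)\<close>, so for \<open>s < 1\<close> nothing is lost as \<delta>
      tends to 0.\<close>
    have "(r - \<delta>) powr b \<le> r powr b" using assms True by (intro powr_mono2) auto
    also have "r powr b = r powr (b - 1) * r" using assms by (simp add: powr_diff)
    finally have "(\<delta> powr (- s) / (s * r)) * (r - \<delta>) powr b \<le> (\<delta> powr (- s) / (s * r)) * (r powr (b - 1) * r)"
      using assms by (intro mult_left_mono) auto
    then show "\<delta> powr (- s) * (r - \<delta>) powr b / (s * r) \<le> r powr (b - 1) * (\<delta> powr (- s) / s)"
      using assms by (simp add: mult_ac)
  qed
  also have "\<dots> = ennreal (r powr (b - 1)) * ennreal (\<delta> powr (- s) / s)"
    by (rule ennreal_mult') simp
  finally show ?thesis .
qed

text \<open>Monotone convergence along \<open>\<delta> = 1 / (n + 1)\<close>, whose intervals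
  exhaust \<open>{0<..<r}\<close>. The exponent is now \<open>- s\<close> instead of
  \<open>- 1 - s\<close>, hence integrable down to 0; this is what the integration by parts behind
  \<open>nn_integral_power_kernel_le\<close> gains.\<close>

lemma nn_integral_power_kernel_SUP:
  fixes s b r :: real
  assumes "s < 1" "0 < b" "0 < r"
  shows "(SUP n. \<integral>\<^sup>+t\<in>{1 / real (Suc n)..<r}. ennreal (t powr (- s) * (r - t) powr (b - 1)) \<partial>lborel)
     = ennreal (Beta (1 - s) b * r powr (b - s))"
proof -
  let ?f = "\<lambda>t. ennreal (t powr (- s) * (r - t) powr (b - 1))"
  have "(SUP n. \<integral>\<^sup>+t\<in>{1 / real (Suc n)..<r}. ?f t \<partial>lborel) = (\<integral>\<^sup>+t. (SUP n. ?f t * indicator {1 / real (Suc n)..<r} t) \<partial>lborel)"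
  proof (rule nn_integral_monotone_convergence_SUP[symmetric])
    have le: "1 / real (Suc n) \<le> 1 / real (Suc m)" if "m \<le> n" for m n :: nat
      using that by (intro divide_left_mono) auto
    show "incseq (\<lambda>n t. ?f t * indicator {1 / real (Suc n)..<r} t)"
      unfolding incseq_def le_fun_def by (intro allI impI mult_left_mono indicator_leI)
        (auto simp del: of_nat_Suc intro: order_trans[OF le])
  qed measurable
  also have "\<dots> = (\<integral>\<^sup>+t\<in>{0<..<r}. ?f t \<partial>lborel)"
  proof (intro nn_integral_cong)
    fix t
    have "(SUP n. indicator {1 / real (Suc n)..<r} t) = (indicator {0<..<r} t :: ennreal)"
    proof (cases "0 < t \<and> t < r")
      case True
      then obtain n where "1 / real (Suc n) < t" using nat_approx_posE by blast
      then have "indicator {1 / real (Suc n)..<r} t = (1::ennreal)" using True by auto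
      then have "(SUP n. indicator {1 / real (Suc n)..<r} t) \<ge> (1::ennreal)"
        by (intro SUP_upper2[of n]) (simp_all only: UNIV_I order.refl)
      moreover have "(SUP n. indicator {1 / real (Suc n)..<r} t) \<le> (1::ennreal)"
        by (intro SUP_least) (auto simp: indicator_def)
      ultimately show ?thesis using True by auto
    next
      case False
      have "1 / real (Suc n) > 0" for n by simp
      then have "t \<notin> {1 / real (Suc n)..<r}" for n using False
        by (smt (verit) atLeastLessThan_iff)
      then have "indicator {1 / real (Suc n)..<r} t = (0::ennreal)" for n by simp
      then have "(SUP n. indicator {1 / real (Suc n)..<r} t) = (0::ennreal)" by simp
      then show ?thesis using False by auto
    qed
    then show "(SUP n. ?f t * indicator {1 / real (Suc n)..<r} t) = ?f t * indicator {0<..<r} t"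
      by (simp only: SUP_mult_left_ennreal[symmetric])
  qed
  also have "\<dots> = ennreal (Beta (1 - s) b * r powr (b - s))"
    using nn_integral_Beta_scaled[of "1 - s" b r] assms by (simp add: add.commute[of b] diff_add_eq)
  finally show ?thesis .
qed

text \<open>Fubini's theorem is applied on regions such as
  \<open>{(r, t). \<delta> \<le> t \<and> t < r}\<close>, so the ends of the interval have to be
  allowed to vary with the point.\<close>

lemma indicator_atLeastLessThan_measurable:
  fixes f g h :: "'b \<Rightarrow> real"
  assumes [measurable]: "f \<in> borel_measurable M" "g \<in> borel_measurable M" "h \<in> borel_measurable M"
  shows "(\<lambda>x. indicator {g x..<f x} (h x) :: ennreal) \<in> borel_measurable M"
  by (rule borel_measurable_indicator') (unfold atLeastLessThan_iff, measurable)

lemma indicator_greaterThan_measurable: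
  fixes g h :: "'b \<Rightarrow> real"
  assumes [measurable]: "g \<in> borel_measurable M" "h \<in> borel_measurable M"
  shows "(\<lambda>x. indicator {g x<..} (h x) :: ennreal) \<in> borel_measurable M"
  by (rule borel_measurable_indicator') (unfold greaterThan_iff, measurable)

section \<open>The Hardy inequality\<close>

text \<open>The constant in front of the power of \<open>norm x\<close> makes the weight equal to \<open>\<integral>\<^sub>0\<^sup>\<infinity> t\<^sup>b\<^sup>-\<^sup>1 p\<^sub>t(x) dt\<close>, which turns its heat flow into a shift of the time variable.\<close>

definition hardy_weight :: "real \<Rightarrow> 'a::euclidean_space \<Rightarrow> real" where
  "hardy_weight b x = pi powr (- (DIM('a) / 2)) * 4 powr (- b) * Gamma (DIM('a) / 2 - b) * norm x powr (2 * b - real DIM('a))"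

lemma hardy_weight_measurable [measurable]: "hardy_weight b \<in> borel_measurable borel"
  unfolding hardy_weight_def by measurable

lemma hardy_weight_pos: "b < real DIM('a) / 2 \<Longrightarrow> x \<noteq> (0::'a::euclidean_space) \<Longrightarrow> hardy_weight b x > 0"
  unfolding hardy_weight_def by (intro mult_pos_pos) (auto intro: Gamma_real_pos)

lemma hardy_weight_nonneg: "b < real DIM('a) / 2 \<Longrightarrow> hardy_weight b (x::'a::euclidean_space) \<ge> 0"
  using hardy_weight_pos[of b x] by (cases "x = 0") (auto simp: hardy_weight_def)

lemma hardy_weight_heat:
  assumes "b < real DIM('a) / 2" "x \<noteq> (0::'a::euclidean_space)"
  shows "(\<integral>\<^sup>+t\<in>{0<..}. ennreal (t powr (b - 1) * heat_kernel t x) \<partial>lborel) = ennreal (hardy_weight b x)"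
  using nn_integral_heat_kernel_time[OF assms] unfolding hardy_weight_def .

text \<open>Convolution with the heat kernel at time \<open>t\<close> takes the kernel at time
  \<open>r\<close> to the one at time \<open>r + t\<close>, so after Fubini the density
  \<open>r powr (b - 1)\<close> is merely shifted.\<close>

lemma hardy_weight_heat_flow:
  fixes x :: "'a::euclidean_space"
  assumes "b < real DIM('a) / 2" "t > 0"
  shows "(\<integral>\<^sup>+y. ennreal (heat_kernel t (x - y) * hardy_weight b y) \<partial>lborel)
    = (\<integral>\<^sup>+r\<in>{t<..}. ennreal ((r - t) powr (b - 1) * heat_kernel r x) \<partial>lborel)"
proof -
  have "(\<integral>\<^sup>+y. ennreal (heat_kernel t (x - y) * hardy_weight b y) \<partial>lborel)
     = (\<integral>\<^sup>+y. (\<integral>\<^sup>+r. ennreal (r powr (b - 1)) * indicator {0<..} r * ennreal (heat_kernel t (x - y) * heat_kernel r y) \<partial>lborel) \<partial>lborel)"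
  proof (rule nn_integral_cong_AE, use AE_lborel_singleton[of "0::'a"] in eventually_elim)
    case (elim y)
    have "ennreal (heat_kernel t (x - y) * hardy_weight b y) = ennreal (heat_kernel t (x - y)) * (\<integral>\<^sup>+t\<in>{0<..}. ennreal (t powr (b - 1) * heat_kernel t y) \<partial>lborel)"
      unfolding hardy_weight_heat[OF assms(1) elim] by (rule ennreal_mult') simp
    also have "\<dots> = (\<integral>\<^sup>+r. ennreal (heat_kernel t (x - y)) * (ennreal (r powr (b - 1) * heat_kernel r y) * indicator {0<..} r) \<partial>lborel)"
      by (rule nn_integral_cmult[symmetric]) measurable
    also have "\<dots> = (\<integral>\<^sup>+r. ennreal (r powr (b - 1)) * indicator {0<..} r * ennreal (heat_kernel t (x - y) * heat_kernel r y) \<partial>lborel)"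
      by (intro nn_integral_cong) (simp add: ennreal_mult' mult_ac)
    finally show ?case .
  qed
  also have "\<dots> = (\<integral>\<^sup>+r. (\<integral>\<^sup>+y. ennreal (r powr (b - 1)) * indicator {0<..} r * ennreal (heat_kernel t (x - y) * heat_kernel r y) \<partial>lborel) \<partial>lborel)"
    by (rule lborel_pair.Fubini') measurable
  also have "\<dots> = (\<integral>\<^sup>+r. ennreal (((r + t) - t) powr (b - 1) * heat_kernel (r + t) x) * indicator {t<..} (r + t) \<partial>lborel)"
  proof (rule nn_integral_cong)
    fix r :: real
    have "(\<integral>\<^sup>+y. ennreal (r powr (b - 1)) * indicator {0<..} r * ennreal (heat_kernel t (x - y) * heat_kernel r y) \<partial>lborel)
      = ennreal (r powr (b - 1)) * indicator {0<..} r * (\<integral>\<^sup>+y. ennreal (heat_kernel t (x - y) * heat_kernel r y) \<partial>lborel)"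
      by (rule nn_integral_cmult) measurable
    also have "\<dots> = ennreal (((r + t) - t) powr (b - 1) * heat_kernel (r + t) x) * indicator {t<..} (r + t)"
      using heat_kernel_convolution[OF assms(2), of r x]
      by (cases "r > 0") (simp_all add: ennreal_mult' add.commute)
    finally show "(\<integral>\<^sup>+y. ennreal (r powr (b - 1)) * indicator {0<..} r * ennreal (heat_kernel t (x - y) * heat_kernel r y) \<partial>lborel)
      = ennreal (((r + t) - t) powr (b - 1) * heat_kernel (r + t) x) * indicator {t<..} (r + t)" .
  qed
  also have "\<dots> = (\<integral>\<^sup>+r\<in>{t<..}. ennreal ((r - t) powr (b - 1) * heat_kernel r x) \<partial>lborel)"
    by (rule nn_integral_lborel_translate[where f = "\<lambda>r. ennreal ((r - t) powr (b - 1) * heat_kernel r x) * indicator {t<..} r"]) measurable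
  finally show ?thesis .
qed

text \<open>A lower bound for \<open>\<integral>\<^sub>\<delta>\<^sup>\<infinity> t\<^sup>-\<^sup>1\<^sup>-\<^sup>s (w - P\<^sub>t w)(x) dt\<close>, written as a nonnegative integral.\<close>

definition hardy_remainder :: "real \<Rightarrow> real \<Rightarrow> real \<Rightarrow> 'a::euclidean_space \<Rightarrow> ennreal" where
  "hardy_remainder s b \<delta> x = (\<integral>\<^sup>+r\<in>{0<..}. ennreal (heat_kernel r x) *
     (ennreal ((b - s) / (s * r)) * (\<integral>\<^sup>+t\<in>{\<delta>..<r}. ennreal (t powr (- s) * (r - t) powr (b - 1)) \<partial>lborel)) \<partial>lborel)"

lemma power_kernel_measurable [measurable]:
  "(\<lambda>r. \<integral>\<^sup>+t\<in>{\<delta>..<r}. ennreal (t powr p * (r - t) powr q) \<partial>lborel) \<in> borel_measurable borel"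
proof (rule lborel.borel_measurable_nn_integral)
  show "(\<lambda>(r, t). ennreal (t powr p * (r - t) powr q) * indicator {\<delta>..<r} t) \<in> borel_measurable (borel \<Otimes>\<^sub>M lborel)"
    unfolding split_beta' by (intro borel_measurable_times_ennreal indicator_atLeastLessThan_measurable) measurable
qed

lemma hardy_remainder_measurable [measurable]: "hardy_remainder s b \<delta> \<in> borel_measurable borel"
proof -
  define k where "k = (\<lambda>r. \<integral>\<^sup>+t\<in>{\<delta>..<r}. ennreal (t powr (- s) * (r - t) powr (b - 1)) \<partial>lborel)"
  have [measurable]: "k \<in> borel_measurable borel"
    unfolding k_def by (rule power_kernel_measurable)
  have "hardy_remainder s b \<delta> = (\<lambda>x. \<integral>\<^sup>+r\<in>{0<..}. ennreal (heat_kernel r x) * (ennreal ((b - s) / (s * r)) * k r) \<partial>lborel)"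
    unfolding hardy_remainder_def k_def ..
  also have "\<dots> \<in> borel_measurable borel" by measurable
  finally show ?thesis .
qed

text \<open>By \<open>hardy_weight_heat_flow\<close> and Fubini, the flow term is an integral over
  \<open>r\<close> of the heat kernel against the truncated time kernel on
  \<open>{\<delta>..<r}\<close>. Adding the remainder produces, under the integral, precisely the
  left-hand side of \<open>nn_integral_power_kernel_le\<close>; the right-hand side there integrates
  to the weight itself.\<close>

lemma hardy_weight_flow_le:
  fixes x :: "'a::euclidean_space"
  assumes "0 < s" "s < b" "b < real DIM('a) / 2" "0 < \<delta>" "x \<noteq> 0"
  shows "(\<integral>\<^sup>+t\<in>{\<delta>..}. ennreal (t powr (- 1 - s)) * (\<integral>\<^sup>+y. ennreal (heat_kernel t (x - y) * hardy_weight b y) \<partial>lborel) \<partial>lborel)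
     + hardy_remainder s b \<delta> x \<le> ennreal (hardy_weight b x) * ennreal (\<delta> powr (- s) / s)"
proof -
  let ?K = "\<lambda>r. \<integral>\<^sup>+t\<in>{\<delta>..<r}. ennreal (t powr (- 1 - s) * (r - t) powr (b - 1)) \<partial>lborel"
  let ?R = "\<lambda>r. ennreal ((b - s) / (s * r)) * (\<integral>\<^sup>+t\<in>{\<delta>..<r}. ennreal (t powr (- s) * (r - t) powr (b - 1)) \<partial>lborel)"
  have "(\<integral>\<^sup>+t\<in>{\<delta>..}. ennreal (t powr (- 1 - s)) * (\<integral>\<^sup>+y. ennreal (heat_kernel t (x - y) * hardy_weight b y) \<partial>lborel) \<partial>lborel)
     = (\<integral>\<^sup>+t. (\<integral>\<^sup>+r. ennreal (heat_kernel r x) * (ennreal (t powr (- 1 - s) * (r - t) powr (b - 1)) * (indicator {\<delta>..} t * indicator {t<..} r)) \<partial>lborel) \<partial>lborel)"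
  proof (rule nn_integral_cong)
    fix t :: real
    show "ennreal (t powr (- 1 - s)) * (\<integral>\<^sup>+y. ennreal (heat_kernel t (x - y) * hardy_weight b y) \<partial>lborel) * indicator {\<delta>..} t
       = (\<integral>\<^sup>+r. ennreal (heat_kernel r x) * (ennreal (t powr (- 1 - s) * (r - t) powr (b - 1)) * (indicator {\<delta>..} t * indicator {t<..} r)) \<partial>lborel)"
    proof (cases "t \<ge> \<delta>")
      case True
      then have "t > 0" using assms by simp
      show ?thesis
        unfolding hardy_weight_heat_flow[OF assms(3) \<open>t > 0\<close>] using True
        by (simp add: nn_integral_cmult[symmetric] ennreal_mult' mult_ac del: ennreal_mult_eq_top_iff)
    qed simp
  qed
  also have "\<dots> = (\<integral>\<^sup>+r. (\<integral>\<^sup>+t. ennreal (heat_kernel r x) * (ennreal (t powr (- 1 - s) * (r - t) powr (b - 1)) * (indicator {\<delta>..} t * indicator {t<..} r)) \<partial>lborel) \<partial>lborel)"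
  proof (rule lborel_pair.Fubini')
    show "(\<lambda>(r, t). ennreal (heat_kernel r x) * (ennreal (t powr (- 1 - s) * (r - t) powr (b - 1)) * (indicator {\<delta>..} t * indicator {t<..} r))) \<in> borel_measurable (lborel \<Otimes>\<^sub>M lborel)"
      unfolding split_beta' by (intro borel_measurable_times_ennreal indicator_greaterThan_measurable) measurable
  qed
  also have "\<dots> = (\<integral>\<^sup>+r\<in>{0<..}. ennreal (heat_kernel r x) * ?K r \<partial>lborel)"
  proof (rule nn_integral_cong)
    fix r :: real
    \<comment> \<open>Since \<delta> is positive, \<open>\<delta> \<le> t < r\<close> already forces
      \<open>r > 0\<close>.\<close>
    have i: "indicator {\<delta>..} t * indicator {t<..} r = (indicator {\<delta>..<r} t * indicator {0<..} r :: ennreal)" for t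
      using assms(4) by (auto simp: indicator_def)
    have "(\<integral>\<^sup>+t. ennreal (heat_kernel r x) * (ennreal (t powr (- 1 - s) * (r - t) powr (b - 1)) * (indicator {\<delta>..} t * indicator {t<..} r)) \<partial>lborel)
      = (\<integral>\<^sup>+t. (ennreal (heat_kernel r x) * indicator {0<..} r) * (ennreal (t powr (- 1 - s) * (r - t) powr (b - 1)) * indicator {\<delta>..<r} t) \<partial>lborel)"
      unfolding i by (simp only: mult_ac)
    also have "\<dots> = (ennreal (heat_kernel r x) * indicator {0<..} r) * ?K r"
      by (rule nn_integral_cmult) measurable
    finally show "(\<integral>\<^sup>+t. ennreal (heat_kernel r x) * (ennreal (t powr (- 1 - s) * (r - t) powr (b - 1)) * (indicator {\<delta>..} t * indicator {t<..} r)) \<partial>lborel)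
      = ennreal (heat_kernel r x) * ?K r * indicator {0<..} r" by (simp only: mult_ac)
  qed
  finally have flow: "(\<integral>\<^sup>+t\<in>{\<delta>..}. ennreal (t powr (- 1 - s)) * (\<integral>\<^sup>+y. ennreal (heat_kernel t (x - y) * hardy_weight b y) \<partial>lborel) \<partial>lborel)
     = (\<integral>\<^sup>+r\<in>{0<..}. ennreal (heat_kernel r x) * ?K r \<partial>lborel)" .
  have "(\<integral>\<^sup>+t\<in>{\<delta>..}. ennreal (t powr (- 1 - s)) * (\<integral>\<^sup>+y. ennreal (heat_kernel t (x - y) * hardy_weight b y) \<partial>lborel) \<partial>lborel)
     + hardy_remainder s b \<delta> x = (\<integral>\<^sup>+r\<in>{0<..}. ennreal (heat_kernel r x) * (?K r + ?R r) \<partial>lborel)"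
  proof -
    define K R where "K = ?K" and "R = ?R"
    have [measurable]: "K \<in> borel_measurable borel"
      unfolding K_def by (rule power_kernel_measurable)
    have [measurable]: "R \<in> borel_measurable borel"
      unfolding R_def by (intro borel_measurable_times_ennreal power_kernel_measurable) measurable
    have "(\<integral>\<^sup>+r\<in>{0<..}. ennreal (heat_kernel r x) * K r \<partial>lborel) + (\<integral>\<^sup>+r\<in>{0<..}. ennreal (heat_kernel r x) * R r \<partial>lborel)
      = (\<integral>\<^sup>+r\<in>{0<..}. ennreal (heat_kernel r x) * (K r + R r) \<partial>lborel)"
      by (subst nn_integral_add[symmetric]) (measurable, simp only: distrib_left distrib_right)
    then show ?thesis
      unfolding hardy_remainder_def flow K_def R_def .
  qed
  also have "\<dots> \<le> (\<integral>\<^sup>+r\<in>{0<..}. ennreal (heat_kernel r x) * (ennreal (r powr (b - 1)) * ennreal (\<delta> powr (- s) / s)) \<partial>lborel)"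
  proof (rule nn_integral_mono)
    fix r :: real
    show "ennreal (heat_kernel r x) * (?K r + ?R r) * indicator {0<..} r \<le> ennreal (heat_kernel r x) * (ennreal (r powr (b - 1)) * ennreal (\<delta> powr (- s) / s)) * indicator {0<..} r"
      using nn_integral_power_kernel_le[OF assms(1,2,4), of r]
      by (cases "r > 0") (auto intro: mult_left_mono)
  qed
  also have "\<dots> = (\<integral>\<^sup>+r. ennreal (\<delta> powr (- s) / s) * (ennreal (r powr (b - 1) * heat_kernel r x) * indicator {0<..} r) \<partial>lborel)"
  proof (rule nn_integral_cong)
    fix r :: real
    have "ennreal (r powr (b - 1) * heat_kernel r x) = ennreal (r powr (b - 1)) * ennreal (heat_kernel r x)"
      by (rule ennreal_mult') simp
    then show "ennreal (heat_kernel r x) * (ennreal (r powr (b - 1)) * ennreal (\<delta> powr (- s) / s)) * indicator {0<..} r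
      = ennreal (\<delta> powr (- s) / s) * (ennreal (r powr (b - 1) * heat_kernel r x) * indicator {0<..} r)"
      by (simp only: mult_ac)
  qed
  also have "\<dots> = ennreal (\<delta> powr (- s) / s) * (\<integral>\<^sup>+r\<in>{0<..}. ennreal (r powr (b - 1) * heat_kernel r x) \<partial>lborel)"
    by (rule nn_integral_cmult) measurable
  also have "\<dots> = ennreal (\<delta> powr (- s) / s) * ennreal (hardy_weight b x)"
    by (simp only: hardy_weight_heat[OF assms(3,5)])
  also have "\<dots> = ennreal (hardy_weight b x) * ennreal (\<delta> powr (- s) / s)"
    by (rule mult.commute)
  finally show ?thesis .
qed

text \<open>As \<delta> tends to 0 the inner integral increases to
  \<open>Beta (1 - s) b * r powr (b - s)\<close>. The prefactor contributes another
  \<open>1 / r\<close>, and the resulting \<open>r powr (b - s - 1)\<close> is the density that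
  generates the weight with parameter \<open>b - s\<close>. Thus the limit is again an explicit
  power of \<open>norm x\<close>, differing from the weight with parameter \<open>b\<close> by a
  multiple of \<open>norm x powr (- (2 * s))\<close>.\<close>

lemma hardy_remainder_SUP:
  fixes x :: "'a::euclidean_space"
  assumes "0 < s" "s < 1" "s < b" "b < real DIM('a) / 2" "x \<noteq> 0"
  shows "(SUP n. hardy_remainder s b (1 / real (Suc n)) x) = ennreal ((b - s) / s * Beta (1 - s) b * hardy_weight (b - s) x)"
proof -
  let ?k = "\<lambda>n r. \<integral>\<^sup>+t\<in>{1 / real (Suc n)..<r}. ennreal (t powr (- s) * (r - t) powr (b - 1)) \<partial>lborel"
  let ?c = "\<lambda>r. indicator {0<..} r * ennreal (heat_kernel r x) * ennreal ((b - s) / (s * r))"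
  have le: "1 / real (Suc n) \<le> 1 / real (Suc m)" if "m \<le> n" for m n :: nat
    using that by (intro divide_left_mono) auto
  have mono: "?k m r \<le> ?k n r" if "m \<le> n" for m n r
    using le[OF that] by (intro nn_set_integral_set_mono) (auto simp del: of_nat_Suc)
  have "(SUP n. hardy_remainder s b (1 / real (Suc n)) x) = (SUP n. \<integral>\<^sup>+r. ?c r * ?k n r \<partial>lborel)"
    unfolding hardy_remainder_def by (simp only: mult_ac)
  also have "\<dots> = (\<integral>\<^sup>+r. (SUP n. ?c r * ?k n r) \<partial>lborel)"
  proof (rule nn_integral_monotone_convergence_SUP[symmetric])
    show "incseq (\<lambda>n r. ?c r * ?k n r)"
      unfolding incseq_def le_fun_def by (intro allI impI mult_left_mono mono) auto
    show "(\<lambda>r. ?c r * ?k n r) \<in> borel_measurable lborel" for n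
      unfolding measurable_lborel1
      by (intro borel_measurable_times_ennreal power_kernel_measurable) measurable
  qed
  also have "\<dots> = (\<integral>\<^sup>+r. ennreal ((b - s) / s * Beta (1 - s) b) * (ennreal (r powr (b - s - 1) * heat_kernel r x) * indicator {0<..} r) \<partial>lborel)"
  proof (rule nn_integral_cong)
    fix r :: real
    show "(SUP n. ?c r * ?k n r) = ennreal ((b - s) / s * Beta (1 - s) b) * (ennreal (r powr (b - s - 1) * heat_kernel r x) * indicator {0<..} r)"
    proof (cases "r > 0")
      case True
      have e: "r powr (b - s) = r powr (b - s - 1) * r"
        using True by (simp add: powr_diff)
      have "heat_kernel r x * ((b - s) / (s * r)) * (Beta (1 - s) b * r powr (b - s)) = (b - s) / s * Beta (1 - s) b * (r powr (b - s - 1) * heat_kernel r x)"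
        unfolding e using True assms by (simp add: field_simps)
      moreover have B: "Beta (1 - s) b > 0"
        using assms unfolding Beta_def by (intro divide_pos_pos mult_pos_pos) (auto intro: Gamma_real_pos)
      moreover have "(SUP n. ?c r * ?k n r) = ?c r * (SUP n. ?k n r)"
        by (rule SUP_mult_left_ennreal[symmetric])
      moreover have "(SUP n. ?k n r) = ennreal (Beta (1 - s) b * r powr (b - s))"
        by (rule nn_integral_power_kernel_SUP) (use assms True in auto)
      moreover have "?c r * ennreal (Beta (1 - s) b * r powr (b - s)) = ennreal (heat_kernel r x * ((b - s) / (s * r)) * (Beta (1 - s) b * r powr (b - s)))"
      proof -
        have "0 \<le> heat_kernel r x * ((b - s) / (s * r))"
          using True assms by (intro mult_nonneg_nonneg divide_nonneg_nonneg) auto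
        then show ?thesis
          using True by (subst ennreal_mult') (simp_all add: ennreal_mult' del: times_divide_eq_right)
      qed
      ultimately have "(SUP n. ?c r * ?k n r) = ennreal ((b - s) / s * Beta (1 - s) b * (r powr (b - s - 1) * heat_kernel r x))"
        by (simp only:)
      also have "\<dots> = ennreal ((b - s) / s * Beta (1 - s) b) * ennreal (r powr (b - s - 1) * heat_kernel r x)"
        using assms B by (intro ennreal_mult' mult_nonneg_nonneg) auto
      finally show ?thesis
        using True by (simp only: greaterThan_iff indicator_simps mult_1_right)
    qed simp
  qed
  also have "\<dots> = ennreal ((b - s) / s * Beta (1 - s) b) * (\<integral>\<^sup>+r\<in>{0<..}. ennreal (r powr (b - s - 1) * heat_kernel r x) \<partial>lborel)"
    by (rule nn_integral_cmult) measurable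
  also have "\<dots> = ennreal ((b - s) / s * Beta (1 - s) b) * ennreal (hardy_weight (b - s) x)"
    using hardy_weight_heat[of "b - s" x] assms by simp
  also have "\<dots> = ennreal ((b - s) / s * Beta (1 - s) b * hardy_weight (b - s) x)"
    using assms by (intro ennreal_mult''[symmetric] hardy_weight_nonneg) auto
  finally show ?thesis .
qed

section \<open>The energy and its heat representation\<close>

text \<open>Values in \<open>ennreal\<close> and iterated integrals keep the later uses of Fubini,
  monotone convergence and Fatou free of integrability conditions; \<open>Ds2_norm_sq\<close>
  translates back to the norm.\<close>

definition energy :: "real \<Rightarrow> ('a::euclidean_space \<Rightarrow> real) \<Rightarrow> ennreal" where
  "energy s u = (\<integral>\<^sup>+x. \<integral>\<^sup>+y. ennreal ((u x - u y)\<^sup>2 / norm (x - y) powr (real DIM('a) + 2 * s)) \<partial>lborel \<partial>lborel)"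

definition heat_energy :: "real \<Rightarrow> ('a::euclidean_space \<Rightarrow> real) \<Rightarrow> ennreal" where
  "heat_energy t u = (\<integral>\<^sup>+x. \<integral>\<^sup>+y. ennreal ((u x - u y)\<^sup>2 * heat_kernel t (x - y)) \<partial>lborel \<partial>lborel)"

text \<open>Up to the factor \<open>s / (2 * Gamma (1 - s))\<close>, the normalising constant is
  exactly what \<open>nn_integral_heat_kernel_time\<close> yields at \<open>q = - s\<close>, because
  \<open>Gamma (2 - s) = (1 - s) * Gamma (1 - s)\<close>.\<close>

lemma C_Ns_half:
  assumes "0 < s" "s < 1"
  shows "C_Ns N s / 2 = s / (2 * Gamma (1 - s)) * (pi powr (- (real N / 2)) * 4 powr s * Gamma (real N / 2 + s))"
proof -
  have "Gamma (2 - s) = (1 - s) * Gamma (1 - s)"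
    using Gamma_plus1[of "1 - s"] assms nonpos_Ints_nonpos[of "1 - s"] by fastforce
  moreover have "(2::real) powr (2 * s) = 4 powr s"
    using powr_powr[of 2 2 s] by simp
  moreover have "(real N + 2 * s) / 2 = real N / 2 + s" by (simp add: add_divide_distrib)
  moreover define g where "g = Gamma (1 - s)"
  moreover have "g > 0" unfolding g_def using assms by (intro Gamma_real_pos) simp
  moreover define h where "h = Gamma (real N / 2 + s)"
  ultimately have "C_Ns N s / 2 = pi powr (- real N / 2) * 4 powr s * (h / ((1 - s) * g)) * s * (1 - s) / 2"
    unfolding C_Ns_def by (simp only:)
  also have "\<dots> = s / (2 * g) * (pi powr (- (real N / 2)) * 4 powr s * h)"
    using assms \<open>g > 0\<close> by (simp add: divide_simps)
  finally show ?thesis unfolding g_def h_def .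
qed

text \<open>Pointwise, the kernel of the energy is a time integral of heat kernels: off the diagonal
  by \<open>nn_integral_heat_kernel_time\<close> at \<open>q = - s\<close>, while on the diagonal
  both sides vanish with the numerator. Fubini then moves the time integral outside, past
  \<open>y\<close> and past \<open>x\<close>.\<close>

lemma energy_heat:
  fixes u :: "'a::euclidean_space \<Rightarrow> real"
  assumes s: "0 < s" "s < 1" and [measurable]: "u \<in> borel_measurable borel"
  shows "ennreal (C_Ns DIM('a) s / 2) * energy s u
    = ennreal (s / (2 * Gamma (1 - s))) * (\<integral>\<^sup>+t\<in>{0<..}. ennreal (t powr (- 1 - s)) * heat_energy t u \<partial>lborel)"
proof -
  define c where "c = pi powr (- (real DIM('a) / 2)) * 4 powr s * Gamma (real DIM('a) / 2 + s)"
  define F where "F t x y = ennreal (t powr (- 1 - s)) * indicator {0<..} t * ennreal ((u x - u y)\<^sup>2 * heat_kernel t (x - y))" for t x y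
  have c0: "c \<ge> 0" unfolding c_def using s by (intro mult_nonneg_nonneg) (auto intro: less_imp_le Gamma_real_pos)
  have G: "Gamma (1 - s) > 0" using s by (intro Gamma_real_pos) simp
  have F [measurable]: "(\<lambda>p. F (f p) (g p) (h p)) \<in> borel_measurable M"
    if [measurable]: "f \<in> borel_measurable M" "g \<in> borel_measurable M" "h \<in> borel_measurable M" for f g h M
    unfolding F_def by measurable
  have ptw: "ennreal c * ennreal ((u x - u y)\<^sup>2 / norm (x - y) powr (real DIM('a) + 2 * s)) = (\<integral>\<^sup>+t. F t x y \<partial>lborel)" for x y
  proof (cases "x = y")
    case False
    have e: "(- s) - 1 = - 1 - s" "- (- s) = s" "real DIM('a) / 2 - - s = real DIM('a) / 2 + s" "2 * (- s) - real DIM('a) = - (real DIM('a) + 2 * s)"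
      by simp_all
    have "- s < real DIM('a) / 2" "x - y \<noteq> 0" using s False by (auto intro: less_le_trans[of _ 0])
    from nn_integral_heat_kernel_time[OF this, unfolded e]
    have I: "(\<integral>\<^sup>+t\<in>{0<..}. ennreal (t powr (- 1 - s) * heat_kernel t (x - y)) \<partial>lborel) = ennreal (c * norm (x - y) powr (- (real DIM('a) + 2 * s)))"
      unfolding c_def .
    have "(\<integral>\<^sup>+t. F t x y \<partial>lborel) = (\<integral>\<^sup>+t. ennreal ((u x - u y)\<^sup>2) * (ennreal (t powr (- 1 - s) * heat_kernel t (x - y)) * indicator {0<..} t) \<partial>lborel)"
      unfolding F_def by (intro nn_integral_cong) (simp add: ennreal_mult' mult_ac)
    also have "\<dots> = ennreal ((u x - u y)\<^sup>2) * ennreal (c * norm (x - y) powr (- (real DIM('a) + 2 * s)))"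
      unfolding I[symmetric] by (rule nn_integral_cmult) measurable
    also have "\<dots> = ennreal (c * ((u x - u y)\<^sup>2 / norm (x - y) powr (real DIM('a) + 2 * s)))"
      unfolding powr_minus_divide by (subst ennreal_mult'[symmetric]) (simp_all add: mult_ac)
    also have "\<dots> = ennreal c * ennreal ((u x - u y)\<^sup>2 / norm (x - y) powr (real DIM('a) + 2 * s))"
      by (rule ennreal_mult'[OF c0])
    finally show ?thesis ..
  qed (simp add: F_def)
  have "ennreal c * energy s u = (\<integral>\<^sup>+x. ennreal c * (\<integral>\<^sup>+y. ennreal ((u x - u y)\<^sup>2 / norm (x - y) powr (real DIM('a) + 2 * s)) \<partial>lborel) \<partial>lborel)"
    unfolding energy_def by (rule nn_integral_cmult[symmetric]) measurable
  also have "\<dots> = (\<integral>\<^sup>+x. (\<integral>\<^sup>+y. (\<integral>\<^sup>+t. F t x y \<partial>lborel) \<partial>lborel) \<partial>lborel)"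
    unfolding ptw[symmetric] by (intro nn_integral_cong nn_integral_cmult[symmetric]) measurable
  also have "\<dots> = (\<integral>\<^sup>+x. (\<integral>\<^sup>+t. (\<integral>\<^sup>+y. F t x y \<partial>lborel) \<partial>lborel) \<partial>lborel)"
    by (intro nn_integral_cong lborel_pair.Fubini') measurable
  also have "\<dots> = (\<integral>\<^sup>+t. (\<integral>\<^sup>+x. (\<integral>\<^sup>+y. F t x y \<partial>lborel) \<partial>lborel) \<partial>lborel)"
    by (intro lborel_pair.Fubini') measurable
  also have "\<dots> = (\<integral>\<^sup>+t\<in>{0<..}. ennreal (t powr (- 1 - s)) * heat_energy t u \<partial>lborel)"
  proof (rule nn_integral_cong)
    fix t :: real
    have "(\<integral>\<^sup>+x. (\<integral>\<^sup>+y. F t x y \<partial>lborel) \<partial>lborel) = (\<integral>\<^sup>+x. (ennreal (t powr (- 1 - s)) * indicator {0<..} t) * (\<integral>\<^sup>+y. ennreal ((u x - u y)\<^sup>2 * heat_kernel t (x - y)) \<partial>lborel) \<partial>lborel)"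
      unfolding F_def by (intro nn_integral_cong nn_integral_cmult) measurable
    also have "\<dots> = (ennreal (t powr (- 1 - s)) * indicator {0<..} t) * heat_energy t u"
      unfolding heat_energy_def by (rule nn_integral_cmult) measurable
    finally show "(\<integral>\<^sup>+x. (\<integral>\<^sup>+y. F t x y \<partial>lborel) \<partial>lborel) = ennreal (t powr (- 1 - s)) * heat_energy t u * indicator {0<..} t"
      by (simp only: mult_ac)
  qed
  finally have *: "ennreal c * energy s u = (\<integral>\<^sup>+t\<in>{0<..}. ennreal (t powr (- 1 - s)) * heat_energy t u \<partial>lborel)" .
  have "ennreal (C_Ns DIM('a) s / 2) = ennreal (s / (2 * Gamma (1 - s))) * ennreal c"
    unfolding C_Ns_half[OF s] c_def[symmetric] using s G by (intro ennreal_mult') simp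
  then show ?thesis
    by (simp only: mult.assoc *)
qed

lemma heat_energy_measurable [measurable]:
  fixes u :: "'a::euclidean_space \<Rightarrow> real"
  assumes [measurable]: "u \<in> borel_measurable borel"
  shows "(\<lambda>t. heat_energy t u) \<in> borel_measurable borel"
  unfolding heat_energy_def by measurable

text \<open>AM-GM in the form \<open>2 u(x) u(y) \<le> u(x)\<^sup>2 w(y) / w(x) + u(y)\<^sup>2 w(x) / w(y)\<close>.\<close>

lemma heat_energy_picone:
  fixes u :: "'a::euclidean_space \<Rightarrow> real"
  assumes [measurable]: "u \<in> borel_measurable borel" and t: "t > 0" and b: "b < real DIM('a) / 2"
  shows "2 * (\<integral>\<^sup>+x. ennreal ((u x)\<^sup>2) \<partial>lborel) \<le> heat_energy t u
     + 2 * (\<integral>\<^sup>+x. ennreal ((u x)\<^sup>2 / hardy_weight b x) * (\<integral>\<^sup>+y. ennreal (heat_kernel t (x - y) * hardy_weight b y) \<partial>lborel) \<partial>lborel)"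
proof -
  define W where "W = (hardy_weight b :: 'a \<Rightarrow> real)"
  have [measurable]: "W \<in> borel_measurable borel" unfolding W_def by measurable
  have W0: "W x \<ge> 0" for x unfolding W_def using b by (rule hardy_weight_nonneg)
  have Wpos: "W x > 0" if "x \<noteq> 0" for x unfolding W_def using b that by (rule hardy_weight_pos)
  define G where "G x y = ennreal ((u x)\<^sup>2 / W x) * ennreal (heat_kernel t (x - y) * W y)" for x y
  define U where "U x y = ennreal ((u x)\<^sup>2) * ennreal (heat_kernel t (x - y))" for x y
  have mU: "(\<lambda>(x, y). U x y) \<in> borel_measurable (lborel \<Otimes>\<^sub>M lborel)" unfolding U_def by measurable
  have mG: "(\<lambda>(x, y). G x y) \<in> borel_measurable (lborel \<Otimes>\<^sub>M lborel)" unfolding G_def by measurable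
  note [measurable] = mU mG
  have U1: "(\<integral>\<^sup>+x. \<integral>\<^sup>+y. U x y \<partial>lborel \<partial>lborel) = (\<integral>\<^sup>+x. ennreal ((u x)\<^sup>2) \<partial>lborel)"
  proof (rule nn_integral_cong)
    fix x
    have "(\<integral>\<^sup>+y. U x y \<partial>lborel) = ennreal ((u x)\<^sup>2) * (\<integral>\<^sup>+y. ennreal (heat_kernel t (y - x)) \<partial>lborel)"
      unfolding U_def heat_kernel_minus[of t x] by (rule nn_integral_cmult) measurable
    then show "(\<integral>\<^sup>+y. U x y \<partial>lborel) = ennreal ((u x)\<^sup>2)"
      using nn_integral_heat_kernel[OF t, of x] by simp
  qed
  have U2: "(\<integral>\<^sup>+x. \<integral>\<^sup>+y. U y x \<partial>lborel \<partial>lborel) = (\<integral>\<^sup>+x. ennreal ((u x)\<^sup>2) \<partial>lborel)"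
    unfolding U1[symmetric] by (rule lborel_pair.Fubini') (rule mU)
  have G2: "(\<integral>\<^sup>+x. \<integral>\<^sup>+y. G y x \<partial>lborel \<partial>lborel) = (\<integral>\<^sup>+x. \<integral>\<^sup>+y. G x y \<partial>lborel \<partial>lborel)"
    by (rule lborel_pair.Fubini') (rule mG)
  have G1: "(\<integral>\<^sup>+x. \<integral>\<^sup>+y. G x y \<partial>lborel \<partial>lborel) = (\<integral>\<^sup>+x. ennreal ((u x)\<^sup>2 / W x) * (\<integral>\<^sup>+y. ennreal (heat_kernel t (x - y) * W y) \<partial>lborel) \<partial>lborel)"
    unfolding G_def by (intro nn_integral_cong nn_integral_cmult) measurable
  have ptw: "U x y + U y x \<le> ennreal ((u x - u y)\<^sup>2 * heat_kernel t (x - y)) + (G x y + G y x)" if "x \<noteq> 0" "y \<noteq> 0" for x y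
  proof -
    have am: "2 * (u x * u y) \<le> (u x)\<^sup>2 / W x * W y + (u y)\<^sup>2 / W y * W x"
    proof -
      have "0 \<le> (u x * W y - u y * W x)\<^sup>2 / (W x * W y)"
        using W0 by simp
      also have "\<dots> = (u x)\<^sup>2 / W x * W y + (u y)\<^sup>2 / W y * W x - 2 * (u x * u y)"
        using Wpos[OF that(1)] Wpos[OF that(2)] by (simp add: field_simps power2_eq_square)
      finally show ?thesis by simp
    qed
    define h where "h = heat_kernel t (x - y)"
    have h: "h \<ge> 0" "heat_kernel t (y - x) = h" "heat_kernel t (x - y) = h" unfolding h_def by (simp_all add: heat_kernel_minus)
    have "((u x)\<^sup>2 + (u y)\<^sup>2) * h \<le> ((u x - u y)\<^sup>2 + (u x)\<^sup>2 / W x * W y + (u y)\<^sup>2 / W y * W x) * h"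
      using am h(1) by (intro mult_right_mono) (auto simp: power2_diff)
    then have "ennreal ((u x)\<^sup>2 * h + (u y)\<^sup>2 * h) \<le> ennreal ((u x - u y)\<^sup>2 * h + ((u x)\<^sup>2 / W x * (h * W y) + (u y)\<^sup>2 / W y * (h * W x)))"
      by (intro ennreal_leI) (simp add: algebra_simps)
    then show ?thesis
      unfolding U_def G_def h(2,3) using W0 h(1)
      by (simp add: ennreal_mult'[symmetric] ennreal_plus[symmetric] del: ennreal_plus)
  qed
  have "2 * (\<integral>\<^sup>+x. ennreal ((u x)\<^sup>2) \<partial>lborel) = (\<integral>\<^sup>+x. \<integral>\<^sup>+y. U x y \<partial>lborel \<partial>lborel) + (\<integral>\<^sup>+x. \<integral>\<^sup>+y. U y x \<partial>lborel \<partial>lborel)"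
    unfolding U1 U2 by (rule mult_2)
  also have "\<dots> = (\<integral>\<^sup>+x. \<integral>\<^sup>+y. U x y + U y x \<partial>lborel \<partial>lborel)"
    unfolding U_def by (simp add: nn_integral_add)
  also have "\<dots> \<le> (\<integral>\<^sup>+x. \<integral>\<^sup>+y. ennreal ((u x - u y)\<^sup>2 * heat_kernel t (x - y)) + (G x y + G y x) \<partial>lborel \<partial>lborel)"
  proof (rule nn_integral_mono_AE, use AE_lborel_singleton[of "0::'a"] in eventually_elim)
    case (elim x)
    show ?case
      by (rule nn_integral_mono_AE, use AE_lborel_singleton[of "0::'a"] in eventually_elim) (rule ptw[OF elim])
  qed
  also have "\<dots> = heat_energy t u + ((\<integral>\<^sup>+x. \<integral>\<^sup>+y. G x y \<partial>lborel \<partial>lborel) + (\<integral>\<^sup>+x. \<integral>\<^sup>+y. G y x \<partial>lborel \<partial>lborel))"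
    unfolding G_def heat_energy_def by (simp add: nn_integral_add)
  also have "\<dots> = heat_energy t u + 2 * (\<integral>\<^sup>+x. ennreal ((u x)\<^sup>2 / W x) * (\<integral>\<^sup>+y. ennreal (heat_kernel t (x - y) * W y) \<partial>lborel) \<partial>lborel)"
    unfolding G2 G1 mult_2 ..
  finally show ?thesis unfolding W_def .
qed

text \<open>\<open>heat_energy_picone\<close>, integrated over \<open>t \<ge> \<delta>\<close>,
  gives \<open>2 * (D * J) \<le> E + 2 * Z\<close>, where \<open>E\<close> is the truncated energy
  and \<open>Z\<close> the flow term. \<open>hardy_weight_flow_le\<close>, integrated against
  \<open>u\<^sup>2 / w\<close>, gives \<open>Z + X \<le> D * J\<close>, where \<open>2 * X\<close>
  is the left-hand side of the claim. Together they yield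
  \<open>2 * Z + 2 * X \<le> 2 * Z + E\<close>.\<close>

lemma hardy_remainder_energy_le:
  fixes u :: "'a::euclidean_space \<Rightarrow> real"
  assumes [measurable]: "u \<in> borel_measurable borel" and L2: "(\<integral>\<^sup>+x. ennreal ((u x)\<^sup>2) \<partial>lborel) < \<infinity>"
    and sb: "0 < s" "s < b" "b < real DIM('a) / 2" and d: "0 < \<delta>"
  shows "2 * (\<integral>\<^sup>+x. ennreal ((u x)\<^sup>2 / hardy_weight b x) * hardy_remainder s b \<delta> x \<partial>lborel)
     \<le> (\<integral>\<^sup>+t\<in>{0<..}. ennreal (t powr (- 1 - s)) * heat_energy t u \<partial>lborel)"
proof -
  define W where "W = (hardy_weight b :: 'a \<Rightarrow> real)"
  have [measurable]: "W \<in> borel_measurable borel" unfolding W_def by measurable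
  define P where "P t x = (\<integral>\<^sup>+y. ennreal (heat_kernel t (x - y) * W y) \<partial>lborel)" for t x
  have mP [measurable]: "(\<lambda>p. P (f p) (g p)) \<in> borel_measurable M"
    if [measurable]: "f \<in> borel_measurable M" "g \<in> borel_measurable M" for f g M
    unfolding P_def by measurable
  define R where "R = (hardy_remainder s b \<delta> :: 'a \<Rightarrow> ennreal)"
  have [measurable]: "R \<in> borel_measurable borel" unfolding R_def by measurable
  define v where "v x = ennreal ((u x)\<^sup>2 / W x)" for x
  have [measurable]: "v \<in> borel_measurable borel" unfolding v_def by measurable
  define k where "k t = ennreal (t powr (- 1 - s)) * indicator {\<delta>..} t" for t :: real
  have [measurable]: "k \<in> borel_measurable borel" unfolding k_def by measurable
  define J where "J = (\<integral>\<^sup>+x. ennreal ((u x)\<^sup>2) \<partial>lborel)"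
  define D where "D = ennreal (\<delta> powr (- s) / s)"
  have D: "(\<integral>\<^sup>+t. k t \<partial>lborel) = D"
    unfolding k_def D_def by (rule nn_integral_power_tail) (use sb d in auto)
  define Z where "Z = (\<integral>\<^sup>+x. v x * (\<integral>\<^sup>+t. k t * P t x \<partial>lborel) \<partial>lborel)"
  have ZR: "Z + (\<integral>\<^sup>+x. v x * R x \<partial>lborel) \<le> D * J"
  proof -
    have "Z + (\<integral>\<^sup>+x. v x * R x \<partial>lborel) = (\<integral>\<^sup>+x. v x * ((\<integral>\<^sup>+t. k t * P t x \<partial>lborel) + R x) \<partial>lborel)"
      unfolding Z_def by (simp add: nn_integral_add distrib_left)
    also have "\<dots> \<le> (\<integral>\<^sup>+x. D * ennreal ((u x)\<^sup>2) \<partial>lborel)"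
    proof (rule nn_integral_mono_AE, use AE_lborel_singleton[of "0::'a"] in eventually_elim)
      case (elim x)
      have "(\<integral>\<^sup>+t. k t * P t x \<partial>lborel) + R x \<le> ennreal (W x) * D"
        using hardy_weight_flow_le[OF sb d elim] unfolding k_def P_def R_def W_def D_def by (simp only: mult_ac)
      then have "v x * ((\<integral>\<^sup>+t. k t * P t x \<partial>lborel) + R x) \<le> v x * (ennreal (W x) * D)"
        by (rule mult_left_mono) simp
      also have "\<dots> = ennreal ((u x)\<^sup>2 / W x * W x) * D"
        unfolding v_def mult.assoc[symmetric] using hardy_weight_nonneg[OF sb(3), of x]
        by (subst ennreal_mult''[symmetric]) (simp_all only: W_def)
      also have "(u x)\<^sup>2 / W x * W x = (u x)\<^sup>2"
        using hardy_weight_pos[OF sb(3) elim] by (simp add: W_def)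
      finally show ?case by (simp only: mult.commute)
    qed
    also have "\<dots> = D * J" unfolding J_def by (rule nn_integral_cmult) measurable
    finally show ?thesis .
  qed
  \<comment> \<open>Truncation makes \<open>D\<close> finite and square integrability makes
    \<open>J\<close> finite. Hence \<open>Z\<close> is finite, which is what allows it to be
    cancelled in \<open>ennreal\<close>.\<close>
  have DJ: "D * J < \<infinity>" using L2 unfolding D_def J_def by (simp add: ennreal_mult_less_top)
  have "Z \<le> Z + (\<integral>\<^sup>+x. v x * R x \<partial>lborel)" by simp
  then have "Z < \<infinity>" using ZR DJ by (meson order.strict_trans1 order.trans)
  then have Zfin: "2 * Z < \<infinity>" by (simp add: ennreal_mult_less_top)
  have "2 * (D * J) = (\<integral>\<^sup>+t. k t * (2 * J) \<partial>lborel)"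
    by (subst nn_integral_multc) (auto simp: D mult_ac)
  also have "\<dots> \<le> (\<integral>\<^sup>+t. k t * heat_energy t u + 2 * (\<integral>\<^sup>+x. k t * (v x * P t x) \<partial>lborel) \<partial>lborel)"
  proof (rule nn_integral_mono)
    fix t :: real
    show "k t * (2 * J) \<le> k t * heat_energy t u + 2 * (\<integral>\<^sup>+x. k t * (v x * P t x) \<partial>lborel)"
    proof (cases "t \<ge> \<delta>")
      case True
      then have "t > 0" using d by simp
      have "k t * (2 * J) \<le> k t * (heat_energy t u + 2 * (\<integral>\<^sup>+x. v x * P t x \<partial>lborel))"
        using heat_energy_picone[OF assms(1) \<open>t > 0\<close> sb(3)] unfolding J_def v_def P_def W_def by (rule mult_left_mono) simp
      also have "\<dots> = k t * heat_energy t u + 2 * (k t * (\<integral>\<^sup>+x. v x * P t x \<partial>lborel))"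
        by (simp only: distrib_left mult_ac)
      also have "k t * (\<integral>\<^sup>+x. v x * P t x \<partial>lborel) = (\<integral>\<^sup>+x. k t * (v x * P t x) \<partial>lborel)"
        by (rule nn_integral_cmult[symmetric]) measurable
      finally show ?thesis .
    qed (simp add: k_def)
  qed
  also have "\<dots> = (\<integral>\<^sup>+t. k t * heat_energy t u \<partial>lborel) + 2 * (\<integral>\<^sup>+t. (\<integral>\<^sup>+x. k t * (v x * P t x) \<partial>lborel) \<partial>lborel)"
    by (subst nn_integral_add, (measurable)[2], subst nn_integral_cmult, measurable)
  also have "(\<integral>\<^sup>+t. (\<integral>\<^sup>+x. k t * (v x * P t x) \<partial>lborel) \<partial>lborel) = (\<integral>\<^sup>+x. (\<integral>\<^sup>+t. k t * (v x * P t x) \<partial>lborel) \<partial>lborel)"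
    by (rule lborel_pair.Fubini') measurable
  also have "\<dots> = Z"
    unfolding Z_def by (intro nn_integral_cong, subst nn_integral_cmult[symmetric]) (measurable, simp only: mult_ac)
  finally have "2 * (Z + (\<integral>\<^sup>+x. v x * R x \<partial>lborel)) \<le> (\<integral>\<^sup>+t. k t * heat_energy t u \<partial>lborel) + 2 * Z"
    using mult_left_mono[OF ZR, of 2] by (meson order_trans zero_le)
  then have "2 * Z + 2 * (\<integral>\<^sup>+x. v x * R x \<partial>lborel) \<le> 2 * Z + (\<integral>\<^sup>+t. k t * heat_energy t u \<partial>lborel)"
    by (simp only: distrib_left add.commute)
  then have "2 * (\<integral>\<^sup>+x. v x * R x \<partial>lborel) \<le> (\<integral>\<^sup>+t. k t * heat_energy t u \<partial>lborel)"
    using Zfin by (auto simp: ennreal_add_left_cancel_le)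
  also have "\<dots> \<le> (\<integral>\<^sup>+t\<in>{0<..}. ennreal (t powr (- 1 - s)) * heat_energy t u \<partial>lborel)"
    using d by (intro nn_integral_mono) (auto simp: k_def indicator_def)
  finally show ?thesis unfolding v_def W_def R_def .
qed

text \<open>For this \<open>b\<close>, \<open>DIM('a) / 2 - b = b - s\<close>, so the Gamma factors
  of the two weights have the quotient \<open>Gamma b / Gamma (b - s)\<close>. The Beta function
  together with the factors around it gives the same quotient once more, hence the squares in
  \<open>gamma_H\<close>. This \<open>b\<close> is the fixed point of the symmetry that exchanges
  \<open>b\<close> and \<open>DIM('a) / 2 + s - b\<close> in the constant obtained for general
  \<open>b\<close>.\<close>

lemma hardy_constant:
  fixes x :: "'a::euclidean_space"
  assumes s: "0 < s" "s < 1" "2 * s < real DIM('a)" and x: "x \<noteq> 0" and b: "b = (real DIM('a) + 2 * s) / 4"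
  shows "s / Gamma (1 - s) * ((b - s) / s * Beta (1 - s) b * hardy_weight (b - s) x) / hardy_weight b x
    = gamma_H DIM('a) s / norm x powr (2 * s)"
proof -
  define p where "p = pi powr (- (real DIM('a) / 2))"
  have p: "p > 0" unfolding p_def by simp
  have bs: "b - s > 0" "b > 0" using s by (auto simp: b)
  have e1: "real DIM('a) / 2 - b = b - s" "real DIM('a) / 2 - (b - s) = b" "(real DIM('a) + 2 * s) / 4 = b" "(real DIM('a) - 2 * s) / 4 = b - s"
    by (simp_all add: b field_simps)
  define g1 where "g1 = Gamma b"
  define g2 where "g2 = Gamma (b - s)"
  define g3 where "g3 = Gamma (1 - s)"
  have g: "g1 > 0" "g2 > 0" "g3 > 0" unfolding g1_def g2_def g3_def using bs s by (auto intro!: Gamma_real_pos)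
  have "Gamma (1 - s + b) = (b - s) * g2"
    using Gamma_plus1[of "b - s"] bs nonpos_Ints_nonpos[of "b - s"] unfolding g2_def by (force simp: algebra_simps)
  then have B: "Beta (1 - s) b = g3 * g1 / ((b - s) * g2)"
    unfolding Beta_def g1_def g3_def by simp
  have four: "(4::real) powr (- (b - s)) = 4 powr (- b) * 2 powr (2 * s)"
  proof -
    have "(2::real) powr (2 * s) = 4 powr s" using powr_powr[of 2 2 s] by simp
    then show ?thesis by (simp flip: powr_add)
  qed
  have n: "norm x powr (2 * (b - s) - real DIM('a)) = norm x powr (2 * b - real DIM('a)) / norm x powr (2 * s)"
    unfolding powr_diff[symmetric] by (rule arg_cong2[where f = "(powr)"]) simp_all
  define f where "f = (4::real) powr (- b)"
  define m where "m = norm x powr (2 * b - real DIM('a))"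
  have fm: "f > 0" "m > 0" unfolding f_def m_def using x by simp_all
  show ?thesis
    unfolding hardy_weight_def gamma_H_def e1 B four n p_def[symmetric] g1_def[symmetric] g2_def[symmetric] g3_def[symmetric] f_def[symmetric] m_def[symmetric]
    using g p fm bs s x by (simp add: field_simps power2_eq_square)
qed

text \<open>In \<open>hardy_remainder_energy_le\<close> the cutoff \<delta> tends to 0 by monotone
  convergence, and \<open>hardy_constant\<close> identifies the limit. Square integrability stems
  from the cancellation of truncated terms; it holds on \<open>Cc_inf\<close>, from where
  \<open>hardy_inequality_Ds2\<close> passes to the completion.\<close>

theorem hardy_inequality_L2:
  fixes u :: "'a::euclidean_space \<Rightarrow> real"
  assumes [measurable]: "u \<in> borel_measurable borel" and L2: "(\<integral>\<^sup>+x. ennreal ((u x)\<^sup>2) \<partial>lborel) < \<infinity>"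
    and s: "0 < s" "s < 1" "2 * s < real DIM('a)"
  shows "ennreal (gamma_H DIM('a) s) * (\<integral>\<^sup>+x. ennreal ((u x)\<^sup>2 / norm x powr (2 * s)) \<partial>lborel) \<le> ennreal (C_Ns DIM('a) s / 2) * energy s u"
proof -
  define b where "b = (real DIM('a) + 2 * s) / 4"
  have sb: "0 < s" "s < b" "b < real DIM('a) / 2" using s by (auto simp: b_def)
  define H where "H = (\<integral>\<^sup>+t\<in>{0<..}. ennreal (t powr (- 1 - s)) * heat_energy t u \<partial>lborel)"
  define v where "v x = ennreal ((u x)\<^sup>2 / hardy_weight b x)" for x
  have [measurable]: "v \<in> borel_measurable borel" unfolding v_def by measurable
  define \<kappa> where "\<kappa> x = (b - s) / s * Beta (1 - s) b * hardy_weight (b - s) x" for x :: 'a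
  have G: "Gamma (1 - s) > 0" using s by (intro Gamma_real_pos) simp
  have le: "1 / real (Suc n) \<le> 1 / real (Suc m)" if "m \<le> n" for m n :: nat
    using that by (intro divide_left_mono) auto
  have mono: "hardy_remainder s b (1 / real (Suc m)) x \<le> hardy_remainder s b (1 / real (Suc n)) x" if "m \<le> n" for m n and x :: 'a
    unfolding hardy_remainder_def using le[OF that]
    by (intro nn_integral_mono mult_mono nn_set_integral_set_mono) (auto simp del: of_nat_Suc)
  have "(\<integral>\<^sup>+x. v x * ennreal (\<kappa> x) \<partial>lborel) = (\<integral>\<^sup>+x. (SUP n. v x * hardy_remainder s b (1 / real (Suc n)) x) \<partial>lborel)"
  proof (rule nn_integral_cong_AE, use AE_lborel_singleton[of "0::'a"] in eventually_elim)
    case (elim x)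
    show ?case
      unfolding \<kappa>_def hardy_remainder_SUP[OF s(1,2) sb(2,3) elim, symmetric]
      by (rule SUP_mult_left_ennreal)
  qed
  also have "\<dots> = (SUP n. \<integral>\<^sup>+x. v x * hardy_remainder s b (1 / real (Suc n)) x \<partial>lborel)"
    by (rule nn_integral_monotone_convergence_SUP)
       (auto simp only: incseq_def le_fun_def intro!: mult_left_mono mono, measurable)
  finally have "2 * (\<integral>\<^sup>+x. v x * ennreal (\<kappa> x) \<partial>lborel) = (SUP n. 2 * (\<integral>\<^sup>+x. v x * hardy_remainder s b (1 / real (Suc n)) x \<partial>lborel))"
    by (simp only: SUP_mult_left_ennreal)
  also have "\<dots> \<le> H"
    unfolding H_def v_def by (intro SUP_least hardy_remainder_energy_le assms sb) auto
  finally have main: "2 * (\<integral>\<^sup>+x. v x * ennreal (\<kappa> x) \<partial>lborel) \<le> H" .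
  have "ennreal (gamma_H DIM('a) s) * (\<integral>\<^sup>+x. ennreal ((u x)\<^sup>2 / norm x powr (2 * s)) \<partial>lborel)
     = (\<integral>\<^sup>+x. ennreal (gamma_H DIM('a) s) * ennreal ((u x)\<^sup>2 / norm x powr (2 * s)) \<partial>lborel)"
    by (rule nn_integral_cmult[symmetric]) measurable
  also have "\<dots> = (\<integral>\<^sup>+x. ennreal (s / Gamma (1 - s)) * (v x * ennreal (\<kappa> x)) \<partial>lborel)"
  proof (rule nn_integral_cong_AE, use AE_lborel_singleton[of "0::'a"] in eventually_elim)
    case (elim x)
    define W where "W = hardy_weight b x"
    have W: "W > 0" unfolding W_def by (rule hardy_weight_pos[OF sb(3) elim])
    have g: "gamma_H DIM('a) s \<ge> 0" unfolding gamma_H_def by simp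
    have "ennreal (gamma_H DIM('a) s) * ennreal ((u x)\<^sup>2 / norm x powr (2 * s)) = ennreal ((u x)\<^sup>2 * (gamma_H DIM('a) s / norm x powr (2 * s)))"
      using g by (subst ennreal_mult'[symmetric]) (auto simp: mult_ac)
    also have "gamma_H DIM('a) s / norm x powr (2 * s) = s / Gamma (1 - s) * \<kappa> x / W"
      unfolding \<kappa>_def W_def by (rule hardy_constant[OF s elim b_def, symmetric])
    also have "(u x)\<^sup>2 * (s / Gamma (1 - s) * \<kappa> x / W) = s / Gamma (1 - s) * ((u x)\<^sup>2 / W * \<kappa> x)"
      by simp
    also have "ennreal \<dots> = ennreal (s / Gamma (1 - s)) * (v x * ennreal (\<kappa> x))"
      unfolding v_def W_def[symmetric] using s G W by (simp add: ennreal_mult' del: times_divide_eq_left times_divide_eq_right)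
    finally show ?case .
  qed
  also have "\<dots> = ennreal (s / Gamma (1 - s)) * (\<integral>\<^sup>+x. v x * ennreal (\<kappa> x) \<partial>lborel)"
    unfolding \<kappa>_def by (rule nn_integral_cmult) measurable
  \<comment> \<open>The 2 comes from the two symmetric terms of the AM-GM step and is absorbed by
    \<open>main\<close>; what remains is the constant of \<open>energy_heat\<close>.\<close>
  also have "s / Gamma (1 - s) = s / (2 * Gamma (1 - s)) * 2" using G by simp
  also have "ennreal (s / (2 * Gamma (1 - s)) * 2) = ennreal (s / (2 * Gamma (1 - s))) * 2"
    using s G by (subst ennreal_mult') auto
  also have "\<dots> * (\<integral>\<^sup>+x. v x * ennreal (\<kappa> x) \<partial>lborel) \<le> ennreal (s / (2 * Gamma (1 - s))) * H"
    unfolding mult.assoc by (rule mult_left_mono[OF main]) simp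
  also have "\<dots> = ennreal (C_Ns DIM('a) s / 2) * energy s u"
    unfolding H_def by (rule energy_heat[symmetric]) (use s in auto)
  finally show ?thesis .
qed

section \<open>Optimality of the constant\<close>

text \<open>On a pair of heat kernels the L2 product, the heat energy and the Hardy integral are
  explicit, so on these sums every form is a finite double sum over the variances.\<close>

definition heat_sum :: "nat \<Rightarrow> (nat \<Rightarrow> real) \<Rightarrow> (nat \<Rightarrow> real) \<Rightarrow> 'a::euclidean_space \<Rightarrow> real" where
  "heat_sum n c a x = (\<Sum>i<n. c i * heat_kernel (a i) x)"

lemma heat_sum_measurable [measurable]: "heat_sum n c a \<in> borel_measurable borel"
  unfolding heat_sum_def by measurable

lemma heat_sum_nonneg: "(\<And>i. i < n \<Longrightarrow> c i \<ge> 0) \<Longrightarrow> heat_sum n c a x \<ge> 0"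
  unfolding heat_sum_def by (intro sum_nonneg mult_nonneg_nonneg) auto

lemma heat_kernel_0: "heat_kernel t (0::'a::euclidean_space) = (4 * pi) powr (- (real DIM('a) / 2)) * t powr (- (real DIM('a) / 2))"
  unfolding heat_kernel_def by (simp only: powr_mult[of "4 * pi" t]) simp

lemma nn_integral_heat_kernel_mult:
  assumes "a > 0" "b > 0"
  shows "(\<integral>\<^sup>+x. ennreal (heat_kernel a (x::'a::euclidean_space) * heat_kernel b x) \<partial>lborel) = ennreal (heat_kernel (a + b) (0::'a))"
  using heat_kernel_convolution[OF assms, of "0::'a"] by (simp add: heat_kernel_def)

lemma nn_integral_heat_kernel_triple:
  assumes "a > 0" "b > 0" "t > 0"
  shows "(\<integral>\<^sup>+x. \<integral>\<^sup>+y. ennreal (heat_kernel a (x::'a::euclidean_space) * heat_kernel b y * heat_kernel t (x - y)) \<partial>lborel \<partial>lborel)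
    = ennreal (heat_kernel (a + b + t) (0::'a))"
proof -
  have "(\<integral>\<^sup>+y. ennreal (heat_kernel a x * heat_kernel b y * heat_kernel t (x - y)) \<partial>lborel) = ennreal (heat_kernel a x * heat_kernel (b + t) x)" for x :: 'a
  proof -
    have "(\<integral>\<^sup>+y. ennreal (heat_kernel a x * heat_kernel b y * heat_kernel t (x - y)) \<partial>lborel)
      = (\<integral>\<^sup>+y. ennreal (heat_kernel a x) * ennreal (heat_kernel t (x - y) * heat_kernel b y) \<partial>lborel)"
      by (intro nn_integral_cong) (simp add: ennreal_mult' mult_ac)
    also have "\<dots> = ennreal (heat_kernel a x) * ennreal (heat_kernel (t + b) x)"
      unfolding heat_kernel_convolution[OF assms(3,2), symmetric] by (rule nn_integral_cmult) measurable
    also have "\<dots> = ennreal (heat_kernel a x * heat_kernel (b + t) x)"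
      by (simp only: add.commute[of t b]) (rule ennreal_mult'[symmetric], simp)
    finally show ?thesis .
  qed
  then show ?thesis
    using nn_integral_heat_kernel_mult[of a "b + t", where 'a = 'a] assms by (simp add: add.assoc)
qed

lemma ennreal_double_sum:
  assumes "\<And>i j. i < n \<Longrightarrow> j < n \<Longrightarrow> g i j \<ge> 0"
  shows "ennreal (\<Sum>i<n. \<Sum>j<n. g i j) = (\<Sum>i<(n::nat). \<Sum>j<n. ennreal (g i j))"
  using assms by (subst sum_ennreal[symmetric]) (auto intro!: sum_nonneg sum.cong sum_ennreal[symmetric])

lemma nn_integral_double_sum:
  assumes "\<And>i j. i < n \<Longrightarrow> j < n \<Longrightarrow> f i j \<in> borel_measurable M" "\<And>i j x. i < n \<Longrightarrow> j < n \<Longrightarrow> f i j x \<ge> 0"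
    and "\<And>i j. i < n \<Longrightarrow> j < n \<Longrightarrow> (\<integral>\<^sup>+x. ennreal (f i j x) \<partial>M) = ennreal (g i j)"
    and "\<And>i j. i < n \<Longrightarrow> j < n \<Longrightarrow> g i j \<ge> (0::real)"
  shows "(\<integral>\<^sup>+x. ennreal (\<Sum>i<n. \<Sum>j<n. f i j x) \<partial>M) = ennreal (\<Sum>i<(n::nat). \<Sum>j<n. g i j)"
proof -
  have "(\<integral>\<^sup>+x. ennreal (\<Sum>i<n. \<Sum>j<n. f i j x) \<partial>M) = (\<integral>\<^sup>+x. (\<Sum>i<n. \<Sum>j<n. ennreal (f i j x)) \<partial>M)"
    using assms(2) by (intro nn_integral_cong ennreal_double_sum)
  also have "\<dots> = (\<Sum>i<n. \<Sum>j<n. (\<integral>\<^sup>+x. ennreal (f i j x) \<partial>M))"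
    using assms(1) by (subst nn_integral_sum) (auto intro!: sum.cong nn_integral_sum)
  also have "\<dots> = ennreal (\<Sum>i<n. \<Sum>j<n. g i j)"
    using assms(3,4) by (subst ennreal_double_sum) (auto intro!: sum.cong)
  finally show ?thesis .
qed

lemma heat_sum_square: "heat_sum n c a x * heat_sum n c a y = (\<Sum>i<n. \<Sum>j<n. c i * c j * (heat_kernel (a i) x * heat_kernel (a j) y))"
  unfolding heat_sum_def sum_product by (simp only: mult_ac)

lemma nn_integral_heat_sum_square:
  assumes c: "\<And>i. i < n \<Longrightarrow> c i > 0" and a: "\<And>i. i < n \<Longrightarrow> a i > 0"
  shows "(\<integral>\<^sup>+x. ennreal ((heat_sum n c a (x::'a::euclidean_space))\<^sup>2) \<partial>lborel) = ennreal (\<Sum>i<n. \<Sum>j<n. c i * c j * heat_kernel (a i + a j) (0::'a))"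
  unfolding power2_eq_square heat_sum_square
proof (rule nn_integral_double_sum)
  fix i j assume ij: "i < n" "j < n"
  have "(\<integral>\<^sup>+x. ennreal (c i * c j * (heat_kernel (a i) (x::'a) * heat_kernel (a j) x)) \<partial>lborel)
    = (\<integral>\<^sup>+x. ennreal (c i * c j) * ennreal (heat_kernel (a i) (x::'a) * heat_kernel (a j) x) \<partial>lborel)"
    by (intro nn_integral_cong ennreal_mult'') simp
  also have "\<dots> = ennreal (c i * c j) * ennreal (heat_kernel (a i + a j) (0::'a))"
    unfolding nn_integral_heat_kernel_mult[OF a a, OF ij, symmetric] by (rule nn_integral_cmult) measurable
  also have "\<dots> = ennreal (c i * c j * heat_kernel (a i + a j) (0::'a))"
    by (intro ennreal_mult''[symmetric]) simp
  finally show "(\<integral>\<^sup>+x. ennreal (c i * c j * (heat_kernel (a i) (x::'a) * heat_kernel (a j) x)) \<partial>lborel) = ennreal (c i * c j * heat_kernel (a i + a j) (0::'a))" .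
qed (use c in \<open>auto intro!: mult_nonneg_nonneg intro: less_imp_le\<close>)

text \<open>Expanding the square gives \<open>2 * A - 2 * B\<close>, with \<open>A\<close> the
  squared L2 norm and \<open>B\<close> the quadratic form of the heat semigroup. As subtraction in
  \<open>ennreal\<close> is truncated, the identity is first proved with \<open>2 * B\<close> added
  to the energy; this also yields \<open>B \<le> A\<close>, after which the real difference may be
  formed.\<close>

lemma heat_energy_heat_sum:
  fixes c a :: "nat \<Rightarrow> real"
  assumes c: "\<And>i. i < n \<Longrightarrow> c i > 0" and a: "\<And>i. i < n \<Longrightarrow> a i > 0" and t: "t > 0"
  shows "heat_energy t (heat_sum n c a :: 'a::euclidean_space \<Rightarrow> real)
    = ennreal (\<Sum>i<n. \<Sum>j<n. 2 * (c i * c j) * (heat_kernel (a i + a j) (0::'a) - heat_kernel (a i + a j + t) (0::'a)))"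
proof -
  define u where "u = (heat_sum n c a :: 'a \<Rightarrow> real)"
  have [measurable]: "u \<in> borel_measurable borel" unfolding u_def by measurable
  have u0: "u x \<ge> 0" for x unfolding u_def using c by (intro heat_sum_nonneg) (auto intro: less_imp_le)
  define A where "A = (\<Sum>i<n. \<Sum>j<n. c i * c j * heat_kernel (a i + a j) (0::'a))"
  define B where "B = (\<Sum>i<n. \<Sum>j<n. c i * c j * heat_kernel (a i + a j + t) (0::'a))"
  have A0: "A \<ge> 0" unfolding A_def using c by (intro sum_nonneg mult_nonneg_nonneg) (auto intro: less_imp_le)
  have B0: "B \<ge> 0" unfolding B_def using c by (intro sum_nonneg mult_nonneg_nonneg) (auto intro: less_imp_le)
  have A: "(\<integral>\<^sup>+x. ennreal ((u x)\<^sup>2) \<partial>lborel) = ennreal A"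
    unfolding u_def A_def by (rule nn_integral_heat_sum_square[OF c a])
  have B: "(\<integral>\<^sup>+x. \<integral>\<^sup>+y. ennreal (u x * u y * heat_kernel t (x - y)) \<partial>lborel \<partial>lborel) = ennreal B"
  proof -
    have "(\<integral>\<^sup>+x. \<integral>\<^sup>+y. ennreal (u x * u y * heat_kernel t (x - y)) \<partial>lborel \<partial>lborel)
      = (\<integral>\<^sup>+p. ennreal (u (fst p) * u (snd p) * heat_kernel t (fst p - snd p)) \<partial>(lborel \<Otimes>\<^sub>M lborel))"
      by (subst lborel.nn_integral_fst[symmetric]) simp_all
    also have "\<dots> = (\<integral>\<^sup>+p. ennreal (\<Sum>i<n. \<Sum>j<n. c i * c j * (heat_kernel (a i) (fst p) * heat_kernel (a j) (snd p) * heat_kernel t (fst p - snd p :: 'a))) \<partial>(lborel \<Otimes>\<^sub>M lborel))"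
      unfolding u_def heat_sum_square by (simp only: sum_distrib_right mult.assoc)
    also have "\<dots> = ennreal B"
      unfolding B_def
    proof (rule nn_integral_double_sum)
      fix i j assume ij: "i < n" "j < n"
      have "(\<integral>\<^sup>+p. ennreal (c i * c j * (heat_kernel (a i) (fst p) * heat_kernel (a j) (snd p) * heat_kernel t (fst p - snd p :: 'a))) \<partial>(lborel \<Otimes>\<^sub>M lborel))
        = (\<integral>\<^sup>+p. ennreal (c i * c j) * ennreal (heat_kernel (a i) (fst p) * heat_kernel (a j) (snd p) * heat_kernel t (fst p - snd p :: 'a)) \<partial>(lborel \<Otimes>\<^sub>M lborel))"
        by (intro nn_integral_cong ennreal_mult'') simp
      also have "\<dots> = ennreal (c i * c j) * (\<integral>\<^sup>+p. ennreal (heat_kernel (a i) (fst p) * heat_kernel (a j) (snd p) * heat_kernel t (fst p - snd p :: 'a)) \<partial>(lborel \<Otimes>\<^sub>M lborel))"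
        by (rule nn_integral_cmult) measurable
      also have "(\<integral>\<^sup>+p. ennreal (heat_kernel (a i) (fst p) * heat_kernel (a j) (snd p) * heat_kernel t (fst p - snd p :: 'a)) \<partial>(lborel \<Otimes>\<^sub>M lborel)) = ennreal (heat_kernel (a i + a j + t) (0::'a))"
        unfolding nn_integral_heat_kernel_triple[OF a a t, OF ij, symmetric]
        by (subst lborel.nn_integral_fst[symmetric]) simp_all
      also have "ennreal (c i * c j) * \<dots> = ennreal (c i * c j * heat_kernel (a i + a j + t) (0::'a))"
        by (intro ennreal_mult''[symmetric]) simp
      finally show "(\<integral>\<^sup>+p. ennreal (c i * c j * (heat_kernel (a i) (fst p) * heat_kernel (a j) (snd p) * heat_kernel t (fst p - snd p :: 'a))) \<partial>(lborel \<Otimes>\<^sub>M lborel)) = ennreal (c i * c j * heat_kernel (a i + a j + t) (0::'a))" .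
    qed (use c in \<open>auto intro!: mult_nonneg_nonneg intro: less_imp_le\<close>)
    finally show ?thesis .
  qed
  have U1: "(\<integral>\<^sup>+x. \<integral>\<^sup>+y. ennreal ((u x)\<^sup>2 * heat_kernel t (x - y)) \<partial>lborel \<partial>lborel) = ennreal A"
    unfolding A[symmetric]
  proof (rule nn_integral_cong)
    fix x
    have "(\<integral>\<^sup>+y. ennreal ((u x)\<^sup>2 * heat_kernel t (x - y)) \<partial>lborel) = (\<integral>\<^sup>+y. ennreal ((u x)\<^sup>2) * ennreal (heat_kernel t (y - x)) \<partial>lborel)"
      unfolding heat_kernel_minus[of t x] by (intro nn_integral_cong ennreal_mult') simp
    also have "\<dots> = ennreal ((u x)\<^sup>2) * (\<integral>\<^sup>+y. ennreal (heat_kernel t (y - x)) \<partial>lborel)"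
      by (rule nn_integral_cmult) measurable
    finally show "(\<integral>\<^sup>+y. ennreal ((u x)\<^sup>2 * heat_kernel t (x - y)) \<partial>lborel) = ennreal ((u x)\<^sup>2)"
      using nn_integral_heat_kernel[OF t, of x] by simp
  qed
  have U2: "(\<integral>\<^sup>+x. \<integral>\<^sup>+y. ennreal ((u y)\<^sup>2 * heat_kernel t (x - y)) \<partial>lborel \<partial>lborel) = ennreal A"
    unfolding U1[symmetric] by (subst lborel_pair.Fubini') (measurable, simp only: heat_kernel_minus)
  have "heat_energy t u + ennreal (2 * B) = (\<integral>\<^sup>+x. \<integral>\<^sup>+y. ennreal ((u x)\<^sup>2 * heat_kernel t (x - y)) + ennreal ((u y)\<^sup>2 * heat_kernel t (x - y)) \<partial>lborel \<partial>lborel)"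
  proof -
    have "ennreal (2 * B) = 2 * (\<integral>\<^sup>+x. \<integral>\<^sup>+y. ennreal (u x * u y * heat_kernel t (x - y)) \<partial>lborel \<partial>lborel)"
      unfolding B by (subst ennreal_mult') simp_all
    also have "\<dots> = (\<integral>\<^sup>+x. \<integral>\<^sup>+y. 2 * ennreal (u x * u y * heat_kernel t (x - y)) \<partial>lborel \<partial>lborel)"
      by (subst nn_integral_cmult[symmetric], measurable, subst nn_integral_cmult[symmetric], measurable)
    finally have "heat_energy t u + ennreal (2 * B) = (\<integral>\<^sup>+x. \<integral>\<^sup>+y. ennreal ((u x - u y)\<^sup>2 * heat_kernel t (x - y)) + 2 * ennreal (u x * u y * heat_kernel t (x - y)) \<partial>lborel \<partial>lborel)"
      unfolding heat_energy_def by (simp add: nn_integral_add)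
    also have "\<dots> = (\<integral>\<^sup>+x. \<integral>\<^sup>+y. ennreal ((u x)\<^sup>2 * heat_kernel t (x - y)) + ennreal ((u y)\<^sup>2 * heat_kernel t (x - y)) \<partial>lborel \<partial>lborel)"
    proof (intro nn_integral_cong)
      fix x y
      have "ennreal ((u x - u y)\<^sup>2 * heat_kernel t (x - y)) + 2 * ennreal (u x * u y * heat_kernel t (x - y))
        = ennreal ((u x - u y)\<^sup>2 * heat_kernel t (x - y) + 2 * (u x * u y * heat_kernel t (x - y)))"
        using u0 by (subst ennreal_plus) (auto simp: ennreal_mult')
      also have "(u x - u y)\<^sup>2 * heat_kernel t (x - y) + 2 * (u x * u y * heat_kernel t (x - y)) = (u x)\<^sup>2 * heat_kernel t (x - y) + (u y)\<^sup>2 * heat_kernel t (x - y)"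
        by (simp add: power2_eq_square algebra_simps)
      finally show "ennreal ((u x - u y)\<^sup>2 * heat_kernel t (x - y)) + 2 * ennreal (u x * u y * heat_kernel t (x - y)) = ennreal ((u x)\<^sup>2 * heat_kernel t (x - y)) + ennreal ((u y)\<^sup>2 * heat_kernel t (x - y))"
        by simp
    qed
    finally show ?thesis .
  qed
  also have "\<dots> = ennreal A + ennreal A"
    using U1 U2 by (simp add: nn_integral_add)
  also have "\<dots> = ennreal (2 * A)" using A0 by (simp flip: ennreal_plus)
  finally have *: "heat_energy t u + ennreal (2 * B) = ennreal (2 * A)" .
  then have "ennreal (2 * B) \<le> ennreal (2 * A)" by (metis add.commute le_iff_add)
  then have BA: "B \<le> A" using A0 by (simp add: ennreal_le_iff)
  have "heat_energy t u + ennreal (2 * B) = ennreal (2 * A - 2 * B) + ennreal (2 * B)"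
    unfolding * using BA B0 by (simp flip: ennreal_plus)
  then have "heat_energy t u = ennreal (2 * A - 2 * B)" by simp
  also have "2 * A - 2 * B = (\<Sum>i<n. \<Sum>j<n. 2 * (c i * c j) * (heat_kernel (a i + a j) (0::'a) - heat_kernel (a i + a j + t) (0::'a)))"
    unfolding A_def B_def by (simp add: sum_distrib_left sum_subtractf right_diff_distrib mult.assoc)
  finally show ?thesis unfolding u_def .
qed

text \<open>The difference is the integral of \<open>f\<close> over \<open>{0..t}\<close>. After the
  order is exchanged, the tail integral over \<open>t \<ge> v\<close> gives
  \<open>v powr (- s) / s\<close>, and the remaining integral over \<open>v\<close> is of the type
  of \<open>nn_integral_beta_prime\<close>, convergent at 0 because \<open>s < 1\<close>.\<close>

lemma nn_integral_power_difference:
  fixes s \<nu> \<sigma> :: real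
  assumes s: "0 < s" "s < 1" and "\<nu> > 0" "\<sigma> > 0"
  shows "(\<integral>\<^sup>+t\<in>{0<..}. ennreal (t powr (- 1 - s)) * ennreal (\<sigma> powr (- \<nu>) - (\<sigma> + t) powr (- \<nu>)) \<partial>lborel)
    = ennreal (Gamma (1 - s) * Gamma (\<nu> + s) / (s * Gamma \<nu>) * \<sigma> powr (- \<nu> - s))"
proof -
  define f where "f v = \<nu> * (\<sigma> + v) powr (- \<nu> - 1)" for v
  have f0: "f v \<ge> 0" for v unfolding f_def using assms by simp
  have [measurable]: "f \<in> borel_measurable borel" unfolding f_def by measurable
  have FTC: "(\<integral>\<^sup>+v\<in>{0..t}. ennreal (f v) \<partial>lborel) = ennreal (\<sigma> powr (- \<nu>) - (\<sigma> + t) powr (- \<nu>))" if "t > 0" for t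
  proof -
    have "(f has_integral (- ((\<sigma> + t) powr (- \<nu>)) - (- ((\<sigma> + 0) powr (- \<nu>))))) {0..t}"
    proof (rule fundamental_theorem_of_calculus)
      fix x assume x: "x \<in> {0..t}"
      have "((\<lambda>v. (\<sigma> + v) powr (- \<nu>)) has_real_derivative (- \<nu> * (\<sigma> + x) powr (- \<nu> - 1) * (0 + 1))) (at x)"
        using x assms by (intro DERIV_chain'[of "\<lambda>v. \<sigma> + v" _ _ _ "\<lambda>v. v powr (- \<nu>)", THEN DERIV_cong] derivative_intros has_real_derivative_powr) auto
      from DERIV_minus[OF this] have "((\<lambda>v. - ((\<sigma> + v) powr (- \<nu>))) has_real_derivative f x) (at x)"
        by (simp add: f_def)
      then show "((\<lambda>v. - ((\<sigma> + v) powr (- \<nu>))) has_vector_derivative f x) (at x within {0..t})"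
        by (simp add: has_real_derivative_iff_has_vector_derivative has_vector_derivative_at_within)
    qed (use that in simp)
    from nn_integral_has_integral_lebesgue'[OF f0 this] show ?thesis by simp
  qed
  have "(\<integral>\<^sup>+t\<in>{0<..}. ennreal (t powr (- 1 - s)) * ennreal (\<sigma> powr (- \<nu>) - (\<sigma> + t) powr (- \<nu>)) \<partial>lborel)
     = (\<integral>\<^sup>+t. (\<integral>\<^sup>+v. ennreal (t powr (- 1 - s)) * ennreal (f v) * (indicator {0..} v * indicator {v..} t) \<partial>lborel) \<partial>lborel)"
  proof (rule nn_integral_cong_AE, use AE_lborel_singleton[of "0::real"] in eventually_elim)
    case (elim t)
    show ?case
    proof (cases "t > 0")
      case True
      have i: "indicator {0..t} v = (indicator {0..} v * indicator {v..} t :: ennreal)" for v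
        by (auto simp: indicator_def)
      have "ennreal (t powr (- 1 - s)) * ennreal (\<sigma> powr (- \<nu>) - (\<sigma> + t) powr (- \<nu>)) = (\<integral>\<^sup>+v. ennreal (t powr (- 1 - s)) * (ennreal (f v) * indicator {0..t} v) \<partial>lborel)"
        unfolding FTC[OF True, symmetric] by (rule nn_integral_cmult[symmetric]) measurable
      then show ?thesis using True unfolding i by (simp only: mult_ac greaterThan_iff indicator_simps mult_1_right mult_1_left)
    next
      case False
      then have z: "indicator {0..} v * indicator {v..} t = (0::ennreal)" for v
        using elim by (auto simp: indicator_def)
      show ?thesis using False unfolding z by simp
    qed
  qed
  also have "\<dots> = (\<integral>\<^sup>+v. (\<integral>\<^sup>+t. ennreal (t powr (- 1 - s)) * ennreal (f v) * (indicator {0..} v * indicator {v..} t) \<partial>lborel) \<partial>lborel)"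
  proof (rule lborel_pair.Fubini')
    have [measurable]: "(\<lambda>p::real\<times>real. indicator {fst p..} (snd p) :: ennreal) \<in> borel_measurable (lborel \<Otimes>\<^sub>M lborel)"
      by (rule borel_measurable_indicator') (unfold atLeast_iff, measurable)
    show "(\<lambda>(v, t). ennreal (t powr (- 1 - s)) * ennreal (f v) * (indicator {0..} v * indicator {v..} t)) \<in> borel_measurable (lborel \<Otimes>\<^sub>M lborel)"
      unfolding split_beta'
      by (intro borel_measurable_times_ennreal borel_measurable_indicator'[where A = "\<lambda>p. {fst p..}"]) (unfold atLeast_iff, measurable)
  qed
  also have "\<dots> = (\<integral>\<^sup>+v. ennreal (\<nu> / s) * (ennreal (v powr ((1 - s) - 1) * (\<sigma> + v) powr (- (\<nu> + 1))) * indicator {0<..} v) \<partial>lborel)"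
  proof (rule nn_integral_cong_AE, use AE_lborel_singleton[of "0::real"] in eventually_elim)
    case (elim v)
    show ?case
    proof (cases "v > 0")
      case True
      have "(\<integral>\<^sup>+t. ennreal (t powr (- 1 - s)) * ennreal (f v) * (indicator {0..} v * indicator {v..} t) \<partial>lborel)
         = (\<integral>\<^sup>+t. ennreal (f v) * (ennreal (t powr (- 1 - s)) * indicator {v..} t) \<partial>lborel)"
        using True by (intro nn_integral_cong) (simp add: mult_ac)
      also have "\<dots> = ennreal (f v) * ennreal (v powr (- s) / s)"
        unfolding nn_integral_power_tail[OF s(1) True, symmetric] by (rule nn_integral_cmult) measurable
      also have "\<dots> = ennreal (f v * (v powr (- s) / s))"
        by (rule ennreal_mult'[symmetric]) (rule f0)
      also have "f v * (v powr (- s) / s) = \<nu> / s * (v powr ((1 - s) - 1) * (\<sigma> + v) powr (- (\<nu> + 1)))"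
        unfolding f_def by (simp add: minus_diff_commute)
      also have "ennreal \<dots> = ennreal (\<nu> / s) * ennreal (v powr ((1 - s) - 1) * (\<sigma> + v) powr (- (\<nu> + 1)))"
        using assms by (intro ennreal_mult') auto
      finally show ?thesis using True by (simp only: greaterThan_iff indicator_simps mult_1_right)
    qed (use elim in simp)
  qed
  also have "\<dots> = ennreal (\<nu> / s) * ennreal (\<sigma> powr ((1 - s) - (\<nu> + 1)) * Gamma (1 - s) * Gamma ((\<nu> + 1) - (1 - s)) / Gamma (\<nu> + 1))"
    by (subst nn_integral_beta_prime[symmetric]) (use assms in \<open>auto intro!: nn_integral_cmult\<close>)
  also have "\<dots> = ennreal (Gamma (1 - s) * Gamma (\<nu> + s) / (s * Gamma \<nu>) * \<sigma> powr (- \<nu> - s))"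
  proof -
    define g where "g = Gamma \<nu>"
    have g: "g > 0" unfolding g_def using assms by (intro Gamma_real_pos)
    have G: "Gamma (\<nu> + 1) = \<nu> * g"
      using Gamma_plus1[of \<nu>] assms nonpos_Ints_nonpos[of \<nu>] unfolding g_def by force
    have e: "(1 - s) - (\<nu> + 1) = - \<nu> - s" "(\<nu> + 1) - (1 - s) = \<nu> + s" by simp_all
    have "ennreal (\<nu> / s) * ennreal (\<sigma> powr (- \<nu> - s) * Gamma (1 - s) * Gamma (\<nu> + s) / (\<nu> * g)) = ennreal (\<nu> / s * (\<sigma> powr (- \<nu> - s) * Gamma (1 - s) * Gamma (\<nu> + s) / (\<nu> * g)))"
      using assms by (intro ennreal_mult'[symmetric]) auto
    also have "\<nu> / s * (\<sigma> powr (- \<nu> - s) * Gamma (1 - s) * Gamma (\<nu> + s) / (\<nu> * g)) = Gamma (1 - s) * Gamma (\<nu> + s) / (s * g) * \<sigma> powr (- \<nu> - s)"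
      using assms g by (simp add: field_simps)
    finally show ?thesis unfolding e G g_def .
  qed
  finally show ?thesis .
qed

text \<open>At the origin the heat kernel is a pure power of time, so each pair
  \<open>(i, j)\<close> contributes \<open>nn_integral_power_difference\<close> with
  \<open>\<sigma> = a i + a j\<close>. The factor \<open>Gamma (1 - s) / s\<close> there cancels
  against the constant of \<open>energy_heat\<close>.\<close>

lemma energy_heat_sum:
  fixes c a :: "nat \<Rightarrow> real"
  assumes s: "0 < s" "s < 1" and c: "\<And>i. i < n \<Longrightarrow> c i > 0" and a: "\<And>i. i < n \<Longrightarrow> a i > 0"
  defines "\<nu> \<equiv> real DIM('a) / 2"
  shows "ennreal (C_Ns DIM('a) s / 2) * energy s (heat_sum n c a :: 'a::euclidean_space \<Rightarrow> real)
    = ennreal ((4 * pi) powr (- \<nu>) * Gamma (\<nu> + s) / Gamma \<nu> * (\<Sum>i<n. \<Sum>j<n. c i * c j * (a i + a j) powr (- \<nu> - s)))"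
proof -
  define K where "K = Gamma (1 - s) * Gamma (\<nu> + s) / (s * Gamma \<nu>)"
  have \<nu>: "\<nu> > 0" unfolding \<nu>_def by simp
  have G: "Gamma (1 - s) > 0" "Gamma (\<nu> + s) > 0" "Gamma \<nu> > 0" using s \<nu> by (auto intro!: Gamma_real_pos)
  have K0: "K \<ge> 0" unfolding K_def using s G by (intro divide_nonneg_nonneg mult_nonneg_nonneg) auto
  have dec: "(\<sigma> + t) powr (- \<nu>) \<le> \<sigma> powr (- \<nu>)" if "\<sigma> > 0" "t \<ge> 0" for \<sigma> t
    using that \<nu> by (intro powr_mono2') auto
  define r where "r i j t = \<bar>t\<bar> powr (- 1 - s) * indicat_real {0<..} t * (2 * (c i * c j) * (heat_kernel (a i + a j) (0::'a) - heat_kernel (a i + a j + t) (0::'a)))" for i j t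
  have "(\<integral>\<^sup>+t\<in>{0<..}. ennreal (t powr (- 1 - s)) * heat_energy t (heat_sum n c a :: 'a \<Rightarrow> real) \<partial>lborel)
    = (\<integral>\<^sup>+t. ennreal (\<Sum>i<n. \<Sum>j<n. r i j t) \<partial>lborel)"
  proof (rule nn_integral_cong)
    fix t :: real
    show "ennreal (t powr (- 1 - s)) * heat_energy t (heat_sum n c a :: 'a \<Rightarrow> real) * indicator {0<..} t = ennreal (\<Sum>i<n. \<Sum>j<n. r i j t)"
    proof (cases "t > 0")
      case True
      have "ennreal (t powr (- 1 - s)) * heat_energy t (heat_sum n c a :: 'a \<Rightarrow> real) = ennreal (t powr (- 1 - s) * (\<Sum>i<n. \<Sum>j<n. 2 * (c i * c j) * (heat_kernel (a i + a j) (0::'a) - heat_kernel (a i + a j + t) (0::'a))))"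
      proof -
        have "heat_energy t (heat_sum n c a :: 'a \<Rightarrow> real) = ennreal (\<Sum>i<n. \<Sum>j<n. 2 * (c i * c j) * (heat_kernel (a i + a j) (0::'a) - heat_kernel (a i + a j + t) (0::'a)))"
          by (rule heat_energy_heat_sum) (use c a True in auto)
        then show ?thesis by (simp only: ennreal_mult'[OF powr_ge_zero])
      qed
      then show ?thesis using True unfolding r_def by (simp add: sum_distrib_left)
    qed (simp add: r_def)
  qed
  also have "\<dots> = ennreal (\<Sum>i<n. \<Sum>j<n. 2 * (c i * c j) * (4 * pi) powr (- \<nu>) * (K * (a i + a j) powr (- \<nu> - s)))"
  proof (rule nn_integral_double_sum)
    fix i j assume ij: "i < n" "j < n"
    have cc: "c i > 0" "c j > 0" "a i + a j > 0" using c a ij by (auto intro: add_pos_pos)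
    show "r i j \<in> borel_measurable lborel" unfolding r_def by measurable
    have diff: "heat_kernel (a i + a j) (0::'a) - heat_kernel (a i + a j + t) (0::'a) = (4 * pi) powr (- \<nu>) * ((a i + a j) powr (- \<nu>) - (a i + a j + t) powr (- \<nu>))" for t
      unfolding heat_kernel_0 \<nu>_def by (simp only: right_diff_distrib)
    show "r i j t \<ge> 0" for t
      using dec[OF cc(3), of t] cc unfolding r_def diff by (auto simp: indicator_def intro!: mult_nonneg_nonneg)
    define d where "d = 2 * (c i * c j) * (4 * pi) powr (- \<nu>)"
    have d: "d \<ge> 0" unfolding d_def using cc by simp
    have "(\<integral>\<^sup>+t. ennreal (r i j t) \<partial>lborel) = (\<integral>\<^sup>+t. ennreal d * (ennreal (t powr (- 1 - s)) * ennreal ((a i + a j) powr (- \<nu>) - (a i + a j + t) powr (- \<nu>)) * indicator {0<..} t) \<partial>lborel)"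
    proof (rule nn_integral_cong)
      fix t :: real
      show "ennreal (r i j t) = ennreal d * (ennreal (t powr (- 1 - s)) * ennreal ((a i + a j) powr (- \<nu>) - (a i + a j + t) powr (- \<nu>)) * indicator {0<..} t)"
      proof (cases "t > 0")
        case True
        have "r i j t = d * (t powr (- 1 - s) * ((a i + a j) powr (- \<nu>) - (a i + a j + t) powr (- \<nu>)))"
          unfolding r_def diff d_def using True by simp
        then show ?thesis
          using True d by (simp only: ennreal_mult'[OF d] ennreal_mult'[OF powr_ge_zero] greaterThan_iff indicator_simps mult_1_right)
      qed (simp add: r_def)
    qed
    also have "\<dots> = ennreal d * ennreal (K * (a i + a j) powr (- \<nu> - s))"
      unfolding K_def nn_integral_power_difference[OF s \<nu> cc(3), symmetric]
      by (rule nn_integral_cmult) measurable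
    also have "\<dots> = ennreal (d * (K * (a i + a j) powr (- \<nu> - s)))"
      by (rule ennreal_mult'[OF d, symmetric])
    finally show "(\<integral>\<^sup>+t. ennreal (r i j t) \<partial>lborel) = ennreal (2 * (c i * c j) * (4 * pi) powr (- \<nu>) * (K * (a i + a j) powr (- \<nu> - s)))"
      unfolding d_def .
    show "2 * (c i * c j) * (4 * pi) powr (- \<nu>) * (K * (a i + a j) powr (- \<nu> - s)) \<ge> 0"
      using cc K0 by (intro mult_nonneg_nonneg) (auto intro: less_imp_le)
  qed
  finally have I: "(\<integral>\<^sup>+t\<in>{0<..}. ennreal (t powr (- 1 - s)) * heat_energy t (heat_sum n c a :: 'a \<Rightarrow> real) \<partial>lborel)
    = ennreal (\<Sum>i<n. \<Sum>j<n. 2 * (c i * c j) * (4 * pi) powr (- \<nu>) * (K * (a i + a j) powr (- \<nu> - s)))" .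
  define S where "S = (\<Sum>i<n. \<Sum>j<n. c i * c j * (a i + a j) powr (- \<nu> - s))"
  have "(\<Sum>i<n. \<Sum>j<n. 2 * (c i * c j) * (4 * pi) powr (- \<nu>) * (K * (a i + a j) powr (- \<nu> - s))) = 2 * K * (4 * pi) powr (- \<nu>) * S"
    unfolding S_def sum_distrib_left by (intro sum.cong refl) (simp only: mult_ac)
  moreover have "ennreal (s / (2 * Gamma (1 - s))) * ennreal (2 * K * (4 * pi) powr (- \<nu>) * S) = ennreal (s / (2 * Gamma (1 - s)) * (2 * K * (4 * pi) powr (- \<nu>) * S))"
    using s G by (intro ennreal_mult'[symmetric]) auto
  moreover have "s / (2 * Gamma (1 - s)) * (2 * K * (4 * pi) powr (- \<nu>) * S) = (4 * pi) powr (- \<nu>) * Gamma (\<nu> + s) / Gamma \<nu> * S"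
  proof -
    define g1 where "g1 = Gamma (1 - s)"
    have "g1 \<noteq> 0" using G(1) unfolding g1_def by linarith
    then show ?thesis unfolding K_def g1_def[symmetric] using s by (simp add: field_simps)
  qed
  ultimately show ?thesis
    unfolding energy_heat[OF s heat_sum_measurable] I S_def[symmetric] by (simp only:)
qed

text \<open>The singular factor is itself a superposition of Gaussians:
  \<open>Gamma s * norm x powr (- (2 * s))\<close> is the integral of
  \<open>r powr (s - 1) * exp (- (r * (norm x)\<^sup>2))\<close> over positive \<open>r\<close>. The
  space integral is then Gaussian, and the one over \<open>r\<close> is
  \<open>nn_integral_beta_prime\<close>, finite since \<open>s < DIM('a) / 2\<close>.\<close>

lemma nn_integral_gaussian_hardy:
  assumes "0 < s" "s < real DIM('a) / 2" "g > 0"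
  defines "\<nu> \<equiv> real DIM('a) / 2"
  shows "(\<integral>\<^sup>+x. ennreal (exp (- (g * (norm (x::'a::euclidean_space))\<^sup>2)) / norm x powr (2 * s)) \<partial>lborel)
    = ennreal (pi powr \<nu> * Gamma (\<nu> - s) / Gamma \<nu> * g powr (s - \<nu>))"
proof -
  have G: "Gamma s > 0" "Gamma (\<nu> - s) > 0" "Gamma \<nu> > 0" using assms by (auto intro!: Gamma_real_pos)
  have "ennreal (Gamma s) * (\<integral>\<^sup>+x. ennreal (exp (- (g * (norm (x::'a))\<^sup>2)) / norm x powr (2 * s)) \<partial>lborel)
     = (\<integral>\<^sup>+x. ennreal (Gamma s) * ennreal (exp (- (g * (norm (x::'a))\<^sup>2)) / norm x powr (2 * s)) \<partial>lborel)"
    by (rule nn_integral_cmult[symmetric]) measurable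
  also have "\<dots> = (\<integral>\<^sup>+x. (\<integral>\<^sup>+r. ennreal (r powr (s - 1)) * indicator {0<..} r * ennreal (exp (- ((g + r) * (norm (x::'a))\<^sup>2))) \<partial>lborel) \<partial>lborel)"
  proof (rule nn_integral_cong_AE, use AE_lborel_singleton[of "0::'a"] in eventually_elim)
    case (elim x)
    define N where "N = (norm x)\<^sup>2"
    have N: "N > 0" using elim by (simp add: N_def)
    have N2: "N powr (- s) = 1 / norm x powr (2 * s)"
    proof -
      have "N powr s = norm x powr (2 * s)"
        using elim powr_powr[of "norm x" 2 s] by (simp add: N_def)
      then show ?thesis by (simp add: powr_minus_divide)
    qed
    have "ennreal (Gamma s) * ennreal (exp (- (g * N)) / norm x powr (2 * s)) = ennreal (Gamma s * (exp (- (g * N)) / norm x powr (2 * s)))"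
      using G by (intro ennreal_mult'[symmetric]) auto
    also have "Gamma s * (exp (- (g * N)) / norm x powr (2 * s)) = exp (- (g * N)) * (Gamma s * N powr (- s))"
      unfolding N2 by simp
    also have "ennreal \<dots> = ennreal (exp (- (g * N))) * (\<integral>\<^sup>+r\<in>{0<..}. ennreal (r powr (s - 1) * exp (- (N * r))) \<partial>lborel)"
      unfolding nn_integral_Gamma[OF N assms(1)] by (rule ennreal_mult') simp
    also have "\<dots> = (\<integral>\<^sup>+r. ennreal (exp (- (g * N))) * (ennreal (r powr (s - 1) * exp (- (N * r))) * indicator {0<..} r) \<partial>lborel)"
      by (rule nn_integral_cmult[symmetric]) measurable
    also have "\<dots> = (\<integral>\<^sup>+r. ennreal (r powr (s - 1)) * indicator {0<..} r * ennreal (exp (- ((g + r) * N))) \<partial>lborel)"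
    proof (rule nn_integral_cong)
      fix r :: real
      have "exp (- ((g + r) * N)) = exp (- (g * N)) * exp (- (N * r))"
        unfolding mult_exp_exp by (simp add: algebra_simps)
      then have "ennreal (exp (- ((g + r) * N))) = ennreal (exp (- (g * N))) * ennreal (exp (- (N * r)))"
        by (simp add: ennreal_mult')
      moreover have "ennreal (r powr (s - 1) * exp (- (N * r))) = ennreal (r powr (s - 1)) * ennreal (exp (- (N * r)))"
        by (rule ennreal_mult') simp
      ultimately show "ennreal (exp (- (g * N))) * (ennreal (r powr (s - 1) * exp (- (N * r))) * indicator {0<..} r)
        = ennreal (r powr (s - 1)) * indicator {0<..} r * ennreal (exp (- ((g + r) * N)))"
        by (simp only: mult_ac)
    qed
    finally show ?case unfolding N_def .
  qed
  also have "\<dots> = (\<integral>\<^sup>+r. (\<integral>\<^sup>+x. ennreal (r powr (s - 1)) * indicator {0<..} r * ennreal (exp (- ((g + r) * (norm (x::'a))\<^sup>2))) \<partial>lborel) \<partial>lborel)"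
    by (rule lborel_pair.Fubini') measurable
  also have "\<dots> = (\<integral>\<^sup>+r. ennreal (pi powr \<nu>) * (ennreal (r powr (s - 1) * (g + r) powr (- \<nu>)) * indicator {0<..} r) \<partial>lborel)"
  proof (rule nn_integral_cong)
    fix r :: real
    show "(\<integral>\<^sup>+x. ennreal (r powr (s - 1)) * indicator {0<..} r * ennreal (exp (- ((g + r) * (norm (x::'a))\<^sup>2))) \<partial>lborel)
      = ennreal (pi powr \<nu>) * (ennreal (r powr (s - 1) * (g + r) powr (- \<nu>)) * indicator {0<..} r)"
    proof (cases "r > 0")
      case True
      have gr: "g + r > 0" using True assms by simp
      have "(\<integral>\<^sup>+x. ennreal (r powr (s - 1)) * indicator {0<..} r * ennreal (exp (- ((g + r) * (norm (x::'a))\<^sup>2))) \<partial>lborel)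
        = ennreal (r powr (s - 1)) * indicator {0<..} r * ennreal ((pi / (g + r)) powr \<nu>)"
        unfolding \<nu>_def nn_integral_gaussian[OF gr, symmetric] by (rule nn_integral_cmult) measurable
      also have "(pi / (g + r)) powr \<nu> = pi powr \<nu> * (g + r) powr (- \<nu>)"
        using gr by (simp add: powr_divide powr_minus_divide)
      also have "ennreal (pi powr \<nu> * (g + r) powr (- \<nu>)) = ennreal (pi powr \<nu>) * ennreal ((g + r) powr (- \<nu>))"
        by (rule ennreal_mult') simp
      also have "ennreal (r powr (s - 1)) * indicator {0<..} r * (ennreal (pi powr \<nu>) * ennreal ((g + r) powr (- \<nu>)))
        = ennreal (pi powr \<nu>) * (ennreal (r powr (s - 1) * (g + r) powr (- \<nu>)) * indicator {0<..} r)"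
        unfolding ennreal_mult'[OF powr_ge_zero] by (simp only: mult_ac)
      finally show ?thesis .
    qed simp
  qed
  also have "\<dots> = ennreal (pi powr \<nu>) * ennreal (g powr (s - \<nu>) * Gamma s * Gamma (\<nu> - s) / Gamma \<nu>)"
    by (subst nn_integral_beta_prime[symmetric]) (use assms in \<open>auto intro!: nn_integral_cmult\<close>)
  also have "\<dots> = ennreal (Gamma s * (pi powr \<nu> * Gamma (\<nu> - s) / Gamma \<nu> * g powr (s - \<nu>)))"
    by (subst ennreal_mult'[symmetric]) (simp_all add: mult_ac)
  also have "\<dots> = ennreal (Gamma s) * ennreal (pi powr \<nu> * Gamma (\<nu> - s) / Gamma \<nu> * g powr (s - \<nu>))"
    using G by (intro ennreal_mult') auto
  finally show ?thesis
    using G(1) by (subst (asm) ennreal_mult_cancel_left) auto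
qed

lemma nn_integral_heat_kernel_hardy:
  assumes s: "0 < s" "s < real DIM('a) / 2" and ab: "a > 0" "b > 0"
  defines "\<nu> \<equiv> real DIM('a) / 2"
  shows "(\<integral>\<^sup>+x. ennreal (heat_kernel a (x::'a::euclidean_space) * heat_kernel b x / norm x powr (2 * s)) \<partial>lborel)
    = ennreal ((4 * pi) powr (- \<nu>) * 4 powr (- s) * Gamma (\<nu> - s) / Gamma \<nu> * ((a * b) powr (- s) * (a + b) powr (s - \<nu>)))"
proof -
  \<comment> \<open>The exponents of the two kernels add up,
    \<open>g = 1 / (4 * a) + 1 / (4 * b)\<close>. The factor \<open>(a * b) powr (- s)\<close> of
    the result is what remains of \<open>g powr (s - \<nu>)\<close> once the normalisations of the
    kernels have cancelled \<open>(a * b) powr \<nu>\<close>.\<close>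
  define g where "g = (a + b) / (4 * a * b)"
  have g: "g > 0" unfolding g_def using ab by simp
  define k where "k = (4 * pi * a) powr (- \<nu>) * (4 * pi * b) powr (- \<nu>)"
  have eq: "heat_kernel a x * heat_kernel b x = k * exp (- (g * (norm x)\<^sup>2))" for x :: 'a
  proof -
    have "- (norm x)\<^sup>2 / (4 * a) + - (norm x)\<^sup>2 / (4 * b) = - (g * (norm x)\<^sup>2)"
      unfolding g_def using ab by (simp add: field_simps)
    then have "exp (- (norm x)\<^sup>2 / (4 * a)) * exp (- (norm x)\<^sup>2 / (4 * b)) = exp (- (g * (norm x)\<^sup>2))"
      unfolding mult_exp_exp by simp
    moreover have "heat_kernel a x * heat_kernel b x = k * (exp (- (norm x)\<^sup>2 / (4 * a)) * exp (- (norm x)\<^sup>2 / (4 * b)))"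
      unfolding heat_kernel_def k_def \<nu>_def by (simp only: mult_ac)
    ultimately show ?thesis by (simp only:)
  qed
  have "(\<integral>\<^sup>+x. ennreal (heat_kernel a (x::'a) * heat_kernel b x / norm x powr (2 * s)) \<partial>lborel)
    = (\<integral>\<^sup>+x. ennreal k * ennreal (exp (- (g * (norm (x::'a))\<^sup>2)) / norm x powr (2 * s)) \<partial>lborel)"
    unfolding eq by (intro nn_integral_cong) (simp add: ennreal_mult'[symmetric] k_def)
  also have "\<dots> = ennreal k * ennreal (pi powr \<nu> * Gamma (\<nu> - s) / Gamma \<nu> * g powr (s - \<nu>))"
    unfolding \<nu>_def nn_integral_gaussian_hardy[OF s g, symmetric] by (rule nn_integral_cmult) measurable
  also have "\<dots> = ennreal (k * (pi powr \<nu> * Gamma (\<nu> - s) / Gamma \<nu> * g powr (s - \<nu>)))"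
    by (rule ennreal_mult'[symmetric]) (simp add: k_def)
  also have "k * (pi powr \<nu> * Gamma (\<nu> - s) / Gamma \<nu> * g powr (s - \<nu>))
    = (4 * pi) powr (- \<nu>) * 4 powr (- s) * Gamma (\<nu> - s) / Gamma \<nu> * ((a * b) powr (- s) * (a + b) powr (s - \<nu>))"
  proof -
    have "g powr (s - \<nu>) = (a + b) powr (s - \<nu>) * (4 * (a * b)) powr (\<nu> - s)"
      unfolding g_def using powr_minus_divide[of "4 * (a * b)" "s - \<nu>"]
      by (simp add: powr_divide mult.assoc)
    also have "(4 * (a * b)) powr (\<nu> - s) = 4 powr \<nu> * 4 powr (- s) * ((a * b) powr \<nu> * (a * b) powr (- s))"
      by (simp only: powr_mult powr_add diff_conv_add_uminus mult_ac)
    finally have gp: "g powr (s - \<nu>) = (a + b) powr (s - \<nu>) * (4 powr \<nu> * 4 powr (- s) * ((a * b) powr \<nu> * (a * b) powr (- s)))" .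
    have k: "k = (4 * pi) powr (- \<nu>) * (4 powr (- \<nu>) * pi powr (- \<nu>) * (a * b) powr (- \<nu>))"
      unfolding k_def by (simp only: powr_mult mult_ac)
    have c: "4 powr (- \<nu>) * 4 powr \<nu> = (1::real)" "pi powr (- \<nu>) * pi powr \<nu> = 1" "(a * b) powr (- \<nu>) * (a * b) powr \<nu> = 1"
      using ab by (simp_all flip: powr_add)
    have "x * (f' * p' * m') * (p * G1 / G2 * (A * (f * t * (m * n)))) = (f' * f) * (p' * p) * (m' * m) * (x * t * G1 / G2 * (n * A))"
      for x f' p' m' p G1 G2 A f t m n :: real
      by (simp add: mult_ac)
    then show ?thesis unfolding k gp c by (simp only: c mult_1)
  qed
  finally show ?thesis .
qed

lemma nn_integral_heat_sum_hardy:
  fixes c a :: "nat \<Rightarrow> real"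
  assumes s: "0 < s" "s < real DIM('a) / 2" and c: "\<And>i. i < n \<Longrightarrow> c i > 0" and a: "\<And>i. i < n \<Longrightarrow> a i > 0"
  defines "\<nu> \<equiv> real DIM('a) / 2"
  shows "(\<integral>\<^sup>+x. ennreal ((heat_sum n c a (x::'a::euclidean_space))\<^sup>2 / norm x powr (2 * s)) \<partial>lborel)
    = ennreal ((4 * pi) powr (- \<nu>) * 4 powr (- s) * Gamma (\<nu> - s) / Gamma \<nu> * (\<Sum>i<n. \<Sum>j<n. c i * c j * ((a i * a j) powr (- s) * (a i + a j) powr (s - \<nu>))))"
proof -
  define K where "K = (4 * pi) powr (- \<nu>) * 4 powr (- s) * Gamma (\<nu> - s) / Gamma \<nu>"
  have K: "K \<ge> 0" unfolding K_def \<nu>_def using s by (intro divide_nonneg_nonneg mult_nonneg_nonneg) (auto intro!: less_imp_le Gamma_real_pos)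
  have "(\<integral>\<^sup>+x. ennreal ((heat_sum n c a (x::'a))\<^sup>2 / norm x powr (2 * s)) \<partial>lborel)
    = (\<integral>\<^sup>+x. ennreal (\<Sum>i<n. \<Sum>j<n. c i * c j * (heat_kernel (a i) (x::'a) * heat_kernel (a j) x / norm x powr (2 * s))) \<partial>lborel)"
    unfolding power2_eq_square heat_sum_square by (simp only: sum_divide_distrib times_divide_eq_right)
  also have "\<dots> = ennreal (\<Sum>i<n. \<Sum>j<n. c i * c j * (K * ((a i * a j) powr (- s) * (a i + a j) powr (s - \<nu>))))"
  proof (rule nn_integral_double_sum)
    fix i j assume ij: "i < n" "j < n"
    have cc: "c i > 0" "c j > 0" using c ij by auto
    have "(\<integral>\<^sup>+x. ennreal (c i * c j * (heat_kernel (a i) (x::'a) * heat_kernel (a j) x / norm x powr (2 * s))) \<partial>lborel)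
      = (\<integral>\<^sup>+x. ennreal (c i * c j) * ennreal (heat_kernel (a i) (x::'a) * heat_kernel (a j) x / norm x powr (2 * s)) \<partial>lborel)"
      using cc by (intro nn_integral_cong ennreal_mult') simp
    also have "\<dots> = ennreal (c i * c j) * ennreal (K * ((a i * a j) powr (- s) * (a i + a j) powr (s - \<nu>)))"
      unfolding K_def \<nu>_def nn_integral_heat_kernel_hardy[OF s a a, OF ij, symmetric] by (rule nn_integral_cmult) measurable
    also have "\<dots> = ennreal (c i * c j * (K * ((a i * a j) powr (- s) * (a i + a j) powr (s - \<nu>))))"
      using cc by (intro ennreal_mult'[symmetric]) simp
    finally show "(\<integral>\<^sup>+x. ennreal (c i * c j * (heat_kernel (a i) (x::'a) * heat_kernel (a j) x / norm x powr (2 * s))) \<partial>lborel)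
      = ennreal (c i * c j * (K * ((a i * a j) powr (- s) * (a i + a j) powr (s - \<nu>))))" .
    show "c i * c j * (K * ((a i * a j) powr (- s) * (a i + a j) powr (s - \<nu>))) \<ge> 0"
      using cc K by (intro mult_nonneg_nonneg) auto
    show "c i * c j * (heat_kernel (a i) x * heat_kernel (a j) x / norm x powr (2 * s)) \<ge> 0" for x :: 'a
      using cc by (intro mult_nonneg_nonneg divide_nonneg_nonneg) auto
  qed measurable
  also have "(\<Sum>i<n. \<Sum>j<n. c i * c j * (K * ((a i * a j) powr (- s) * (a i + a j) powr (s - \<nu>))))
    = K * (\<Sum>i<n. \<Sum>j<n. c i * c j * ((a i * a j) powr (- s) * (a i + a j) powr (s - \<nu>)))"
    unfolding sum_distrib_left by (intro sum.cong refl) (simp only: mult_ac)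
  finally show ?thesis unfolding K_def .
qed

section \<open>Powers of sech and Toeplitz sums\<close>

text \<open>Arises from \<open>(exp x + exp y) powr (- p)\<close>, which equals
  \<open>exp (- (p * (x + y) / 2)) * sech_power p (x - y)\<close>: in logarithmic variables a power
  of a sum is, up to a product weight, a convolution kernel.\<close>

definition sech_power :: "real \<Rightarrow> real \<Rightarrow> real" where
  "sech_power p x = (2 * cosh (x / 2)) powr (- p)"

lemma sech_power_pos: "sech_power p x > 0"
  unfolding sech_power_def by simp

lemma sech_power_even: "sech_power p (- x) = sech_power p x"
  unfolding sech_power_def by simp

lemma sech_power_antimono: "p > 0 \<Longrightarrow> 0 \<le> x \<Longrightarrow> x \<le> y \<Longrightarrow> sech_power p y \<le> sech_power p x"
  unfolding sech_power_def by (intro powr_mono2') (auto simp: cosh_real_nonneg_le_iff)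

text \<open>The substitution \<open>t = exp x\<close> turns the integral into that of
  \<open>t powr (p / 2 - 1) * (1 + t) powr (- p)\<close> over the half-line, the case
  \<open>q = p / 2\<close> of \<open>nn_integral_beta_prime\<close>.\<close>

lemma sech_power_has_integral:
  assumes p: "p > 0"
  shows "(sech_power p has_integral ((Gamma (p / 2))\<^sup>2 / Gamma p)) UNIV"
proof -
  define f where "f x = x powr (p / 2 - 1) * (1 + x) powr (- p)" for x :: real
  define I where "I = (Gamma (p / 2))\<^sup>2 / Gamma p"
  have I: "I \<ge> 0" unfolding I_def using p by (intro divide_nonneg_nonneg) (auto intro: less_imp_le Gamma_real_pos)
  have [measurable]: "f \<in> borel_measurable borel" unfolding f_def by measurable
  have "(\<integral>\<^sup>+x. ennreal (f x * indicat_real {0<..} x) \<partial>lborel) = (\<integral>\<^sup>+x\<in>{0<..}. ennreal (f x) \<partial>lborel)"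
    by (intro nn_integral_cong) (simp add: indicator_def)
  also have "\<dots> = ennreal I"
    using nn_integral_beta_prime[of "p / 2" p 1] p unfolding f_def I_def by (simp add: power2_eq_square)
  finally have nn: "(\<integral>\<^sup>+x. ennreal (f x * indicat_real {0<..} x) \<partial>lborel) = ennreal I" .
  have "((\<lambda>x. f x * indicat_real {0<..} x) has_integral I) UNIV"
    by (rule nn_integral_has_integral[OF _ _ nn I]) (auto simp: f_def)
  then have "((\<lambda>x. if x \<in> {0<..} then f x else 0) has_integral I) UNIV"
    by (rule has_integral_eq[rotated]) (simp add: indicator_def)
  then have fI: "(f has_integral I) {0<..}"
    by (simp only: has_integral_restrict_UNIV)
  have "f absolutely_integrable_on {0<..} \<and> integral {0<..} f = I"
    using fI by (auto intro!: nonnegative_absolutely_integrable_1 simp: f_def integral_unique has_integral_integrable)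
  moreover have im: "range (exp :: real \<Rightarrow> real) = {0<..}"
    by (auto simp: image_iff intro: exp_ln[symmetric])
  ultimately have "(\<lambda>x. \<bar>exp x\<bar> * f (exp x)) absolutely_integrable_on UNIV \<and> integral UNIV (\<lambda>x. \<bar>exp x\<bar> * f (exp x)) = I"
    by (subst has_absolute_integral_change_of_variables_1'[where g = exp and g' = exp])
       (auto intro!: DERIV_exp simp: im inj_on_def)
  moreover have "\<bar>exp x\<bar> * f (exp x) = sech_power p x" for x
  proof -
    have c: "2 * cosh (x / 2) = exp (- (x / 2)) * (1 + exp x)"
    proof -
      have "exp (x / 2) = exp (- (x / 2)) * exp x" unfolding mult_exp_exp by simp
      then show ?thesis unfolding cosh_def by (simp add: algebra_simps)
    qed
    have e: "exp y powr r = exp (y * r)" for y r :: real by (simp add: powr_def)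
    have "sech_power p x = exp (x / 2 * p) * (1 + exp x) powr (- p)"
      unfolding sech_power_def c powr_mult e by simp
    also have "exp (x / 2 * p) = exp x * exp (x * (p / 2 - 1))"
      unfolding mult_exp_exp by (simp add: algebra_simps)
    finally show ?thesis unfolding f_def e by simp
  qed
  ultimately have "sech_power p absolutely_integrable_on UNIV \<and> integral UNIV (sech_power p) = I"
    by simp
  then show ?thesis unfolding I_def
    using integrable_integral[OF set_lebesgue_integral_eq_integral(1)] by metis
qed

text \<open>The properties shared by the two kernels to be compared. Monotonicity on the half-line
  bounds Toeplitz sums by integrals from both sides without any modulus of continuity, and
  integrability controls the tails.\<close>

locale even_kernel =
  fixes \<phi> :: "real \<Rightarrow> real" and I :: real
  assumes pos: "\<phi> x > 0" and even: "\<phi> (- x) = \<phi> x" and antimono: "0 \<le> x \<Longrightarrow> x \<le> y \<Longrightarrow> \<phi> y \<le> \<phi> x"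
    and has_int: "(\<phi> has_integral I) UNIV"
begin

lemma integrable: "\<phi> integrable_on {a..b}"
proof -
  have "\<phi> integrable_on UNIV" using has_int by blast
  then have "\<phi> integrable_on cbox a b" by (rule integrable_on_subcbox) simp
  then show ?thesis by simp
qed

lemma integral_symmetric:
  assumes "X \<ge> 0"
  shows "integral {- X..X} \<phi> = 2 * integral {0..X} \<phi>"
proof -
  have "integral {- X..X} \<phi> = integral {- X..0} \<phi> + integral {0..X} \<phi>"
    by (rule Henstock_Kurzweil_Integration.integral_combine[symmetric]) (use assms integrable in auto)
  also have "integral {- X..0} \<phi> = integral {0..X} \<phi>"
  proof -
    have "integral {- X..- 0} (\<lambda>x. \<phi> (- x)) = integral {0..X} \<phi>" by (rule Henstock_Kurzweil_Integration.integral_reflect_real)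
    then show ?thesis by (simp only: even minus_zero)
  qed
  finally show ?thesis by simp
qed

lemma half_integral_le: "2 * integral {0..X} \<phi> \<le> I" if "X \<ge> 0"
proof -
  have "integral {- X..X} \<phi> \<le> integral UNIV \<phi>"
    by (rule integral_subset_le) (use has_int pos integrable in \<open>auto intro: less_imp_le\<close>)
  then show ?thesis
    using integral_symmetric[OF that] has_int by (simp add: integral_unique)
qed

text \<open>The integral over the line is by definition a limit over large boxes, and on a symmetric
  box evenness gives twice the half-line integral.\<close>

lemma half_integral_approx:
  assumes "e > 0"
  obtains X where "X \<ge> 0" "\<And>Y. Y \<ge> X \<Longrightarrow> 2 * integral {0..Y} \<phi> > I - e"
proof -
  obtain B where B: "B > 0" "\<And>a b. ball 0 B \<subseteq> cbox a b \<Longrightarrow> \<exists>z. ((\<lambda>x. if x \<in> UNIV then \<phi> x else 0) has_integral z) (cbox a b) \<and> norm (z - I) < e"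
    using has_int[unfolded has_integral'[of \<phi>]] assms by meson
  show ?thesis
  proof (rule that)
    show "B \<ge> 0" using B(1) by simp
    fix Y assume Y: "Y \<ge> B"
    have "ball 0 B \<subseteq> cbox (- Y) Y" using Y by (auto simp: dist_norm)
    then obtain z where z: "(\<phi> has_integral z) {- Y..Y}" "norm (z - I) < e"
      using B(2) by (force simp: cbox_interval)
    then have "z = 2 * integral {0..Y} \<phi>"
      using integral_symmetric[of Y] Y B(1) by (simp add: integral_unique)
    then show "2 * integral {0..Y} \<phi> > I - e" using z(2) by auto
  qed
qed

text \<open>Half a row of the Toeplitz matrix, without the diagonal; \<open>h * S h M\<close> is the
  right-endpoint Riemann sum of \<open>\<phi>\<close> on \<open>{0..h * real M}\<close>.\<close>

definition S :: "real \<Rightarrow> nat \<Rightarrow> real" where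
  "S h M = (\<Sum>m<M. \<phi> (h * real (Suc m)))"

lemma integral_step:
  assumes "h > 0"
  shows "integral {0..h * real (Suc m)} \<phi> = integral {0..h * real m} \<phi> + integral {h * real m..h * real (Suc m)} \<phi>"
  by (rule Henstock_Kurzweil_Integration.integral_combine[symmetric]) (use assms integrable in auto)

lemma step_bounds:
  assumes "h > 0"
  shows "h * \<phi> (h * real (Suc m)) \<le> integral {h * real m..h * real (Suc m)} \<phi>"
    and "integral {h * real m..h * real (Suc m)} \<phi> \<le> h * \<phi> (h * real m)"
proof -
  have le: "h * real m \<le> h * real (Suc m)" using assms by (intro mult_left_mono) auto
  have len: "h * real (Suc m) - h * real m = h" by (simp add: algebra_simps)
  have nn: "0 \<le> h * real m" using assms by simp
  have c: "integral {h * real m..h * real (Suc m)} (\<lambda>x. k) = h * k" for k :: real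
    using le len by simp
  show "h * \<phi> (h * real (Suc m)) \<le> integral {h * real m..h * real (Suc m)} \<phi>"
    by (subst c[symmetric], rule integral_le) (use integrable antimono nn in \<open>auto intro: order_trans\<close>)
  show "integral {h * real m..h * real (Suc m)} \<phi> \<le> h * \<phi> (h * real m)"
    by (subst c[symmetric], rule integral_le) (use integrable antimono nn in \<open>auto intro: order_trans\<close>)
qed

lemma S_upper: "h > 0 \<Longrightarrow> h * S h M \<le> integral {0..h * real M} \<phi>"
proof (induction M)
  case (Suc M)
  have "h * S h (Suc M) = h * S h M + h * \<phi> (h * real (Suc M))"
    unfolding S_def by (simp add: distrib_left)
  then show ?case
    using Suc step_bounds(1)[OF Suc.prems, of M] integral_step[OF Suc.prems, of M] by linarith
qed (simp add: S_def)

lemma S_lower: "h > 0 \<Longrightarrow> integral {0..h * real (Suc M)} \<phi> \<le> h * (\<phi> 0 + S h M)"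
proof (induction M)
  case 0
  then show ?case
    using step_bounds(2)[OF 0, of 0] by (simp add: S_def)
next
  case (Suc M)
  have "h * (\<phi> 0 + S h (Suc M)) = h * (\<phi> 0 + S h M) + h * \<phi> (h * real (Suc M))"
    unfolding S_def by (simp add: distrib_left)
  then show ?case
    using Suc step_bounds(2)[OF Suc.prems, of "Suc M"] integral_step[OF Suc.prems, of "Suc M"] by linarith
qed

lemma S_mono: "M \<le> N \<Longrightarrow> S h M \<le> S h N"
  unfolding S_def by (rule sum_mono2) (auto intro: less_imp_le pos)

text \<open>In a matrix of size \<open>n = i + Suc k\<close>, row \<open>i\<close> has
  \<open>i\<close> entries before the diagonal and \<open>k\<close> after it; evenness identifies
  both pieces with sums \<open>S\<close>.\<close>

lemma row_sum: "(\<Sum>j<i + Suc k. \<phi> (h * (real i - real j))) = \<phi> 0 + S h i + S h k"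
proof -
  have "(\<Sum>j<i + Suc k. \<phi> (h * (real i - real j))) = (\<Sum>j<i. \<phi> (h * (real i - real j))) + (\<phi> 0 + S h k)"
  proof (induction k)
    case (Suc k)
    have "h * (real i - real (i + Suc k)) = - (h * real (Suc k))" by (simp add: algebra_simps)
    then have "\<phi> (h * (real i - real (i + Suc k))) = \<phi> (h * real (Suc k))"
      by (simp only: even)
    then show ?case using Suc by (simp add: S_def)
  qed (simp add: S_def)
  also have "(\<Sum>j<i. \<phi> (h * (real i - real j))) = (\<Sum>j<i. \<phi> (h * real (Suc (i - Suc j))))"
    by (intro sum.cong refl) (simp add: of_nat_diff)
  also have "\<dots> = S h i"
    unfolding S_def by (rule sum.nat_diff_reindex[where g = "\<lambda>m. \<phi> (h * real (Suc m))"])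
  finally show ?thesis by simp
qed

definition T :: "real \<Rightarrow> nat \<Rightarrow> real" where
  "T h n = (\<Sum>i<n. \<Sum>j<n. \<phi> (h * (real i - real j)))"

lemma T_upper:
  assumes "h > 0"
  shows "h * T h n \<le> real n * (h * \<phi> 0 + I)"
proof -
  have "h * (\<Sum>j<n. \<phi> (h * (real i - real j))) \<le> h * \<phi> 0 + I" if "i < n" for i
  proof -
    have "n = i + Suc (n - Suc i)" using that by simp
    then obtain k where k: "n = i + Suc k" by blast
    have "h * S h i \<le> I / 2" "h * S h k \<le> I / 2"
      using S_upper[OF assms, of i] S_upper[OF assms, of k] half_integral_le[of "h * real i"] half_integral_le[of "h * real k"] assms by auto
    then show ?thesis unfolding k row_sum by (simp add: distrib_left)
  qed
  then have "(\<Sum>i<n. h * (\<Sum>j<n. \<phi> (h * (real i - real j)))) \<le> (\<Sum>i<n. h * \<phi> 0 + I)"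
    by (intro sum_mono) auto
  then show ?thesis unfolding T_def by (simp add: sum_distrib_left)
qed

text \<open>Rows close to the first or the last index miss part of the mass of
  \<open>\<phi>\<close>. The \<open>n - 2 * M\<close> middle rows have at least \<open>M\<close>
  entries on each side of the diagonal; the others are dropped, all entries being positive.\<close>

lemma T_lower:
  assumes "h > 0" "2 * M \<le> n"
  shows "real (n - 2 * M) * (2 * integral {0..h * real (Suc M)} \<phi> - h * \<phi> 0) \<le> h * T h n"
proof -
  have row: "2 * integral {0..h * real (Suc M)} \<phi> - h * \<phi> 0 \<le> h * (\<Sum>j<n. \<phi> (h * (real i - real j)))"
    if "i \<in> {M..<n - M}" for i
  proof -
    have "i < n" using that less_le_trans[of i "n - M" n] by simp
    then have "n = i + Suc (n - Suc i)" by simp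
    then obtain k where k: "n = i + Suc k" by blast
    have "S h M \<le> S h i" "S h M \<le> S h k" using that k by (auto intro!: S_mono)
    then have "h * (2 * (\<phi> 0 + S h M) - \<phi> 0) \<le> h * (\<phi> 0 + S h i + S h k)"
      using assms(1) by (intro mult_left_mono) auto
    moreover have "h * (2 * (\<phi> 0 + S h M) - \<phi> 0) = 2 * (h * (\<phi> 0 + S h M)) - h * \<phi> 0" by (simp add: algebra_simps)
    ultimately show ?thesis
      unfolding k row_sum using S_lower[OF assms(1), of M] by linarith
  qed
  have "real (n - 2 * M) * (2 * integral {0..h * real (Suc M)} \<phi> - h * \<phi> 0) = (\<Sum>i\<in>{M..<n - M}. 2 * integral {0..h * real (Suc M)} \<phi> - h * \<phi> 0)"
  proof -
    have "n - M - M = n - 2 * M" by simp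
    then show ?thesis by (simp only: sum_constant card_atLeastLessThan)
  qed
  also have "\<dots> \<le> (\<Sum>i\<in>{M..<n - M}. h * (\<Sum>j<n. \<phi> (h * (real i - real j))))"
    by (rule sum_mono) (rule row)
  also have "\<dots> \<le> (\<Sum>i<n. h * (\<Sum>j<n. \<phi> (h * (real i - real j))))"
    using assms(1) by (intro sum_mono2 mult_nonneg_nonneg sum_nonneg) (auto intro: less_imp_le pos)
  also have "\<dots> = h * T h n" unfolding T_def by (simp add: sum_distrib_left)
  finally show ?thesis .
qed

end

lemma sech_power_even_kernel: "p > 0 \<Longrightarrow> even_kernel (sech_power p) ((Gamma (p / 2))\<^sup>2 / Gamma p)"
  by unfold_locales (auto simp: sech_power_pos sech_power_even sech_power_antimono sech_power_has_integral)

text \<open>For large \<open>n\<close> and small \<open>h\<close> the quotient of the two Toeplitz sums is close to the quotient of the integrals.\<close>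

lemma toeplitz_compare:
  assumes "even_kernel f I" "even_kernel g J" and PQ: "0 < P" "0 < Q" "P * I < Q * J"
  obtains h n where "h > 0" "P * (\<Sum>i<n. \<Sum>j<n. f (h * (real i - real j))) < Q * (\<Sum>i<(n::nat). \<Sum>j<n. g (h * (real i - real j)))"
proof -
  interpret F: even_kernel f I by fact
  interpret G: even_kernel g J by fact
  define d where "d = Q * J - P * I"
  have d: "d > 0" using PQ by (simp add: d_def)
  define w where "w = P * f 0 + Q * g 0"
  have w: "w > 0" unfolding w_def using PQ F.pos[of 0] G.pos[of 0] by (intro add_pos_pos mult_pos_pos)
  \<comment> \<open>Per row, the diagonal terms cost \<open>h * w = d / 4\<close>, and cutting off
    the integral of \<open>g\<close> costs at most another \<open>d / 4\<close>. This leaves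
    \<open>B - A = d / 2\<close> of the gap \<open>d\<close>, and \<open>n\<close> is taken so large
    that the \<open>2 * M\<close> dropped rows do not use it up.\<close>
  define h where "h = d / (4 * w)"
  have h: "h > 0" "h * w = d / 4" unfolding h_def using d w by auto
  obtain X where X: "X \<ge> 0" "\<And>Y. Y \<ge> X \<Longrightarrow> 2 * integral {0..Y} g > J - d / (4 * Q)"
    using G.half_integral_approx[of "d / (4 * Q)"] d PQ by auto
  obtain M :: nat where M: "X / h \<le> real M" using real_arch_simple by blast
  then have "X \<le> h * real (Suc M)" using h(1) by (simp add: field_simps)
  then have "2 * integral {0..h * real (Suc M)} g > J - d / (4 * Q)" by (rule X)
  then have "Q * (2 * integral {0..h * real (Suc M)} g) > Q * (J - d / (4 * Q))"
    using PQ by (intro mult_strict_left_mono)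
  then have QJ: "Q * (2 * integral {0..h * real (Suc M)} g) > Q * J - d / 4"
    using PQ by (simp add: right_diff_distrib)
  define A where "A = P * I + P * (h * f 0)"
  define B where "B = Q * J - d / 4 - Q * (h * g 0)"
  have hw: "P * (h * f 0) + Q * (h * g 0) = d / 4" using h(2) unfolding w_def by (simp add: algebra_simps)
  then have BA: "B - A = d / 2" using d_def unfolding A_def B_def by linarith
  obtain n0 :: nat where n0: "2 * real M * \<bar>B\<bar> / (d / 2) < real n0" using reals_Archimedean2 by blast
  define n where "n = n0 + 2 * M"
  have nM: "2 * M \<le> n" unfolding n_def by simp
  have n1: "2 * real M * \<bar>B\<bar> / (d / 2) < real n" using n0 unfolding n_def by simp
  have key: "real n * A < real (n - 2 * M) * B"
  proof -
    have "2 * real M * B \<le> 2 * real M * \<bar>B\<bar>" by (intro mult_left_mono) auto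
    also have "\<dots> < real n * (B - A)" using n1 d unfolding BA by (simp add: field_simps)
    finally have "2 * real M * B < real n * (B - A)" .
    then show ?thesis using nM by (simp add: of_nat_diff algebra_simps)
  qed
  have "h * (P * F.T h n) \<le> real n * A"
    using mult_left_mono[OF F.T_upper[OF h(1), of n], of P] PQ unfolding A_def by (simp add: algebra_simps)
  also have "\<dots> < real (n - 2 * M) * B" by (rule key)
  also have "\<dots> \<le> real (n - 2 * M) * (Q * (2 * integral {0..h * real (Suc M)} g - h * g 0))"
    using QJ unfolding B_def by (intro mult_left_mono) (simp_all add: right_diff_distrib)
  also have "\<dots> = Q * (real (n - 2 * M) * (2 * integral {0..h * real (Suc M)} g - h * g 0))" by (simp only: mult_ac)
  also have "\<dots> \<le> Q * (h * G.T h n)"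
    using PQ by (intro mult_left_mono G.T_lower h nM) auto
  finally have "h * (P * F.T h n) < h * (Q * G.T h n)" by (simp only: mult_ac)
  then have "P * F.T h n < Q * G.T h n" using h(1) by simp
  then show ?thesis using that[OF h(1), of n] unfolding F.T_def G.T_def by blast
qed

theorem hardy_constant_optimal:
  assumes s: "0 < s" "s < 1" "2 * s < real DIM('a)" and L: "gamma_H DIM('a) s < L"
  obtains n c a where "\<And>i. i < n \<Longrightarrow> c i > 0" "\<And>i. i < n \<Longrightarrow> a i > (0::real)"
    "ennreal (C_Ns DIM('a) s / 2) * energy s (heat_sum n c a :: 'a::euclidean_space \<Rightarrow> real)
      < ennreal L * (\<integral>\<^sup>+x. ennreal ((heat_sum n c a (x::'a))\<^sup>2 / norm x powr (2 * s)) \<partial>lborel)"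
proof -
  define \<nu> where "\<nu> = real DIM('a) / 2"
  have \<nu>: "\<nu> - s > 0" "\<nu> + s > 0" "\<nu> > 0" "s < real DIM('a) / 2" using s by (auto simp: \<nu>_def)
  define g1 where "g1 = Gamma (\<nu> + s)"
  define g2 where "g2 = Gamma (\<nu> - s)"
  define h1 where "h1 = Gamma ((\<nu> + s) / 2)"
  define h2 where "h2 = Gamma ((\<nu> - s) / 2)"
  define g0 where "g0 = Gamma \<nu>"
  have g: "g1 > 0" "g2 > 0" "h1 > 0" "h2 > 0" "g0 > 0"
    unfolding g1_def g2_def h1_def h2_def g0_def using \<nu> by (auto intro!: Gamma_real_pos)
  have e: "(real DIM('a) + 2 * s) / 4 = (\<nu> + s) / 2" "(real DIM('a) - 2 * s) / 4 = (\<nu> - s) / 2"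
    unfolding \<nu>_def by (simp_all add: field_simps)
  have two: "(2::real) powr (2 * s) = 4 powr s" using powr_powr[of 2 2 s] by simp
  define f where "f = (4::real) powr s"
  have f: "f > 0" unfolding f_def by simp
  have gH: "gamma_H DIM('a) s = f * (h1\<^sup>2 / h2\<^sup>2)"
    unfolding gamma_H_def e two f_def h1_def h2_def ..
  have gH0: "gamma_H DIM('a) s \<ge> 0" unfolding gH using f by simp
  then have L0: "L > 0" using L by linarith
  \<comment> \<open>The constants \<open>Gamma (\<nu> + s)\<close> and
    \<open>Gamma (\<nu> - s)\<close> of the two forms cancel the denominators of the two sech
    integrals, so the comparison reduces to \<open>gamma_H DIM('a) s < L\<close>.\<close>
  have "(f * g1) * (h1\<^sup>2 / g1) < (L * g2) * (h2\<^sup>2 / g2)"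
    using L g unfolding gH by (simp add: divide_simps)
  moreover have "even_kernel (sech_power (\<nu> + s)) (h1\<^sup>2 / g1)" "even_kernel (sech_power (\<nu> - s)) (h2\<^sup>2 / g2)"
    unfolding h1_def g1_def h2_def g2_def by (rule sech_power_even_kernel, rule \<nu>)+
  moreover have "f * g1 > 0" "L * g2 > 0" using f g L0 by auto
  ultimately obtain h n where h: "h > 0" and cmp: "f * g1 * (\<Sum>i<n. \<Sum>j<n. sech_power (\<nu> + s) (h * (real i - real j))) < L * g2 * (\<Sum>i<n. \<Sum>j<n. sech_power (\<nu> - s) (h * (real i - real j)))"
    using toeplitz_compare by blast
  \<comment> \<open>The exponent in \<open>c\<close> is \<open>(N + 2s)/4\<close>, so
    \<open>c i\<close> is \<open>a i\<close> to the power \<open>b\<close> that generates the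
    comparison function of the Hardy inequality. It is the one exponent that removes the dependence
    on \<open>i + j\<close> from both forms at once, as \<open>A\<close> and \<open>B\<close>
    show.\<close>
  define a where "a i = exp (h * real i)" for i :: nat
  define c where "c i = exp (h * real i * ((\<nu> + s) / 2))" for i :: nat
  have ac: "c i > 0" "a i > 0" for i unfolding a_def c_def by auto
  have ep: "exp y powr r = exp (y * r)" for y r :: real by (simp add: powr_def)
  have sum: "(a i + a j) powr (- q) = exp (- (h * (real i + real j) * (q / 2))) * sech_power q (h * (real i - real j))" for i j q
  proof -
    have "a i + a j = exp (h * (real i + real j) / 2) * (2 * cosh (h * (real i - real j) / 2))"
    proof -
      have "2 * cosh (h * (real i - real j) / 2) = exp (h * (real i - real j) / 2) + exp (- (h * (real i - real j) / 2))"
        unfolding cosh_def by simp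
      then have "exp (h * (real i + real j) / 2) * (2 * cosh (h * (real i - real j) / 2))
        = exp (h * (real i + real j) / 2 + h * (real i - real j) / 2) + exp (h * (real i + real j) / 2 + - (h * (real i - real j) / 2))"
        by (simp only: distrib_left exp_add)
      also have "h * (real i + real j) / 2 + h * (real i - real j) / 2 = h * real i" by (simp add: field_simps)
      also have "h * (real i + real j) / 2 + - (h * (real i - real j) / 2) = h * real j" by (simp add: field_simps)
      finally show ?thesis unfolding a_def ..
    qed
    then have "(a i + a j) powr (- q) = exp (h * (real i + real j) / 2 * - q) * sech_power q (h * (real i - real j))"
      unfolding sech_power_def by (simp only: powr_mult ep)
    then show ?thesis by simp
  qed
  have A: "c i * c j * (a i + a j) powr (- \<nu> - s) = sech_power (\<nu> + s) (h * (real i - real j))" for i j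
  proof -
    have q: "- \<nu> - s = - (\<nu> + s)" by simp
    have "c i * c j * exp (- (h * (real i + real j) * ((\<nu> + s) / 2))) = 1"
      unfolding c_def mult_exp_exp by (simp add: algebra_simps)
    then show ?thesis unfolding q sum by (simp add: mult.assoc[symmetric])
  qed
  have B: "c i * c j * ((a i * a j) powr (- s) * (a i + a j) powr (s - \<nu>)) = sech_power (\<nu> - s) (h * (real i - real j))" for i j
  proof -
    have q: "s - \<nu> = - (\<nu> - s)" by simp
    have "c i * c j * ((a i * a j) powr (- s) * exp (- (h * (real i + real j) * ((\<nu> - s) / 2)))) = 1"
      unfolding c_def a_def mult_exp_exp ep by (simp add: field_simps)
    then show ?thesis unfolding q sum by (simp add: mult.assoc[symmetric])
  qed
  define TA where "TA = (\<Sum>i<n. \<Sum>j<n. sech_power (\<nu> + s) (h * (real i - real j)))"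
  define TB where "TB = (\<Sum>i<n. \<Sum>j<n. sech_power (\<nu> - s) (h * (real i - real j)))"
  define k where "k = (4 * pi) powr (- \<nu>)"
  have k: "k > 0" unfolding k_def by simp
  have TB: "TB \<ge> 0" unfolding TB_def by (intro sum_nonneg less_imp_le sech_power_pos)
  have EA: "ennreal (C_Ns DIM('a) s / 2) * energy s (heat_sum n c a :: 'a \<Rightarrow> real) = ennreal (k * g1 / g0 * TA)"
    using energy_heat_sum[where 'a = 'a, OF s(1,2), of n c a] ac unfolding \<nu>_def[symmetric] A TA_def g1_def g0_def k_def by simp
  have HB: "(\<integral>\<^sup>+x. ennreal ((heat_sum n c a (x::'a))\<^sup>2 / norm x powr (2 * s)) \<partial>lborel) = ennreal (k * 4 powr (- s) * g2 / g0 * TB)"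
    using nn_integral_heat_sum_hardy[where 'a = 'a, OF s(1) \<nu>(4), of n c a] ac unfolding \<nu>_def[symmetric] B TB_def g2_def g0_def k_def by simp
  have "k * g1 / g0 * TA < L * (k * 4 powr (- s) * g2 / g0 * TB)"
  proof -
    have i: "4 powr (- s) = 1 / f" unfolding f_def by (rule powr_minus_divide)
    have "f * g1 * TA < L * g2 * TB" using cmp unfolding TA_def TB_def .
    then have "(k / (g0 * f)) * (f * g1 * TA) < (k / (g0 * f)) * (L * g2 * TB)"
      using k g f by (intro mult_strict_left_mono divide_pos_pos mult_pos_pos) auto
    then show ?thesis unfolding i using g f by (simp add: field_simps)
  qed
  moreover have "k * 4 powr (- s) * g2 / g0 * TB \<ge> 0"
    using k g TB by (intro mult_nonneg_nonneg divide_nonneg_nonneg) auto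
  moreover have "TA \<ge> 0" unfolding TA_def by (intro sum_nonneg less_imp_le sech_power_pos)
  then have "0 \<le> k * g1 / g0 * TA"
    using k g by (intro mult_nonneg_nonneg divide_nonneg_nonneg) auto
  ultimately have "ennreal (C_Ns DIM('a) s / 2) * energy s (heat_sum n c a :: 'a \<Rightarrow> real)
      < ennreal L * (\<integral>\<^sup>+x. ennreal ((heat_sum n c a (x::'a))\<^sup>2 / norm x powr (2 * s)) \<partial>lborel)"
    unfolding EA HB using L0 by (subst ennreal_mult'[symmetric]) (simp, intro ennreal_lessI, linarith+)
  then show ?thesis using that[of n c a] ac by blast
qed

section \<open>Smooth functions with compact support\<close>

text \<open>\<open>class_C\<close> is phrased with \<open>frechet_derivative\<close>, which is a
  choice; derivatives are unique, so any derivative found by the calculus rules may take its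
  place.\<close>

lemma class_C_SucI:
  assumes "\<And>x. (f has_derivative f' x) (at x)" "\<And>b. b \<in> Basis \<Longrightarrow> class_C n (\<lambda>x. f' x b)"
  shows "class_C (Suc n) f"
proof -
  have "frechet_derivative f (at x) = f' x" for x
    using frechet_derivative_at[OF assms(1)] by simp
  then show ?thesis using assms by (auto simp: differentiable_def)
qed

lemma class_C_SucD:
  assumes "class_C (Suc n) f"
  shows "(f has_derivative frechet_derivative f (at x)) (at x)" "b \<in> Basis \<Longrightarrow> class_C n (\<lambda>x. frechet_derivative f (at x) b)"
  using assms by (auto simp: frechet_derivative_works[symmetric])

text \<open>The product rule and the chain rule leave one function undifferentiated; the inductions
  for \<open>class_C_mult\<close> and \<open>class_C_compose\<close> need it one order
  lower.\<close>

lemma class_C_Suc_weaken: "class_C (Suc n) f \<Longrightarrow> class_C n f"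
proof (induction n arbitrary: f)
  case 0
  then show ?case
    by (auto intro!: continuous_at_imp_continuous_on differentiable_imp_continuous_within)
next
  case (Suc n)
  show ?case
    by (rule class_C_SucI[OF class_C_SucD(1)[OF Suc.prems]]) (rule Suc.IH[OF class_C_SucD(2)[OF Suc.prems]])
qed

lemma class_C_const: "class_C n (\<lambda>x. c)"
proof (induction n arbitrary: c)
  case (Suc n)
  show ?case by (rule class_C_SucI[of _ "\<lambda>x h. 0"]) (auto intro: Suc)
qed simp

lemma class_C_add: "class_C n f \<Longrightarrow> class_C n g \<Longrightarrow> class_C n (\<lambda>x. f x + g x)"
proof (induction n arbitrary: f g)
  case (Suc n)
  note D = class_C_SucD[OF Suc.prems(1)] class_C_SucD[OF Suc.prems(2)]
  show ?case
    by (rule class_C_SucI[OF has_derivative_add[OF D(1,3)]]) (rule Suc.IH[OF D(2,4)])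
qed (auto intro: continuous_on_add)

lemma class_C_mult: "class_C n f \<Longrightarrow> class_C n g \<Longrightarrow> class_C n (\<lambda>x. f x * g x)"
proof (induction n arbitrary: f g)
  case (Suc n)
  note D = class_C_SucD[OF Suc.prems(1)] class_C_SucD[OF Suc.prems(2)]
  note W = class_C_Suc_weaken[OF Suc.prems(1)] class_C_Suc_weaken[OF Suc.prems(2)]
  show ?case
    by (rule class_C_SucI[OF has_derivative_mult[OF D(1,3)]])
       (intro class_C_add Suc.IH W D)
qed (auto intro: continuous_on_mult)

lemma class_C_sum: "(\<And>i. i \<in> A \<Longrightarrow> class_C n (f i)) \<Longrightarrow> class_C n (\<lambda>x. \<Sum>i\<in>A. f i x)"
  by (induction A rule: infinite_finite_induct) (auto intro: class_C_add class_C_const)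

lemma class_C_inner: "class_C n (\<lambda>x. x \<bullet> c)"
proof (cases n)
  case (Suc m)
  then show ?thesis
    by (simp only:) (rule class_C_SucI[of _ "\<lambda>x h. h \<bullet> c"], auto intro!: derivative_eq_intros class_C_const)
qed (auto intro: continuous_intros)

lemma class_C_norm_sq: "class_C n (\<lambda>x. (norm x)\<^sup>2)"
proof -
  have "class_C n (\<lambda>x. \<Sum>b\<in>Basis. (x \<bullet> b) * (x \<bullet> b))"
    by (intro class_C_sum class_C_mult class_C_inner)
  then show ?thesis
    by (simp add: power2_norm_eq_inner flip: euclidean_inner)
qed

text \<open>\<open>G\<close> is a function together with all its derivatives, \<open>G m\<close>
  being the \<open>m\<close>-th. The chain rule replaces \<open>G m\<close> by
  \<open>G (Suc m)\<close>, so the induction on \<open>n\<close> has to run over all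
  \<open>m\<close>. The instances are the constant sequence \<open>exp\<close> and the sequence
  \<open>bump\<close>.\<close>

lemma class_C_compose:
  fixes G :: "nat \<Rightarrow> real \<Rightarrow> real"
  assumes G: "\<And>m y. (G m has_real_derivative G (Suc m) y) (at y)" and f: "class_C n f"
  shows "class_C n (\<lambda>x. G m (f x))"
  using f
proof (induction n arbitrary: m)
  case 0
  have "continuous_on UNIV (G m)"
    using G by (auto intro!: continuous_at_imp_continuous_on DERIV_isCont)
  then show ?case using 0 by (auto intro: continuous_on_compose2)
next
  case (Suc n)
  note D = class_C_SucD[OF Suc.prems]
  have "((\<lambda>x. G m (f x)) has_derivative (\<lambda>h. G (Suc m) (f x) * frechet_derivative f (at x) h)) (at x)" for x
    by (rule has_derivative_compose[OF D(1) G[unfolded has_field_derivative_def]])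
  then show ?case
    by (rule class_C_SucI) (intro class_C_mult Suc.IH class_C_Suc_weaken[OF Suc.prems] D)
qed

section \<open>A smooth cutoff function\<close>

text \<open>The polynomial \<open>P\<close> in \<open>P (1 / y) * exp (- (1 / y))\<close>.
  Differentiating such a function gives the same form with \<open>X\<^sup>2 * (P - P')\<close> in
  place of \<open>P\<close>, and \<open>[:0, 0, 1:]\<close> is \<open>X\<^sup>2\<close>.\<close>

fun bump_poly :: "nat \<Rightarrow> real poly" where
  "bump_poly 0 = 1"
| "bump_poly (Suc m) = [:0, 0, 1:] * (bump_poly m - pderiv (bump_poly m))"

text \<open>The \<open>m\<close>-th derivative of the function that is
  \<open>exp (- (1 / y))\<close> for positive \<open>y\<close> and 0 elsewhere; the whole sequence
  of derivatives is what \<open>class_C_compose\<close> asks for.\<close>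

definition bump :: "nat \<Rightarrow> real \<Rightarrow> real" where
  "bump m y = (if y > 0 then poly (bump_poly m) (1 / y) * exp (- (1 / y)) else 0)"

lemma poly_mult_exp_tendsto_0: "((\<lambda>z. poly p z * exp (- z)) \<longlongrightarrow> 0) (at_top :: real filter)"
proof -
  have "((\<lambda>z. \<Sum>i\<le>degree p. coeff p i * (z ^ i / exp z)) \<longlongrightarrow> (\<Sum>i\<le>degree p. coeff p i * 0)) (at_top :: real filter)"
    by (intro tendsto_intros tendsto_power_div_exp_0)
  then show ?thesis
    by (simp add: poly_altdef sum_distrib_right exp_minus divide_inverse mult.assoc)
qed

lemma bump_deriv: "(bump m has_real_derivative bump (Suc m) y) (at y)"
proof -
  consider "y > 0" | "y < 0" | "y = 0" by linarith
  then show ?thesis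
  proof cases
    case 1
    have "((\<lambda>y. poly (bump_poly m) (1 / y) * exp (- (1 / y))) has_real_derivative
        (poly (pderiv (bump_poly m)) (1 / y) * (- (1 / y\<^sup>2)) * exp (- (1 / y)) + exp (- (1 / y)) * (1 / y\<^sup>2) * poly (bump_poly m) (1 / y))) (at y)"
    proof -
      have i: "((\<lambda>y. 1 / y) has_real_derivative - (1 / y\<^sup>2)) (at y)"
        using 1 by (auto intro!: derivative_eq_intros simp: power2_eq_square)
      show ?thesis
        using DERIV_mult[OF DERIV_chain2[OF poly_DERIV i] DERIV_chain2[OF DERIV_exp DERIV_minus[OF i]]] by simp
    qed
    also have "poly (pderiv (bump_poly m)) (1 / y) * (- (1 / y\<^sup>2)) * exp (- (1 / y)) + exp (- (1 / y)) * (1 / y\<^sup>2) * poly (bump_poly m) (1 / y) = bump (Suc m) y"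
      using 1 by (simp add: bump_def power2_eq_square algebra_simps)
    finally show ?thesis
      by (rule has_field_derivative_transform_within_open[of _ _ _ "{0<..}"]) (use 1 in \<open>auto simp: bump_def\<close>)
  next
    case 2
    have "((\<lambda>y. 0) has_real_derivative bump (Suc m) y) (at y)"
      using 2 by (simp add: bump_def)
    then show ?thesis
      by (rule has_field_derivative_transform_within_open[of _ _ _ "{..<0}"]) (use 2 in \<open>auto simp: bump_def\<close>)
  next
    case 3
    \<comment> \<open>From the right the difference quotient is a polynomial in
      \<open>z = 1 / h\<close> times \<open>exp (- z)\<close>, with \<open>z\<close> tending to
      infinity; from the left it is 0.\<close>
    have "((\<lambda>h. bump m h / h) \<longlongrightarrow> 0) (at_right 0)"
    proof -
      have "((\<lambda>h. poly ([:0, 1:] * bump_poly m) (inverse h) * exp (- inverse h)) \<longlongrightarrow> 0) (at_right (0::real))"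
        by (rule filterlim_compose[OF poly_mult_exp_tendsto_0 filterlim_inverse_at_top_right])
      then show ?thesis
      proof (rule Lim_transform_eventually)
        show "\<forall>\<^sub>F h in at_right 0. poly ([:0, 1:] * bump_poly m) (inverse h) * exp (- inverse h) = bump m h / h"
          by (rule eventually_at_right_less[THEN eventually_mono]) (simp add: bump_def divide_inverse mult_ac)
      qed
    qed
    moreover have "((\<lambda>h. bump m h / h) \<longlongrightarrow> 0) (at_left 0)"
    proof (rule Lim_transform_eventually[OF tendsto_const])
      show "\<forall>\<^sub>F h in at_left 0. 0 = bump m h / h"
        unfolding eventually_at_filter by (simp add: bump_def)
    qed
    ultimately have "((\<lambda>h. bump m h / h) \<longlongrightarrow> 0) (at 0)"
      by (simp add: filterlim_split_at)
    then show ?thesis unfolding 3 DERIV_def by (simp add: bump_def)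
  qed
qed

lemma bump_bounds: "0 \<le> bump 0 y" "y \<le> 1 \<Longrightarrow> bump 0 y \<le> bump 0 1" "bump 0 1 > 0"
  unfolding bump_def by (auto simp: divide_simps)

text \<open>The squared norm keeps the function smooth at the origin, and the denominator gives it
  the value 1 there.\<close>

definition cutoff :: "'a::euclidean_space \<Rightarrow> real" where
  "cutoff x = bump 0 (1 - (norm x)\<^sup>2) / bump 0 1"

lemma cutoff_bounds: "0 \<le> cutoff x" "cutoff x \<le> 1" "cutoff 0 = 1"
  using bump_bounds(1)[of "1 - (norm x)\<^sup>2"] bump_bounds(2)[of "1 - (norm x)\<^sup>2"] bump_bounds(3)
  unfolding cutoff_def by (auto simp: divide_simps)

lemma cutoff_eq_0:
  assumes "norm x \<ge> 1"
  shows "cutoff x = 0"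
proof -
  have "1\<^sup>2 \<le> (norm x)\<^sup>2" by (rule power_mono) (use assms in auto)
  then have "\<not> 1 - (norm x)\<^sup>2 > 0" by simp
  then show ?thesis unfolding cutoff_def bump_def by (simp only: if_False div_0)
qed

lemma class_C_cutoff_scaled: "class_C n (\<lambda>x. cutoff (r *\<^sub>R x))"
proof -
  have "class_C n (\<lambda>x. bump 0 (1 + (- (r\<^sup>2)) * (norm x)\<^sup>2) * (1 / bump 0 1))"
    by (intro class_C_mult class_C_const class_C_compose[where G = bump and m = 0, OF bump_deriv] class_C_add class_C_norm_sq)
  then show ?thesis unfolding cutoff_def by (simp add: power_mult_distrib)
qed

lemma class_C_heat_sum: "class_C n (heat_sum m c a)"
proof -
  have "class_C n (\<lambda>x. \<Sum>i<m. c i * ((4 * pi * a i) powr (- (DIM('a) / 2)) * exp ((- (1 / (4 * a i))) * (norm (x::'a))\<^sup>2)))"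
    by (intro class_C_sum class_C_mult class_C_const class_C_norm_sq class_C_compose[of "\<lambda>m. exp"]) (rule DERIV_exp)
  then show ?thesis unfolding heat_sum_def heat_kernel_def by (simp add: field_simps)
qed

lemma Cc_infI:
  assumes "\<And>n. class_C n f" "\<And>x. norm x > R \<Longrightarrow> f x = 0"
  shows "f \<in> Cc_inf"
proof -
  have "{x. f x \<noteq> 0} \<subseteq> cball 0 R" using assms(2) by force
  then have "bounded {x. f x \<noteq> 0}" by (rule bounded_subset[OF bounded_cball])
  then show ?thesis using assms(1) unfolding Cc_inf_def by (simp add: compact_closure)
qed

lemma Cc_inf_continuous: "f \<in> Cc_inf \<Longrightarrow> continuous_on UNIV f"
  unfolding Cc_inf_def by (metis (mono_tags, lifting) class_C.simps(1) mem_Collect_eq)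

lemma Cc_inf_measurable: "f \<in> Cc_inf \<Longrightarrow> f \<in> borel_measurable borel"
  by (intro borel_measurable_continuous_onI Cc_inf_continuous)

lemma Cc_inf_diff: "f \<in> Cc_inf \<Longrightarrow> g \<in> Cc_inf \<Longrightarrow> (\<lambda>x. f x - g x) \<in> Cc_inf"
proof -
  assume f: "f \<in> Cc_inf" and g: "g \<in> Cc_inf"
  have "bounded (closure {x. f x \<noteq> 0})" "bounded (closure {x. g x \<noteq> 0})"
    using f g unfolding Cc_inf_def by (auto intro: compact_imp_bounded)
  then have "bounded ({x. f x \<noteq> 0} \<union> {x. g x \<noteq> 0})"
    by (metis bounded_Un bounded_subset closure_subset)
  then obtain R where R: "\<And>x. x \<in> {x. f x \<noteq> 0} \<union> {x. g x \<noteq> 0} \<Longrightarrow> norm x \<le> R"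
    unfolding bounded_iff by auto
  show ?thesis
  proof (rule Cc_infI)
    fix n
    have "class_C n (\<lambda>x. f x + (- 1) * g x)"
      using f g unfolding Cc_inf_def by (intro class_C_add class_C_mult class_C_const) auto
    then show "class_C n (\<lambda>x. f x - g x)" by simp
    show "f x - g x = 0" if "norm x > R" for x
    proof -
      have "x \<notin> {x. f x \<noteq> 0} \<union> {x. g x \<noteq> 0}" using R[of x] that by linarith
      then show ?thesis by simp
    qed
  qed
qed

lemma Cc_inf_support:
  assumes "f \<in> Cc_inf"
  obtains R where "\<And>x. norm x > R \<Longrightarrow> f x = 0"
proof -
  have "bounded (closure {x. f x \<noteq> 0})"
    using assms unfolding Cc_inf_def by (auto intro: compact_imp_bounded)
  then obtain R where "\<And>x. x \<in> closure {x. f x \<noteq> 0} \<Longrightarrow> norm x \<le> R" unfolding bounded_iff by auto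
  then show ?thesis using that[of R] closure_subset[of "{x. f x \<noteq> 0}"] by force
qed

lemma Cc_inf_bounded:
  assumes "f \<in> Cc_inf"
  obtains M where "M \<ge> 0" "\<And>x. \<bar>f x\<bar> \<le> M"
proof -
  let ?K = "closure {x. f x \<noteq> 0}"
  have "compact (f ` ?K)"
    using assms Cc_inf_continuous[OF assms] unfolding Cc_inf_def
    by (intro compact_continuous_image) (auto intro: continuous_on_subset)
  then have "bounded (f ` ?K)" by (rule compact_imp_bounded)
  then obtain M where M: "\<And>x. x \<in> ?K \<Longrightarrow> \<bar>f x\<bar> \<le> M"
    unfolding bounded_iff by auto
  have "\<bar>f x\<bar> \<le> max 0 M" for x
    using M[of x] closure_subset[of "{x. f x \<noteq> 0}"] by (cases "f x = 0") auto
  then show ?thesis using that[of "max 0 M"] by simp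
qed

text \<open>Outside the compact support the partial derivatives vanish, since \<open>f\<close> is
  zero on an open set there; on the support they are continuous, hence bounded. The sum of these
  bounds controls the operator norm of the derivative, and the mean value inequality on the whole
  space concludes.\<close>

lemma Cc_inf_lipschitz:
  fixes f :: "'a::euclidean_space \<Rightarrow> real"
  assumes "f \<in> Cc_inf"
  obtains L where "L \<ge> 0" "\<And>x y. \<bar>f x - f y\<bar> \<le> L * norm (x - y)"
proof -
  let ?K = "closure {x. f x \<noteq> 0}"
  have C: "class_C (Suc 0) f" "compact ?K" using assms unfolding Cc_inf_def by auto
  note D = class_C_SucD[OF C(1)]
  have out: "frechet_derivative f (at x) b = 0" if "x \<notin> ?K" for x b
  proof -
    have "((\<lambda>x. 0) has_derivative (\<lambda>h. 0)) (at x)" by simp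
    then have "(f has_derivative (\<lambda>h. 0)) (at x)"
      by (rule has_derivative_transform_within_open[of _ _ _ _ "- ?K"])
         (use that closure_subset[of "{x. f x \<noteq> 0}"] in auto)
    then have "frechet_derivative f (at x) = (\<lambda>h. 0)" by (metis frechet_derivative_at)
    then show ?thesis by simp
  qed
  have "\<exists>M. \<forall>x. \<bar>frechet_derivative f (at x) b\<bar> \<le> M" if b: "b \<in> Basis" for b
  proof -
    have "continuous_on UNIV (\<lambda>x. frechet_derivative f (at x) b)" using D(2)[OF b] by simp
    then have "compact ((\<lambda>x. frechet_derivative f (at x) b) ` ?K)"
      using C(2) by (intro compact_continuous_image) (auto intro: continuous_on_subset)
    then have "bounded ((\<lambda>x. frechet_derivative f (at x) b) ` ?K)" by (rule compact_imp_bounded)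
    then obtain M where M: "\<And>x. x \<in> ?K \<Longrightarrow> \<bar>frechet_derivative f (at x) b\<bar> \<le> M"
      unfolding bounded_iff by auto
    have "\<bar>frechet_derivative f (at x) b\<bar> \<le> max 0 M" for x
      using M[of x] out[of x b] by (cases "x \<in> ?K") auto
    then show ?thesis by blast
  qed
  then obtain M where M: "\<And>b x. b \<in> Basis \<Longrightarrow> \<bar>frechet_derivative f (at x) b\<bar> \<le> M b" by metis
  define L where "L = (\<Sum>b\<in>(Basis::'a set). M b)"
  have M0: "M b \<ge> 0" if "b \<in> Basis" for b using M[OF that, of 0] by linarith
  have L0: "L \<ge> 0" unfolding L_def using M0 by (rule sum_nonneg)
  have on: "onorm (frechet_derivative f (at x)) \<le> L" for x
  proof (rule onorm_le)
    fix v :: 'a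
    interpret linear "frechet_derivative f (at x)"
      using D(1)[of x] by (rule has_derivative_linear)
    have "frechet_derivative f (at x) v = frechet_derivative f (at x) (\<Sum>b\<in>Basis. (v \<bullet> b) *\<^sub>R b)"
      by (simp add: euclidean_representation)
    also have "\<dots> = (\<Sum>b\<in>Basis. (v \<bullet> b) * frechet_derivative f (at x) b)"
      by (simp add: sum scale)
    finally have "\<bar>frechet_derivative f (at x) v\<bar> \<le> (\<Sum>b\<in>Basis. \<bar>v \<bullet> b\<bar> * \<bar>frechet_derivative f (at x) b\<bar>)"
      by (metis (mono_tags, lifting) abs_mult sum.cong sum_abs)
    also have "\<dots> \<le> (\<Sum>b\<in>Basis. norm v * M b)"
      by (intro sum_mono mult_mono M Basis_le_norm) auto
    finally show "norm (frechet_derivative f (at x) v) \<le> L * norm v"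
      unfolding L_def by (simp add: sum_distrib_left mult.commute)
  qed
  have "\<bar>f x - f y\<bar> \<le> L * norm (x - y)" for x y
    using differentiable_bound[of UNIV f "\<lambda>x. frechet_derivative f (at x)" L x y] D(1) on by simp
  then show ?thesis using that L0 by blast
qed

section \<open>Finiteness of the energy on \<open>Cc_inf\<close>\<close>

text \<open>For bounded Lipschitz \<open>u\<close> the numerator of the energy is at most a multiple
  of \<open>min 1 ((norm (x - y))\<^sup>2)\<close>, by \<open>min_sq_le\<close>, so a multiple of
  this kernel dominates the energy density. The two cases of the minimum deal with infinity and with
  the diagonal.\<close>

definition lipschitz_kernel :: "real \<Rightarrow> 'a::euclidean_space \<Rightarrow> real" where
  "lipschitz_kernel s z = min 1 ((norm z)\<^sup>2) / norm z powr (real DIM('a) + 2 * s)"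

lemma lipschitz_kernel_measurable [measurable]: "lipschitz_kernel s \<in> borel_measurable borel"
  unfolding lipschitz_kernel_def by measurable

lemma lipschitz_kernel_nonneg: "lipschitz_kernel s z \<ge> 0"
  unfolding lipschitz_kernel_def by simp

lemma lipschitz_kernel_minus: "lipschitz_kernel s (x - y) = lipschitz_kernel s (y - x)"
  unfolding lipschitz_kernel_def by (simp add: norm_minus_commute)

text \<open>Half of the Gaussian exponent absorbs the square:
  \<open>y * exp (- (2 * y)) \<le> exp (- y)\<close> for
  \<open>y = (norm z)\<^sup>2 / (8 * t)\<close>, at the price of doubling the time. Integrated over
  \<open>z\<close>, this bounds the second moment of the heat kernel by a multiple of
  \<open>t\<close>.\<close>

lemma norm_sq_heat_kernel_le:
  assumes "t > 0"
  shows "(norm z)\<^sup>2 * heat_kernel t (z::'a::euclidean_space) \<le> 8 * 2 powr (real DIM('a) / 2) * t * heat_kernel (2 * t) z"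
proof -
  define y where "y = (norm z)\<^sup>2 / (8 * t)"
  have n: "(norm z)\<^sup>2 = 8 * t * y" using assms by (simp add: y_def)
  have "y \<le> exp y" using exp_ge_add_one_self[of y] by linarith
  then have "y * exp (- (2 * y)) \<le> exp y * exp (- (2 * y))" by (rule mult_right_mono) simp
  also have "\<dots> = exp (- y)" unfolding mult_exp_exp by simp
  finally have le: "y * exp (- (2 * y)) \<le> exp (- y)" .
  define p where "p = real DIM('a) / 2"
  define k where "k = (4 * pi * t) powr (- p)"
  have h1: "heat_kernel t z = k * exp (- (2 * y))"
    unfolding heat_kernel_def k_def p_def n using assms by simp
  have h2: "2 powr p * heat_kernel (2 * t) z = k * exp (- y)"
  proof -
    have "4 * pi * (2 * t) = 2 * (4 * pi * t)" by simp
    moreover have "- (norm z)\<^sup>2 / (4 * (2 * t)) = - y" unfolding n using assms by simp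
    ultimately have "heat_kernel (2 * t) z = 2 powr (- p) * k * exp (- y)"
      unfolding heat_kernel_def k_def p_def by (simp only: powr_mult)
    then show ?thesis by (simp add: powr_minus)
  qed
  have "(norm z)\<^sup>2 * heat_kernel t z = (8 * t * k) * (y * exp (- (2 * y)))"
    unfolding h1 n by simp
  also have "\<dots> \<le> (8 * t * k) * exp (- y)"
    using assms le by (intro mult_left_mono) (auto simp: k_def)
  also have "\<dots> = 8 * t * (2 powr p * heat_kernel (2 * t) z)" unfolding h2 by simp
  finally show ?thesis unfolding p_def by (simp add: mult_ac)
qed

text \<open>The kernel is again written as a superposition of heat kernels. For
  \<open>t \<ge> 1\<close> the minimum is bounded by 1 and the tail of
  \<open>t powr (- 1 - s)\<close> converges. For \<open>t < 1\<close> it is bounded by the square of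
  the norm, and the second moment supplies a factor \<open>t\<close>, leaving
  \<open>t powr (- s)\<close>, integrable at 0 since \<open>s < 1\<close>.\<close>

lemma nn_integral_lipschitz_kernel:
  assumes s: "0 < s" "s < 1"
  shows "(\<integral>\<^sup>+z. ennreal (lipschitz_kernel s (z::'a::euclidean_space)) \<partial>lborel) < \<infinity>"
proof -
  define c where "c = pi powr (- (real DIM('a) / 2)) * 4 powr s * Gamma (real DIM('a) / 2 + s)"
  have c0: "c > 0" unfolding c_def using s by (intro mult_pos_pos) (auto intro: Gamma_real_pos)
  define C where "C = 8 * 2 powr (real DIM('a) / 2)"
  have C0: "C \<ge> 0" unfolding C_def by simp
  have "ennreal c * (\<integral>\<^sup>+z. ennreal (lipschitz_kernel s (z::'a)) \<partial>lborel) = (\<integral>\<^sup>+z. ennreal c * ennreal (lipschitz_kernel s (z::'a)) \<partial>lborel)"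
    by (rule nn_integral_cmult[symmetric]) measurable
  also have "\<dots> = (\<integral>\<^sup>+z. (\<integral>\<^sup>+t. ennreal (t powr (- 1 - s)) * indicator {0<..} t * ennreal (min 1 ((norm (z::'a))\<^sup>2) * heat_kernel t z) \<partial>lborel) \<partial>lborel)"
  proof (rule nn_integral_cong_AE, use AE_lborel_singleton[of "0::'a"] in eventually_elim)
    case (elim z)
    have e: "(- s) - 1 = - 1 - s" "- (- s) = s" "real DIM('a) / 2 - - s = real DIM('a) / 2 + s" "2 * (- s) - real DIM('a) = - (real DIM('a) + 2 * s)"
      by simp_all
    have "- s < real DIM('a) / 2" using s by (auto intro: less_le_trans[of _ 0])
    from nn_integral_heat_kernel_time[OF this elim, unfolded e]
    have I: "(\<integral>\<^sup>+t\<in>{0<..}. ennreal (t powr (- 1 - s) * heat_kernel t z) \<partial>lborel) = ennreal (c * norm z powr (- (real DIM('a) + 2 * s)))"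
      unfolding c_def .
    have "ennreal c * ennreal (lipschitz_kernel s z) = ennreal (c * lipschitz_kernel s z)"
      using c0 by (intro ennreal_mult'[symmetric]) simp
    also have "c * lipschitz_kernel s z = min 1 ((norm z)\<^sup>2) * (c * norm z powr (- (real DIM('a) + 2 * s)))"
      unfolding lipschitz_kernel_def powr_minus_divide by simp
    also have "ennreal \<dots> = ennreal (min 1 ((norm z)\<^sup>2)) * (\<integral>\<^sup>+t\<in>{0<..}. ennreal (t powr (- 1 - s) * heat_kernel t z) \<partial>lborel)"
      unfolding I by (rule ennreal_mult') simp
    also have "\<dots> = (\<integral>\<^sup>+t. ennreal (min 1 ((norm z)\<^sup>2)) * (ennreal (t powr (- 1 - s) * heat_kernel t z) * indicator {0<..} t) \<partial>lborel)"
      by (rule nn_integral_cmult[symmetric]) measurable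
    also have "\<dots> = (\<integral>\<^sup>+t. ennreal (t powr (- 1 - s)) * indicator {0<..} t * ennreal (min 1 ((norm z)\<^sup>2) * heat_kernel t z) \<partial>lborel)"
      by (intro nn_integral_cong) (simp add: ennreal_mult' mult_ac)
    finally show ?case .
  qed
  also have "\<dots> = (\<integral>\<^sup>+t. (\<integral>\<^sup>+z. ennreal (t powr (- 1 - s)) * indicator {0<..} t * ennreal (min 1 ((norm (z::'a))\<^sup>2) * heat_kernel t z) \<partial>lborel) \<partial>lborel)"
    by (rule lborel_pair.Fubini') measurable
  \<comment> \<open>The factor \<open>(1 - t) powr (1 - 1)\<close> is 1 on the open interval; it
    gives the integrand the form that \<open>nn_integral_Beta_scaled\<close> evaluates.\<close>
  also have "\<dots> \<le> (\<integral>\<^sup>+t. ennreal (t powr (- 1 - s)) * indicator {1..} t + ennreal C * (ennreal (t powr ((1 - s) - 1) * (1 - t) powr (1 - 1)) * indicator {0<..<1} t) \<partial>lborel)"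
  proof (rule nn_integral_mono)
    fix t :: real
    let ?m = "\<integral>\<^sup>+z. ennreal (min 1 ((norm (z::'a))\<^sup>2) * heat_kernel t z) \<partial>lborel"
    have eq: "(\<integral>\<^sup>+z. ennreal (t powr (- 1 - s)) * indicator {0<..} t * ennreal (min 1 ((norm (z::'a))\<^sup>2) * heat_kernel t z) \<partial>lborel)
      = ennreal (t powr (- 1 - s)) * indicator {0<..} t * ?m"
      by (rule nn_integral_cmult) measurable
    consider "t \<le> 0" | "0 < t" "t < 1" | "t \<ge> 1" by linarith
    then show "(\<integral>\<^sup>+z. ennreal (t powr (- 1 - s)) * indicator {0<..} t * ennreal (min 1 ((norm (z::'a))\<^sup>2) * heat_kernel t z) \<partial>lborel)
      \<le> ennreal (t powr (- 1 - s)) * indicator {1..} t + ennreal C * (ennreal (t powr ((1 - s) - 1) * (1 - t) powr (1 - 1)) * indicator {0<..<1} t)"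
      unfolding eq
    proof cases
      case 2
      have "?m \<le> (\<integral>\<^sup>+z. ennreal (C * t) * ennreal (heat_kernel (2 * t) (z - 0 :: 'a)) \<partial>lborel)"
      proof (rule nn_integral_mono)
        fix z :: 'a
        have "min 1 ((norm z)\<^sup>2) * heat_kernel t z \<le> (norm z)\<^sup>2 * heat_kernel t z"
          by (intro mult_right_mono) auto
        also have "\<dots> \<le> C * t * heat_kernel (2 * t) z"
          unfolding C_def by (rule norm_sq_heat_kernel_le[OF 2(1)])
        finally show "ennreal (min 1 ((norm z)\<^sup>2) * heat_kernel t z) \<le> ennreal (C * t) * ennreal (heat_kernel (2 * t) (z - 0))"
          using C0 2 by (simp add: ennreal_mult'[symmetric] ennreal_leI)
      qed
      also have "\<dots> = ennreal (C * t) * (\<integral>\<^sup>+z. ennreal (heat_kernel (2 * t) (z - 0 :: 'a)) \<partial>lborel)"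
        by (rule nn_integral_cmult) measurable
      also have "\<dots> = ennreal (C * t)" using nn_integral_heat_kernel[of "2 * t" "0::'a"] 2 by simp
      finally have "ennreal (t powr (- 1 - s)) * ?m \<le> ennreal (t powr (- 1 - s)) * ennreal (C * t)"
        by (rule mult_left_mono) simp
      also have "\<dots> = ennreal (t powr (- 1 - s) * (C * t))" by (rule ennreal_mult'[symmetric]) simp
      also have "t powr (- 1 - s) * (C * t) = C * (t powr ((1 - s) - 1) * (1 - t) powr (1 - 1))"
      proof -
        have "t powr ((1 - s) - 1) = t powr ((- 1 - s) + 1)" by simp
        also have "\<dots> = t powr (- 1 - s) * t" using 2 by (simp only: powr_add) simp
        finally show ?thesis using 2 by simp
      qed
      also have "ennreal \<dots> = ennreal C * ennreal (t powr ((1 - s) - 1) * (1 - t) powr (1 - 1))"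
        by (rule ennreal_mult'[OF C0])
      finally show "ennreal (t powr (- 1 - s)) * indicator {0<..} t * ?m \<le> ennreal (t powr (- 1 - s)) * indicator {1..} t + ennreal C * (ennreal (t powr ((1 - s) - 1) * (1 - t) powr (1 - 1)) * indicator {0<..<1} t)"
        using 2 by simp
    next
      case 3
      have "?m \<le> (\<integral>\<^sup>+z. ennreal (heat_kernel t (z - 0 :: 'a)) \<partial>lborel)"
        by (intro nn_integral_mono ennreal_leI) (simp add: mult_left_le_one_le)
      also have "\<dots> = 1" by (rule nn_integral_heat_kernel) (use 3 in simp)
      finally have "ennreal (t powr (- 1 - s)) * ?m \<le> ennreal (t powr (- 1 - s)) * 1"
        by (rule mult_left_mono) simp
      then show "ennreal (t powr (- 1 - s)) * indicator {0<..} t * ?m \<le> ennreal (t powr (- 1 - s)) * indicator {1..} t + ennreal C * (ennreal (t powr ((1 - s) - 1) * (1 - t) powr (1 - 1)) * indicator {0<..<1} t)"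
        using 3 by simp
    qed simp
  qed
  also have "\<dots> = ennreal (1 powr (- s) / s) + ennreal C * ennreal (Beta (1 - s) 1 * 1 powr ((1 - s) + 1 - 1))"
  proof -
    have B: "(\<integral>\<^sup>+t\<in>{0<..<1}. ennreal (t powr ((1 - s) - 1) * (1 - t) powr (1 - 1)) \<partial>lborel) = ennreal (Beta (1 - s) 1 * 1 powr ((1 - s) + 1 - 1))"
      by (rule nn_integral_Beta_scaled) (use s in auto)
    let ?f = "\<lambda>t. ennreal (t powr (- 1 - s)) * indicator {1..} t"
    let ?g = "\<lambda>t. ennreal (t powr ((1 - s) - 1) * (1 - t) powr (1 - 1)) * indicator {0<..<1} t"
    have "(\<integral>\<^sup>+t. ?f t + ennreal C * ?g t \<partial>lborel) = (\<integral>\<^sup>+t. ?f t \<partial>lborel) + (\<integral>\<^sup>+t. ennreal C * ?g t \<partial>lborel)"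
      by (rule nn_integral_add) measurable
    also have "(\<integral>\<^sup>+t. ennreal C * ?g t \<partial>lborel) = ennreal C * (\<integral>\<^sup>+t. ?g t \<partial>lborel)"
      by (rule nn_integral_cmult) measurable
    finally show ?thesis
      unfolding B nn_integral_power_tail[OF s(1) zero_less_one] .
  qed
  also have "\<dots> < \<infinity>" by (simp add: ennreal_mult_less_top)
  finally have "ennreal c * (\<integral>\<^sup>+z. ennreal (lipschitz_kernel s (z::'a)) \<partial>lborel) < \<infinity>" .
  then show ?thesis using c0 by (auto simp: ennreal_mult_less_top)
qed

lemma nn_integral_lipschitz_kernel_mult:
  fixes v :: "'a::euclidean_space \<Rightarrow> ennreal"
  assumes [measurable]: "v \<in> borel_measurable borel"
  shows "(\<integral>\<^sup>+x. \<integral>\<^sup>+y. v x * ennreal (lipschitz_kernel s (x - y)) \<partial>lborel \<partial>lborel) = (\<integral>\<^sup>+x. v x \<partial>lborel) * (\<integral>\<^sup>+z. ennreal (lipschitz_kernel s (z::'a)) \<partial>lborel)"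
    and "(\<integral>\<^sup>+x. \<integral>\<^sup>+y. v y * ennreal (lipschitz_kernel s (x - y)) \<partial>lborel \<partial>lborel) = (\<integral>\<^sup>+x. v x \<partial>lborel) * (\<integral>\<^sup>+z. ennreal (lipschitz_kernel s (z::'a)) \<partial>lborel)"
proof -
  let ?\<kappa> = "\<integral>\<^sup>+z. ennreal (lipschitz_kernel s (z::'a)) \<partial>lborel"
  have 1: "(\<integral>\<^sup>+y. v x * ennreal (lipschitz_kernel s (x - y)) \<partial>lborel) = v x * ?\<kappa>" for x
  proof -
    have "(\<integral>\<^sup>+y. v x * ennreal (lipschitz_kernel s (x - y)) \<partial>lborel) = v x * (\<integral>\<^sup>+y. ennreal (lipschitz_kernel s (y + - x)) \<partial>lborel)"
    proof -
      have "lipschitz_kernel s (x - y) = lipschitz_kernel s (y + - x)" for y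
        using lipschitz_kernel_minus[of s x y] by simp
      then show ?thesis by (simp only:) (rule nn_integral_cmult, measurable)
    qed
    also have "(\<integral>\<^sup>+y. ennreal (lipschitz_kernel s (y + - x)) \<partial>lborel) = ?\<kappa>"
      by (rule nn_integral_lborel_translate) measurable
    finally show ?thesis .
  qed
  show A: "(\<integral>\<^sup>+x. \<integral>\<^sup>+y. v x * ennreal (lipschitz_kernel s (x - y)) \<partial>lborel \<partial>lborel) = (\<integral>\<^sup>+x. v x \<partial>lborel) * ?\<kappa>"
    unfolding 1 by (rule nn_integral_multc) measurable
  show "(\<integral>\<^sup>+x. \<integral>\<^sup>+y. v y * ennreal (lipschitz_kernel s (x - y)) \<partial>lborel \<partial>lborel) = (\<integral>\<^sup>+x. v x \<partial>lborel) * ?\<kappa>"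
    unfolding A[symmetric] by (subst lborel_pair.Fubini') (measurable, simp only: lipschitz_kernel_minus)
qed

lemma min_sq_le:
  fixes d r M L :: real
  assumes "\<bar>d\<bar> \<le> M" "\<bar>d\<bar> \<le> L * r" "L \<ge> 0" "r \<ge> 0"
  shows "d\<^sup>2 \<le> (M\<^sup>2 + L\<^sup>2) * min 1 (r\<^sup>2)"
proof -
  have 1: "d\<^sup>2 \<le> M\<^sup>2" using assms(1) abs_ge_zero[of d] power_mono[of "\<bar>d\<bar>" M 2] by simp
  have 2: "d\<^sup>2 \<le> L\<^sup>2 * r\<^sup>2" using assms(2) power_mono[of "\<bar>d\<bar>" "L * r" 2] by (simp add: power_mult_distrib)
  have "L\<^sup>2 * r\<^sup>2 \<le> (M\<^sup>2 + L\<^sup>2) * r\<^sup>2" by (intro mult_right_mono) auto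
  moreover have "M\<^sup>2 \<le> M\<^sup>2 + L\<^sup>2" by simp
  ultimately show ?thesis using 1 2 unfolding min_def by (auto intro: order_trans)
qed

lemma Cc_inf_L2:
  fixes f :: "'a::euclidean_space \<Rightarrow> real"
  assumes "f \<in> Cc_inf"
  shows "(\<integral>\<^sup>+x. ennreal ((f x)\<^sup>2) \<partial>lborel) < \<infinity>"
proof -
  obtain R where R: "\<And>x. norm x > R \<Longrightarrow> f x = 0" using Cc_inf_support[OF assms] by blast
  obtain M where M: "M \<ge> 0" "\<And>x. \<bar>f x\<bar> \<le> M" using Cc_inf_bounded[OF assms] by blast
  have "(\<integral>\<^sup>+x. ennreal ((f x)\<^sup>2) \<partial>lborel) \<le> (\<integral>\<^sup>+x. ennreal (M\<^sup>2) * indicator (cball (0::'a) R) x \<partial>lborel)"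
  proof (rule nn_integral_mono)
    fix x
    show "ennreal ((f x)\<^sup>2) \<le> ennreal (M\<^sup>2) * indicator (cball 0 R) x"
      using R[of x] power_mono[OF M(2)[of x], of 2] by (cases "norm x \<le> R") (auto intro!: ennreal_leI)
  qed
  also have "\<dots> = ennreal (M\<^sup>2) * emeasure lborel (cball (0::'a) R)"
    by (rule nn_integral_cmult_indicator) simp
  also have "\<dots> < \<infinity>"
    using emeasure_bounded_finite[of "cball (0::'a) R"] by (simp add: ennreal_mult_less_top)
  finally show ?thesis .
qed

text \<open>The difference \<open>f x - f y\<close> vanishes unless one of the two points lies in a
  ball containing the support. So the energy density is at most \<open>v x + v y\<close> times the
  \<open>lipschitz_kernel\<close>, with \<open>v\<close> a multiple of the indicator of that
  ball.\<close>

lemma Cc_inf_energy_finite: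
  fixes f :: "'a::euclidean_space \<Rightarrow> real"
  assumes f: "f \<in> Cc_inf" and s: "0 < s" "s < 1"
  shows "energy s f < \<infinity>"
proof -
  obtain R where R: "\<And>x. norm x > R \<Longrightarrow> f x = 0" using Cc_inf_support[OF f] by blast
  obtain M where M: "M \<ge> 0" "\<And>x. \<bar>f x\<bar> \<le> M" using Cc_inf_bounded[OF f] by blast
  obtain L where L: "L \<ge> 0" "\<And>x y. \<bar>f x - f y\<bar> \<le> L * norm (x - y)" using Cc_inf_lipschitz[OF f] by blast
  define v where "v x = ennreal ((2 * M)\<^sup>2 + L\<^sup>2) * indicator (cball 0 R) x" for x :: 'a
  have [measurable]: "v \<in> borel_measurable borel"
    unfolding v_def by (intro borel_measurable_times_ennreal borel_measurable_const borel_measurable_indicator) auto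
  let ?\<kappa> = "\<integral>\<^sup>+z. ennreal (lipschitz_kernel s (z::'a)) \<partial>lborel"
  have ptw: "ennreal ((f x - f y)\<^sup>2 / norm (x - y) powr (real DIM('a) + 2 * s)) \<le> v x * ennreal (lipschitz_kernel s (x - y)) + v y * ennreal (lipschitz_kernel s (x - y))" for x y
  proof (cases "norm x \<le> R \<or> norm y \<le> R")
    case True
    have "(f x - f y)\<^sup>2 \<le> ((2 * M)\<^sup>2 + L\<^sup>2) * min 1 ((norm (x - y))\<^sup>2)"
      using M(2)[of x] M(2)[of y] L by (intro min_sq_le) auto
    then have "(f x - f y)\<^sup>2 / norm (x - y) powr (real DIM('a) + 2 * s) \<le> ((2 * M)\<^sup>2 + L\<^sup>2) * lipschitz_kernel s (x - y)"
      unfolding lipschitz_kernel_def by (simp add: divide_right_mono)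
    then have le: "ennreal ((f x - f y)\<^sup>2 / norm (x - y) powr (real DIM('a) + 2 * s)) \<le> ennreal ((2 * M)\<^sup>2 + L\<^sup>2) * ennreal (lipschitz_kernel s (x - y))"
      by (subst ennreal_mult'[symmetric]) (simp, rule ennreal_leI)
    show ?thesis
    proof (cases "norm x \<le> R")
      case True
      then have vx: "v x = ennreal ((2 * M)\<^sup>2 + L\<^sup>2)" unfolding v_def by simp
      show ?thesis by (rule add_increasing2[OF zero_le]) (use le in \<open>simp only: vx\<close>)
    next
      case False
      then have vy: "v y = ennreal ((2 * M)\<^sup>2 + L\<^sup>2)" using True unfolding v_def by simp
      show ?thesis by (rule add_increasing[OF zero_le]) (use le in \<open>simp only: vy\<close>)
    qed
  next
    case False
    then have "f x = 0" "f y = 0" using R by auto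
    then show ?thesis by simp
  qed
  have fv: "(\<integral>\<^sup>+x. v x \<partial>lborel) < \<infinity>"
  proof -
    have "(\<integral>\<^sup>+x. v x \<partial>lborel) = ennreal ((2 * M)\<^sup>2 + L\<^sup>2) * emeasure lborel (cball (0::'a) R)"
      unfolding v_def by (rule nn_integral_cmult_indicator) simp
    then show ?thesis
      using emeasure_bounded_finite[of "cball (0::'a) R"] by (simp add: ennreal_mult_less_top)
  qed
  have "energy s f \<le> (\<integral>\<^sup>+x. \<integral>\<^sup>+y. v x * ennreal (lipschitz_kernel s (x - y)) + v y * ennreal (lipschitz_kernel s (x - y)) \<partial>lborel \<partial>lborel)"
    unfolding energy_def by (intro nn_integral_mono ptw)
  also have "\<dots> = (\<integral>\<^sup>+x. v x \<partial>lborel) * ?\<kappa> + (\<integral>\<^sup>+x. v x \<partial>lborel) * ?\<kappa>"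
  proof -
    have "(\<integral>\<^sup>+x. \<integral>\<^sup>+y. v x * ennreal (lipschitz_kernel s (x - y)) + v y * ennreal (lipschitz_kernel s (x - y)) \<partial>lborel \<partial>lborel)
      = (\<integral>\<^sup>+x. (\<integral>\<^sup>+y. v x * ennreal (lipschitz_kernel s (x - y)) \<partial>lborel) + (\<integral>\<^sup>+y. v y * ennreal (lipschitz_kernel s (x - y)) \<partial>lborel) \<partial>lborel)"
      by (intro nn_integral_cong nn_integral_add) measurable
    also have "\<dots> = (\<integral>\<^sup>+x. \<integral>\<^sup>+y. v x * ennreal (lipschitz_kernel s (x - y)) \<partial>lborel \<partial>lborel) + (\<integral>\<^sup>+x. \<integral>\<^sup>+y. v y * ennreal (lipschitz_kernel s (x - y)) \<partial>lborel \<partial>lborel)"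
      by (rule nn_integral_add) measurable
    finally show ?thesis
      unfolding nn_integral_lipschitz_kernel_mult[OF \<open>v \<in> borel_measurable borel\<close>] .
  qed
  also have "\<dots> < \<infinity>"
    using fv nn_integral_lipschitz_kernel[OF s, where 'a = 'a] by (simp add: ennreal_mult_less_top)
  finally show ?thesis .
qed

section \<open>Truncation of test functions\<close>

lemma energy_prod:
  fixes u :: "'a::euclidean_space \<Rightarrow> real"
  assumes [measurable]: "u \<in> borel_measurable borel"
  shows "energy s u = (\<integral>\<^sup>+p. ennreal ((u (fst p) - u (snd p))\<^sup>2 / norm (fst p - snd p) powr (real DIM('a) + 2 * s)) \<partial>(lborel \<Otimes>\<^sub>M lborel))"
  unfolding energy_def by (subst lborel.nn_integral_fst[symmetric]) simp_all

lemma sum_sq_le: "(a + b)\<^sup>2 \<le> 2 * a\<^sup>2 + 2 * (b::real)\<^sup>2"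
  using zero_le_power2[of "a - b"] by (simp add: power2_eq_square algebra_simps)

lemma cutoff_scaled_measurable [measurable]: "(\<lambda>x::'a::euclidean_space. cutoff (r *\<^sub>R x)) \<in> borel_measurable borel"
  using class_C_cutoff_scaled[of 0 r] by (intro borel_measurable_continuous_onI) simp

lemma cutoff_scaled_tendsto: "(\<lambda>n. cutoff ((1 / real (Suc n)) *\<^sub>R (x::'a::euclidean_space))) \<longlonglongrightarrow> 1"
proof -
  have c: "isCont (cutoff :: 'a \<Rightarrow> real) 0"
    using class_C_cutoff_scaled[of 0 1, where 'a = 'a] by (simp add: continuous_on_eq_continuous_at)
  have "(\<lambda>n. (1 / real (Suc n)) *\<^sub>R x) \<longlonglongrightarrow> 0 *\<^sub>R x"
    by (intro tendsto_scaleR tendsto_const) (use LIMSEQ_inverse_real_of_nat in \<open>simp add: inverse_eq_divide\<close>)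
  then have "(\<lambda>n. (1 / real (Suc n)) *\<^sub>R x) \<longlonglongrightarrow> 0" by simp
  from isCont_tendsto_compose[OF c this] show ?thesis unfolding cutoff_bounds(3) .
qed

text \<open>Dominated convergence. The difference
  \<open>\<theta> n x * u x - \<theta> n y * u y\<close> is split into
  \<open>\<theta> n x * (u x - u y)\<close> and \<open>u y * (\<theta> n x - \<theta> n y)\<close>.
  Up to constants, the first part is dominated by the energy density of \<open>u\<close> and the
  second by \<open>(u y)\<^sup>2\<close> times the \<open>lipschitz_kernel\<close>, uniformly in
  \<open>n\<close> because stretching the cutoff to larger balls does not increase its Lipschitz
  constant.\<close>

lemma cutoff_energy_tendsto:
  fixes u :: "'a::euclidean_space \<Rightarrow> real"
  assumes s: "0 < s" "s < 1" and [measurable]: "u \<in> borel_measurable borel"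
    and L2: "(\<integral>\<^sup>+x. ennreal ((u x)\<^sup>2) \<partial>lborel) < \<infinity>" and E: "energy s u < \<infinity>"
  shows "(\<lambda>n. energy s (\<lambda>x. cutoff ((1 / real (Suc n)) *\<^sub>R x) * u x)) \<longlonglongrightarrow> energy s u"
proof -
  define \<theta> where "\<theta> n x = cutoff ((1 / real (Suc n)) *\<^sub>R (x::'a))" for n x
  have [measurable]: "\<theta> n \<in> borel_measurable borel" for n unfolding \<theta>_def by measurable
  have \<theta>b: "0 \<le> \<theta> n x" "\<theta> n x \<le> 1" for n x unfolding \<theta>_def by (simp_all add: cutoff_bounds)
  have \<theta>lim: "(\<lambda>n. \<theta> n x) \<longlonglongrightarrow> 1" for x unfolding \<theta>_def by (rule cutoff_scaled_tendsto)
  have "(cutoff :: 'a \<Rightarrow> real) \<in> Cc_inf"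
    using class_C_cutoff_scaled[of _ 1, where 'a = 'a] by (intro Cc_infI[of _ 1] cutoff_eq_0) auto
  then obtain L where L: "L \<ge> 0" "\<And>x y::'a. \<bar>cutoff x - cutoff y\<bar> \<le> L * norm (x - y)" using Cc_inf_lipschitz by blast
  have \<theta>L: "\<bar>\<theta> n x - \<theta> n y\<bar> \<le> L * norm (x - y)" for n x y
  proof -
    have "\<bar>\<theta> n x - \<theta> n y\<bar> \<le> L * norm ((1 / real (Suc n)) *\<^sub>R x - (1 / real (Suc n)) *\<^sub>R y)" unfolding \<theta>_def by (rule L(2))
    also have "\<dots> = L * ((1 / real (Suc n)) * norm (x - y))"
      unfolding scaleR_diff_right[symmetric] norm_scaleR by simp
    also have "\<dots> \<le> L * (1 * norm (x - y))"
      by (intro mult_left_mono mult_right_mono L) auto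
    finally show ?thesis by simp
  qed
  define q where "q p = norm (fst p - snd p :: 'a) powr (real DIM('a) + 2 * s)" for p :: "'a \<times> 'a"
  have [measurable]: "q \<in> borel_measurable (lborel \<Otimes>\<^sub>M lborel)" unfolding q_def by measurable
  have q0: "q p \<ge> 0" for p unfolding q_def by simp
  define w where "w p = 2 * ennreal ((u (fst p) - u (snd p))\<^sup>2 / q p) + ennreal (2 * (1 + L\<^sup>2) * (u (snd p))\<^sup>2) * ennreal (lipschitz_kernel s (fst p - snd p))" for p :: "'a \<times> 'a"
  have ptw: "ennreal ((\<theta> n (fst p) * u (fst p) - \<theta> n (snd p) * u (snd p))\<^sup>2 / q p) \<le> w p" for n p
  proof -
    obtain x y where p: "p = (x, y)" by (cases p)
    have "\<theta> n x * u x - \<theta> n y * u y = \<theta> n x * (u x - u y) + u y * (\<theta> n x - \<theta> n y)" by (simp add: algebra_simps)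
    then have "(\<theta> n x * u x - \<theta> n y * u y)\<^sup>2 \<le> 2 * (\<theta> n x * (u x - u y))\<^sup>2 + 2 * (u y * (\<theta> n x - \<theta> n y))\<^sup>2"
      using sum_sq_le by simp
    also have "\<dots> = 2 * ((\<theta> n x)\<^sup>2 * (u x - u y)\<^sup>2) + 2 * (u y)\<^sup>2 * (\<theta> n x - \<theta> n y)\<^sup>2"
      by (simp add: power_mult_distrib)
    also have "\<dots> \<le> 2 * (1 * (u x - u y)\<^sup>2) + 2 * (u y)\<^sup>2 * ((1\<^sup>2 + L\<^sup>2) * min 1 ((norm (x - y))\<^sup>2))"
    proof (intro add_mono mult_left_mono mult_right_mono)
      show "(\<theta> n x)\<^sup>2 \<le> 1" using \<theta>b[of n x] by (simp add: power_le_one)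
      show "(\<theta> n x - \<theta> n y)\<^sup>2 \<le> (1\<^sup>2 + L\<^sup>2) * min 1 ((norm (x - y))\<^sup>2)"
        using \<theta>b[of n x] \<theta>b[of n y] \<theta>L L by (intro min_sq_le) auto
    qed auto
    finally have "(\<theta> n x * u x - \<theta> n y * u y)\<^sup>2 / q p \<le> (2 * (u x - u y)\<^sup>2 + 2 * (u y)\<^sup>2 * ((1 + L\<^sup>2) * min 1 ((norm (x - y))\<^sup>2))) / q p"
      using q0 by (intro divide_right_mono) simp_all
    also have "\<dots> = 2 * ((u x - u y)\<^sup>2 / q p) + 2 * (1 + L\<^sup>2) * (u y)\<^sup>2 * lipschitz_kernel s (x - y)"
      unfolding lipschitz_kernel_def q_def p by (simp add: add_divide_distrib)
    finally have "ennreal ((\<theta> n x * u x - \<theta> n y * u y)\<^sup>2 / q p) \<le> ennreal (2 * ((u x - u y)\<^sup>2 / q p) + 2 * (1 + L\<^sup>2) * (u y)\<^sup>2 * lipschitz_kernel s (x - y))"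
      by (rule ennreal_leI)
    also have "\<dots> = ennreal (2 * ((u x - u y)\<^sup>2 / q p)) + ennreal (2 * (1 + L\<^sup>2) * (u y)\<^sup>2 * lipschitz_kernel s (x - y))"
      using q0 lipschitz_kernel_nonneg[of s "x - y"] by (intro ennreal_plus) (auto intro!: mult_nonneg_nonneg)
    also have "\<dots> = w p"
      unfolding w_def p fst_conv snd_conv using q0[of p, unfolded p] lipschitz_kernel_nonneg[of s "x - y"]
      by (subst ennreal_mult'[of 2], simp, subst ennreal_mult''[of "lipschitz_kernel s (x - y)"], simp, simp)
    finally show ?thesis unfolding p fst_conv snd_conv .
  qed
  have wfin: "(\<integral>\<^sup>+p. w p \<partial>(lborel \<Otimes>\<^sub>M lborel)) < \<infinity>"
  proof -
    have "(\<integral>\<^sup>+p. w p \<partial>(lborel \<Otimes>\<^sub>M lborel)) = 2 * energy s u + (\<integral>\<^sup>+p. ennreal (2 * (1 + L\<^sup>2) * (u (snd p))\<^sup>2) * ennreal (lipschitz_kernel s (fst p - snd p)) \<partial>(lborel \<Otimes>\<^sub>M lborel))"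
      unfolding w_def energy_prod[OF assms(3)] q_def by (simp add: nn_integral_add nn_integral_cmult)
    also have "(\<integral>\<^sup>+p. ennreal (2 * (1 + L\<^sup>2) * (u (snd p))\<^sup>2) * ennreal (lipschitz_kernel s (fst p - snd p)) \<partial>(lborel \<Otimes>\<^sub>M lborel))
      = (\<integral>\<^sup>+x. \<integral>\<^sup>+y. ennreal (2 * (1 + L\<^sup>2) * (u y)\<^sup>2) * ennreal (lipschitz_kernel s (x - y)) \<partial>lborel \<partial>lborel)"
      by (subst lborel.nn_integral_fst[symmetric]) simp_all
    also have "\<dots> = (\<integral>\<^sup>+x. ennreal (2 * (1 + L\<^sup>2) * (u x)\<^sup>2) \<partial>lborel) * (\<integral>\<^sup>+z. ennreal (lipschitz_kernel s (z::'a)) \<partial>lborel)"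
      by (rule nn_integral_lipschitz_kernel_mult(2)[of "\<lambda>y. ennreal (2 * (1 + L\<^sup>2) * (u y)\<^sup>2)"]) measurable
    also have "(\<integral>\<^sup>+x. ennreal (2 * (1 + L\<^sup>2) * (u x)\<^sup>2) \<partial>lborel) = ennreal (2 * (1 + L\<^sup>2)) * (\<integral>\<^sup>+x. ennreal ((u x)\<^sup>2) \<partial>lborel)"
      by (subst nn_integral_cmult[symmetric]) (measurable, intro nn_integral_cong ennreal_mult'', simp)
    finally show ?thesis
      using E L2 nn_integral_lipschitz_kernel[OF s, where 'a = 'a] by (simp add: ennreal_mult_less_top)
  qed
  have "(\<lambda>n. \<integral>\<^sup>+p. ennreal ((\<theta> n (fst p) * u (fst p) - \<theta> n (snd p) * u (snd p))\<^sup>2 / q p) \<partial>(lborel \<Otimes>\<^sub>M lborel))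
    \<longlonglongrightarrow> (\<integral>\<^sup>+p. ennreal ((u (fst p) - u (snd p))\<^sup>2 / q p) \<partial>(lborel \<Otimes>\<^sub>M lborel))"
  proof (rule nn_integral_dominated_convergence[where w = w])
    show "AE p in lborel \<Otimes>\<^sub>M lborel. (\<lambda>n. ennreal ((\<theta> n (fst p) * u (fst p) - \<theta> n (snd p) * u (snd p))\<^sup>2 / q p)) \<longlonglongrightarrow> ennreal ((u (fst p) - u (snd p))\<^sup>2 / q p)"
    proof (rule AE_I2)
      fix p :: "'a \<times> 'a"
      have "(\<lambda>n. ennreal ((\<theta> n (fst p) * u (fst p) - \<theta> n (snd p) * u (snd p))\<^sup>2 * (1 / q p))) \<longlonglongrightarrow> ennreal ((1 * u (fst p) - 1 * u (snd p))\<^sup>2 * (1 / q p))"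
        by (intro tendsto_ennrealI tendsto_mult tendsto_power tendsto_diff tendsto_const \<theta>lim)
      then show "(\<lambda>n. ennreal ((\<theta> n (fst p) * u (fst p) - \<theta> n (snd p) * u (snd p))\<^sup>2 / q p)) \<longlonglongrightarrow> ennreal ((u (fst p) - u (snd p))\<^sup>2 / q p)"
        by simp
    qed
    show "w \<in> borel_measurable (lborel \<Otimes>\<^sub>M lborel)" unfolding w_def by measurable
  qed (use ptw wfin in \<open>auto simp: q_def\<close>)
  moreover have "energy s (\<lambda>x. \<theta> n x * u x) = (\<integral>\<^sup>+p. ennreal ((\<theta> n (fst p) * u (fst p) - \<theta> n (snd p) * u (snd p))\<^sup>2 / q p) \<partial>(lborel \<Otimes>\<^sub>M lborel))" for n
    unfolding q_def by (rule energy_prod) measurable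
  ultimately have "(\<lambda>n. energy s (\<lambda>x. \<theta> n x * u x)) \<longlonglongrightarrow> energy s u"
    unfolding energy_prod[OF assms(3)] q_def by simp
  then show ?thesis unfolding \<theta>_def .
qed

lemma cutoff_hardy_tendsto:
  fixes u :: "'a::euclidean_space \<Rightarrow> real"
  assumes [measurable]: "u \<in> borel_measurable borel" and fin: "(\<integral>\<^sup>+x. ennreal ((u x)\<^sup>2 / norm x powr (2 * s)) \<partial>lborel) < \<infinity>"
  shows "(\<lambda>n. \<integral>\<^sup>+x. ennreal ((cutoff ((1 / real (Suc n)) *\<^sub>R x) * u x)\<^sup>2 / norm x powr (2 * s)) \<partial>lborel)
    \<longlonglongrightarrow> (\<integral>\<^sup>+x. ennreal ((u x)\<^sup>2 / norm x powr (2 * s)) \<partial>lborel)"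
proof (rule nn_integral_dominated_convergence[where w = "\<lambda>x. ennreal ((u x)\<^sup>2 / norm x powr (2 * s))"])
  show "(\<lambda>x. ennreal ((cutoff ((1 / real (Suc n)) *\<^sub>R x) * u x)\<^sup>2 / norm x powr (2 * s))) \<in> borel_measurable lborel" for n
    by measurable
  show "AE x in lborel. ennreal ((cutoff ((1 / real (Suc n)) *\<^sub>R x) * u x)\<^sup>2 / norm x powr (2 * s)) \<le> ennreal ((u x)\<^sup>2 / norm x powr (2 * s))" for n
  proof (rule AE_I2)
    fix x :: 'a
    have "(cutoff ((1 / real (Suc n)) *\<^sub>R x))\<^sup>2 * (u x)\<^sup>2 \<le> 1 * (u x)\<^sup>2"
      by (intro mult_right_mono power_le_one cutoff_bounds) simp
    then show "ennreal ((cutoff ((1 / real (Suc n)) *\<^sub>R x) * u x)\<^sup>2 / norm x powr (2 * s)) \<le> ennreal ((u x)\<^sup>2 / norm x powr (2 * s))"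
      by (intro ennreal_leI divide_right_mono) (simp_all add: power_mult_distrib)
  qed
  show "AE x in lborel. (\<lambda>n. ennreal ((cutoff ((1 / real (Suc n)) *\<^sub>R x) * u x)\<^sup>2 / norm x powr (2 * s))) \<longlonglongrightarrow> ennreal ((u x)\<^sup>2 / norm x powr (2 * s))"
  proof (rule AE_I2)
    fix x :: 'a
    have "(\<lambda>n. ennreal ((cutoff ((1 / real (Suc n)) *\<^sub>R x) * u x)\<^sup>2 * (1 / norm x powr (2 * s)))) \<longlonglongrightarrow> ennreal ((1 * u x)\<^sup>2 * (1 / norm x powr (2 * s)))"
      by (intro tendsto_ennrealI tendsto_mult tendsto_power tendsto_const cutoff_scaled_tendsto)
    then show "(\<lambda>n. ennreal ((cutoff ((1 / real (Suc n)) *\<^sub>R x) * u x)\<^sup>2 / norm x powr (2 * s))) \<longlonglongrightarrow> ennreal ((u x)\<^sup>2 / norm x powr (2 * s))"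
      by simp
  qed
qed (use fin in auto)

lemma C_Ns_pos:
  assumes "0 < s" "s < 1"
  shows "C_Ns N s > 0"
proof -
  have "Gamma ((real N + 2 * s) / 2) > 0" "Gamma (2 - s) > 0"
    using assms by (auto intro!: Gamma_real_pos divide_pos_pos add_nonneg_pos)
  then show ?thesis unfolding C_Ns_def using assms by (intro mult_pos_pos divide_pos_pos) auto
qed

text \<open>Energy and Hardy integral of the truncated Gaussian sums converge to those of the full
  sum. The inequality is strict, so a number \<open>d\<close> between the two sides still separates
  them far enough along the sequence.\<close>

theorem hardy_constant_optimal_Cc_inf:
  assumes s: "0 < s" "s < 1" "2 * s < real DIM('a)" and L: "gamma_H DIM('a) s < L"
  obtains u where "(u :: 'a::euclidean_space \<Rightarrow> real) \<in> Cc_inf"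
    "ennreal (C_Ns DIM('a) s / 2) * energy s u < ennreal L * (\<integral>\<^sup>+x. ennreal ((u x)\<^sup>2 / norm x powr (2 * s)) \<partial>lborel)"
proof -
  obtain n c a where nca: "\<And>i. i < n \<Longrightarrow> c i > 0" "\<And>i. i < n \<Longrightarrow> a i > (0::real)"
    and lt: "ennreal (C_Ns DIM('a) s / 2) * energy s (heat_sum n c a :: 'a \<Rightarrow> real)
      < ennreal L * (\<integral>\<^sup>+x. ennreal ((heat_sum n c a (x::'a))\<^sup>2 / norm x powr (2 * s)) \<partial>lborel)"
    using hardy_constant_optimal[OF s L] by blast
  define u where "u = (heat_sum n c a :: 'a \<Rightarrow> real)"
  have [measurable]: "u \<in> borel_measurable borel" unfolding u_def by measurable
  have C: "C_Ns DIM('a) s / 2 > 0" using C_Ns_pos[OF s(1,2)] by simp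
  have fin: "(\<integral>\<^sup>+x. ennreal ((u x)\<^sup>2) \<partial>lborel) < \<infinity>"
  proof -
    have "(\<integral>\<^sup>+x. ennreal ((u x)\<^sup>2) \<partial>lborel) = ennreal (\<Sum>i<n. \<Sum>j<n. c i * c j * heat_kernel (a i + a j) (0::'a))"
      unfolding u_def by (rule nn_integral_heat_sum_square) (use nca in auto)
    then show ?thesis by simp
  qed
  have finH: "(\<integral>\<^sup>+x. ennreal ((u x)\<^sup>2 / norm x powr (2 * s)) \<partial>lborel) < \<infinity>"
    unfolding u_def using nn_integral_heat_sum_hardy[of s n c a, where 'a = 'a] nca s by simp
  have finE: "energy s u < \<infinity>"
  proof -
    have "ennreal (C_Ns DIM('a) s / 2) * energy s u < \<infinity>"
      unfolding u_def using energy_heat_sum[of s n c a, where 'a = 'a] nca s by simp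
    then show ?thesis using C by (auto simp: ennreal_mult_less_top)
  qed
  define v where "v m x = cutoff ((1 / real (Suc m)) *\<^sub>R x) * u x" for m x
  have vC: "v m \<in> Cc_inf" for m
  proof (rule Cc_infI[of _ "real (Suc m)"])
    show "class_C k (v m)" for k
      unfolding v_def u_def by (intro class_C_mult class_C_cutoff_scaled class_C_heat_sum)
    show "v m x = 0" if "norm x > real (Suc m)" for x
    proof -
      have "norm ((1 / real (Suc m)) *\<^sub>R x) \<ge> 1" using that by simp
      then show ?thesis unfolding v_def by (simp only: cutoff_eq_0 mult_zero_left)
    qed
  qed
  have E: "(\<lambda>m. ennreal (C_Ns DIM('a) s / 2) * energy s (v m)) \<longlonglongrightarrow> ennreal (C_Ns DIM('a) s / 2) * energy s u"
    unfolding v_def by (rule ennreal_tendsto_cmult[OF _ cutoff_energy_tendsto[OF s(1,2) _ fin finE]]) auto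
  have H: "(\<lambda>m. ennreal L * (\<integral>\<^sup>+x. ennreal ((v m x)\<^sup>2 / norm x powr (2 * s)) \<partial>lborel)) \<longlonglongrightarrow> ennreal L * (\<integral>\<^sup>+x. ennreal ((u x)\<^sup>2 / norm x powr (2 * s)) \<partial>lborel)"
    unfolding v_def by (rule ennreal_tendsto_cmult[OF _ cutoff_hardy_tendsto[OF _ finH]]) auto
  obtain d where d: "ennreal (C_Ns DIM('a) s / 2) * energy s u < d" "d < ennreal L * (\<integral>\<^sup>+x. ennreal ((u x)\<^sup>2 / norm x powr (2 * s)) \<partial>lborel)"
    using dense[OF lt] unfolding u_def by blast
  have "\<forall>\<^sub>F m in sequentially. ennreal (C_Ns DIM('a) s / 2) * energy s (v m) < d \<and> d < ennreal L * (\<integral>\<^sup>+x. ennreal ((v m x)\<^sup>2 / norm x powr (2 * s)) \<partial>lborel)"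
    by (intro eventually_conj order_tendstoD(2)[OF E d(1)] order_tendstoD(1)[OF H d(2)])
  then obtain m where "ennreal (C_Ns DIM('a) s / 2) * energy s (v m) < d" "d < ennreal L * (\<integral>\<^sup>+x. ennreal ((v m x)\<^sup>2 / norm x powr (2 * s)) \<partial>lborel)"
    using eventually_happens'[OF sequentially_bot] by blast
  then show ?thesis using that[OF vC, of m] by (meson less_trans)
qed

section \<open>Positive definiteness\<close>

lemma gamma_H_pos:
  assumes "0 < s" "2 * s < real N"
  shows "gamma_H N s > 0"
proof -
  have "Gamma ((real N + 2 * s) / 4) > 0" "Gamma ((real N - 2 * s) / 4) > 0"
    using assms by (auto intro!: Gamma_real_pos)
  then show ?thesis unfolding gamma_H_def by (intro mult_pos_pos divide_pos_pos zero_less_power) auto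
qed

text \<open>An infinite energy gives 0 on both sides, by the default values of the Bochner integral
  and of \<open>enn2real\<close>. A bound on the norm therefore bounds the energy only once the
  latter is known to be finite.\<close>

lemma Ds2_norm_sq:
  fixes u :: "'a::euclidean_space \<Rightarrow> real"
  assumes [measurable]: "u \<in> borel_measurable borel" and s: "0 < s" "s < 1"
  shows "(Ds2_norm s u)\<^sup>2 = C_Ns DIM('a) s / 2 * enn2real (energy s u)"
proof -
  have "(LINT p|(lborel \<Otimes>\<^sub>M lborel). \<bar>u (fst p) - u (snd p)\<bar>\<^sup>2 / norm (fst p - snd p) powr (real DIM('a) + 2 * s)) = enn2real (energy s u)"
    unfolding energy_prod[OF assms(1)] by (subst integral_eq_nn_integral) auto
  then show ?thesis
    unfolding Ds2_norm_def using C_Ns_pos[OF s, of "DIM('a)"] by (simp add: enn2real_nonneg)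
qed

definition hardy_term :: "real \<Rightarrow> ('a::euclidean_space \<Rightarrow> real) \<Rightarrow> 'a \<Rightarrow> ennreal" where
  "hardy_term s u a = (\<integral>\<^sup>+x. ennreal ((u x)\<^sup>2 / norm (x - a) powr (2 * s)) \<partial>lborel)"

lemma LINT_hardy_term:
  assumes [measurable]: "u \<in> borel_measurable borel"
  shows "(LINT x|lborel. \<bar>u x\<bar>\<^sup>2 / norm (x - a) powr (2 * s)) = enn2real (hardy_term s u a)"
  unfolding hardy_term_def by (subst integral_eq_nn_integral) auto

lemma energy_translate:
  fixes u :: "'a::euclidean_space \<Rightarrow> real"
  assumes [measurable]: "u \<in> borel_measurable borel"
  shows "energy s (\<lambda>x. u (x + a)) = energy s u"
proof -
  let ?e = "\<lambda>x y. ennreal ((u x - u y)\<^sup>2 / norm (x - y) powr (real DIM('a) + 2 * s))"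
  have "energy s (\<lambda>x. u (x + a)) = (\<integral>\<^sup>+x. \<integral>\<^sup>+y. ?e (x + a) (y + a) \<partial>lborel \<partial>lborel)"
    unfolding energy_def by (simp only: add_diff_cancel_right)
  also have "\<dots> = (\<integral>\<^sup>+x. \<integral>\<^sup>+y. ?e (x + a) y \<partial>lborel \<partial>lborel)"
    by (intro nn_integral_cong nn_integral_lborel_translate) measurable
  also have "\<dots> = (\<integral>\<^sup>+x. \<integral>\<^sup>+y. ?e x y \<partial>lborel \<partial>lborel)"
    by (rule nn_integral_lborel_translate[where f = "\<lambda>x. \<integral>\<^sup>+y. ?e x y \<partial>lborel"]) measurable
  finally show ?thesis unfolding energy_def .
qed

lemma hardy_inequality_L2_pole:
  fixes u :: "'a::euclidean_space \<Rightarrow> real"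
  assumes [measurable]: "u \<in> borel_measurable borel" and L2: "(\<integral>\<^sup>+x. ennreal ((u x)\<^sup>2) \<partial>lborel) < \<infinity>"
    and s: "0 < s" "s < 1" "2 * s < real DIM('a)"
  shows "ennreal (gamma_H DIM('a) s) * hardy_term s u a \<le> ennreal (C_Ns DIM('a) s / 2) * energy s u"
proof -
  have "(\<integral>\<^sup>+x. ennreal ((u (x + a))\<^sup>2) \<partial>lborel) = (\<integral>\<^sup>+x. ennreal ((u x)\<^sup>2) \<partial>lborel)"
    by (rule nn_integral_lborel_translate[where f = "\<lambda>x. ennreal ((u x)\<^sup>2)"]) measurable
  moreover have "(\<integral>\<^sup>+x. ennreal ((u (x + a))\<^sup>2 / norm (x + a - a) powr (2 * s)) \<partial>lborel) = hardy_term s u a"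
    unfolding hardy_term_def
    by (rule nn_integral_lborel_translate[where f = "\<lambda>x. ennreal ((u x)\<^sup>2 / norm (x - a) powr (2 * s))"]) measurable
  ultimately show ?thesis
    using hardy_inequality_L2[of "\<lambda>x. u (x + a)" s] s L2 by (simp add: energy_translate)
qed

text \<open>Fatou's lemma is applied once in each variable. The limit exists for almost every
  \<open>x\<close> and for almost every \<open>y\<close> separately, so exceptional sets are handled
  one variable at a time.\<close>

lemma energy_Fatou:
  fixes u :: "'a::euclidean_space \<Rightarrow> real"
  assumes [measurable]: "\<And>n. f n \<in> borel_measurable borel" and lim: "AE x in lborel. (\<lambda>n. f n x) \<longlonglongrightarrow> u x"
  shows "energy s u \<le> liminf (\<lambda>n. energy s (f n))"
proof -
  let ?e = "\<lambda>u x y. ennreal ((u x - u y)\<^sup>2 / norm (x - y :: 'a) powr (real DIM('a) + 2 * s))"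
  have "energy s u \<le> (\<integral>\<^sup>+x. \<integral>\<^sup>+y. liminf (\<lambda>n. ?e (f n) x y) \<partial>lborel \<partial>lborel)"
    unfolding energy_def
  proof (rule nn_integral_mono_AE, use lim in eventually_elim)
    case (elim x)
    note x = elim
    show ?case
    proof (rule nn_integral_mono_AE, use lim in eventually_elim)
      case (elim y)
      have "(\<lambda>n. ennreal ((f n x - f n y)\<^sup>2 * (1 / norm (x - y) powr (real DIM('a) + 2 * s)))) \<longlonglongrightarrow> ennreal ((u x - u y)\<^sup>2 * (1 / norm (x - y) powr (real DIM('a) + 2 * s)))"
        by (intro tendsto_ennrealI tendsto_mult tendsto_power tendsto_diff tendsto_const elim x)
      then have "(\<lambda>n. ?e (f n) x y) \<longlonglongrightarrow> ?e u x y" by simp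
      then show ?case by (simp only: lim_imp_Liminf[OF trivial_limit_sequentially] order.refl)
    qed
  qed
  also have "\<dots> \<le> (\<integral>\<^sup>+x. liminf (\<lambda>n. \<integral>\<^sup>+y. ?e (f n) x y \<partial>lborel) \<partial>lborel)"
    by (intro nn_integral_mono nn_integral_liminf) measurable
  also have "\<dots> \<le> liminf (\<lambda>n. \<integral>\<^sup>+x. \<integral>\<^sup>+y. ?e (f n) x y \<partial>lborel \<partial>lborel)"
    by (rule nn_integral_liminf) measurable
  finally show ?thesis unfolding energy_def .
qed

lemma hardy_term_Fatou:
  fixes u :: "'a::euclidean_space \<Rightarrow> real"
  assumes [measurable]: "\<And>n. f n \<in> borel_measurable borel" and lim: "AE x in lborel. (\<lambda>n. f n x) \<longlonglongrightarrow> u x"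
  shows "hardy_term s u a \<le> liminf (\<lambda>n. hardy_term s (f n) a)"
proof -
  let ?e = "\<lambda>u x. ennreal ((u x)\<^sup>2 / norm (x - a) powr (2 * s))"
  have "hardy_term s u a \<le> (\<integral>\<^sup>+x. liminf (\<lambda>n. ?e (f n) x) \<partial>lborel)"
    unfolding hardy_term_def
  proof (rule nn_integral_mono_AE, use lim in eventually_elim)
    case (elim x)
    have "(\<lambda>n. ennreal ((f n x)\<^sup>2 * (1 / norm (x - a) powr (2 * s)))) \<longlonglongrightarrow> ennreal ((u x)\<^sup>2 * (1 / norm (x - a) powr (2 * s)))"
      by (intro tendsto_ennrealI tendsto_mult tendsto_power tendsto_const elim)
    then have "(\<lambda>n. ?e (f n) x) \<longlonglongrightarrow> ?e u x" by simp
    then show ?case by (simp only: lim_imp_Liminf[OF trivial_limit_sequentially] order.refl)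
  qed
  also have "\<dots> \<le> liminf (\<lambda>n. \<integral>\<^sup>+x. ?e (f n) x \<partial>lborel)"
    by (rule nn_integral_liminf) measurable
  finally show ?thesis unfolding hardy_term_def .
qed

text \<open>Lower semicontinuity in the pole: off \<open>x = b\<close> the integrands converge. A
  lower bound is the direction required for poles with positive coefficients.\<close>

lemma hardy_term_pole_Fatou:
  fixes u :: "'a::euclidean_space \<Rightarrow> real"
  assumes [measurable]: "u \<in> borel_measurable borel" and lim: "a \<longlonglongrightarrow> b"
  shows "hardy_term s u b \<le> liminf (\<lambda>n. hardy_term s u (a n))"
proof -
  let ?e = "\<lambda>a x. ennreal ((u x)\<^sup>2 / norm (x - a) powr (2 * s))"
  have "hardy_term s u b \<le> (\<integral>\<^sup>+x. liminf (\<lambda>n. ?e (a n) x) \<partial>lborel)"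
    unfolding hardy_term_def
  proof (rule nn_integral_mono_AE, use AE_lborel_singleton[of b] in eventually_elim)
    case (elim x)
    have "(\<lambda>n. ?e (a n) x) \<longlonglongrightarrow> ?e b x"
      by (intro tendsto_ennrealI tendsto_divide tendsto_powr tendsto_norm tendsto_diff tendsto_const lim) (use elim in auto)
    then show ?case by (simp only: lim_imp_Liminf[OF trivial_limit_sequentially] order.refl)
  qed
  also have "\<dots> \<le> liminf (\<lambda>n. \<integral>\<^sup>+x. ?e (a n) x \<partial>lborel)"
    by (rule nn_integral_liminf) measurable
  finally show ?thesis unfolding hardy_term_def .
qed

text \<open>With \<eta> small the coefficient of \<open>a\<^sup>2\<close> is close to 1, so that a
  small perturbation \<open>b\<close> hardly changes the energy; the fixed factor 2 of
  \<open>sum_sq_le\<close> would spoil the sharp constant.\<close>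

lemma sum_sq_le_weighted:
  fixes a b \<eta> :: real
  assumes "\<eta> > 0"
  shows "(a + b)\<^sup>2 \<le> (1 + \<eta>) * a\<^sup>2 + (1 + 1 / \<eta>) * b\<^sup>2"
proof -
  have "0 \<le> (\<eta> * a - b)\<^sup>2 / \<eta>" using assms by simp
  also have "\<dots> = \<eta> * a\<^sup>2 + (1 / \<eta>) * b\<^sup>2 - 2 * a * b"
    using assms by (simp add: field_simps power2_eq_square)
  finally show ?thesis by (simp add: power2_eq_square algebra_simps)
qed

lemma energy_add_le:
  fixes f g :: "'a::euclidean_space \<Rightarrow> real"
  assumes [measurable]: "f \<in> borel_measurable borel" "g \<in> borel_measurable borel" and \<eta>: "\<eta> > 0"
  shows "energy s (\<lambda>x. f x + g x) \<le> ennreal (1 + \<eta>) * energy s f + ennreal (1 + 1 / \<eta>) * energy s g"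
proof -
  let ?e = "\<lambda>u x y. ennreal ((u x - u y)\<^sup>2 / norm (x - y :: 'a) powr (real DIM('a) + 2 * s))"
  have "energy s (\<lambda>x. f x + g x) \<le> (\<integral>\<^sup>+x. \<integral>\<^sup>+y. ennreal (1 + \<eta>) * ?e f x y + ennreal (1 + 1 / \<eta>) * ?e g x y \<partial>lborel \<partial>lborel)"
    unfolding energy_def
  proof (intro nn_integral_mono)
    fix x y :: 'a
    define q where "q = norm (x - y) powr (real DIM('a) + 2 * s)"
    have q: "q \<ge> 0" unfolding q_def by simp
    have "((f x + g x) - (f y + g y))\<^sup>2 = ((f x - f y) + (g x - g y))\<^sup>2" by (simp add: algebra_simps)
    also have "\<dots> \<le> (1 + \<eta>) * (f x - f y)\<^sup>2 + (1 + 1 / \<eta>) * (g x - g y)\<^sup>2" by (rule sum_sq_le_weighted[OF \<eta>])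
    finally have "((f x + g x) - (f y + g y))\<^sup>2 / q \<le> ((1 + \<eta>) * (f x - f y)\<^sup>2 + (1 + 1 / \<eta>) * (g x - g y)\<^sup>2) / q"
      using q by (rule divide_right_mono)
    also have "\<dots> = (1 + \<eta>) * ((f x - f y)\<^sup>2 / q) + (1 + 1 / \<eta>) * ((g x - g y)\<^sup>2 / q)"
      by (simp only: add_divide_distrib times_divide_eq_right)
    finally have "ennreal (((f x + g x) - (f y + g y))\<^sup>2 / q) \<le> ennreal ((1 + \<eta>) * ((f x - f y)\<^sup>2 / q) + (1 + 1 / \<eta>) * ((g x - g y)\<^sup>2 / q))"
      by (rule ennreal_leI)
    also have "\<dots> = ennreal ((1 + \<eta>) * ((f x - f y)\<^sup>2 / q)) + ennreal ((1 + 1 / \<eta>) * ((g x - g y)\<^sup>2 / q))"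
      using q \<eta> by (intro ennreal_plus mult_nonneg_nonneg divide_nonneg_nonneg) auto
    also have "\<dots> = ennreal (1 + \<eta>) * ennreal ((f x - f y)\<^sup>2 / q) + ennreal (1 + 1 / \<eta>) * ennreal ((g x - g y)\<^sup>2 / q)"
      using \<eta> by (intro arg_cong2[where f = "(+)"] ennreal_mult') auto
    finally show "ennreal (((f x + g x) - (f y + g y))\<^sup>2 / norm (x - y) powr (real DIM('a) + 2 * s))
      \<le> ennreal (1 + \<eta>) * ?e f x y + ennreal (1 + 1 / \<eta>) * ?e g x y" unfolding q_def .
  qed
  also have "\<dots> = (\<integral>\<^sup>+x. ennreal (1 + \<eta>) * (\<integral>\<^sup>+y. ?e f x y \<partial>lborel) + ennreal (1 + 1 / \<eta>) * (\<integral>\<^sup>+y. ?e g x y \<partial>lborel) \<partial>lborel)"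
    by (intro nn_integral_cong) (simp add: nn_integral_add nn_integral_cmult)
  also have "\<dots> = ennreal (1 + \<eta>) * energy s f + ennreal (1 + 1 / \<eta>) * energy s g"
    unfolding energy_def by (simp add: nn_integral_add nn_integral_cmult)
  finally show ?thesis .
qed

lemma energy_minus: "energy s (\<lambda>x. f x - g x) = energy s (\<lambda>x. g x - f x)"
proof -
  have "(f x - g x - (f y - g y))\<^sup>2 = (g x - f x - (g y - f y))\<^sup>2" for x y
    by (simp add: power2_eq_square algebra_simps)
  then show ?thesis unfolding energy_def by (simp only:)
qed

section \<open>Passage to the completion\<close>

text \<open>The Cauchy condition concerns only the approximating functions. Fatou's lemma in
  \<open>m\<close>, applied to \<open>\<phi> n - \<phi> m\<close>, turns it into convergence of
  \<open>\<phi> n\<close> to \<open>u\<close> in energy.\<close>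

lemma Ds2_approx:
  fixes u :: "'a::euclidean_space \<Rightarrow> real"
  assumes s: "0 < s" "s < 1" and u: "u \<in> Ds2 s"
  obtains \<phi> where "\<And>n. \<phi> n \<in> Cc_inf" "AE x in lborel. (\<lambda>n. \<phi> n x) \<longlonglongrightarrow> u x"
    "\<And>e. e > 0 \<Longrightarrow> \<exists>M. \<forall>n\<ge>M. energy s (\<lambda>x. \<phi> n x - u x) \<le> ennreal e"
proof -
  obtain \<phi> where \<phi>: "\<And>n. \<phi> n \<in> Cc_inf" "\<And>e. e > 0 \<Longrightarrow> \<exists>M. \<forall>m\<ge>M. \<forall>n\<ge>M. Ds2_norm s (\<lambda>x. \<phi> m x - \<phi> n x) < e"
    "AE x in lborel. (\<lambda>n. \<phi> n x) \<longlonglongrightarrow> u x"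
    using u unfolding Ds2_def by blast
  have [measurable]: "\<phi> n \<in> borel_measurable borel" for n by (rule Cc_inf_measurable[OF \<phi>(1)])
  define C where "C = C_Ns DIM('a) s / 2"
  have C: "C > 0" unfolding C_def using C_Ns_pos[OF s] by simp
  have "\<exists>M. \<forall>n\<ge>M. energy s (\<lambda>x. \<phi> n x - u x) \<le> ennreal e" if e: "e > 0" for e
  proof -
    \<comment> \<open>The squared norm is \<open>C\<close> times the energy, so this threshold makes
      the energy at most \<open>e\<close>. That the energies are finite on \<open>Cc_inf\<close> is
      needed to read a bound on \<open>enn2real\<close> as a bound on the energy.\<close>
    obtain M where M: "\<And>m n. m \<ge> M \<Longrightarrow> n \<ge> M \<Longrightarrow> Ds2_norm s (\<lambda>x. \<phi> m x - \<phi> n x) < sqrt (C * e)"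
      using \<phi>(2)[of "sqrt (C * e)"] C e by auto
    have small: "energy s (\<lambda>x. \<phi> n x - \<phi> m x) \<le> ennreal e" if "m \<ge> M" "n \<ge> M" for m n
    proof -
      have d: "(\<lambda>x. \<phi> n x - \<phi> m x) \<in> Cc_inf" by (intro Cc_inf_diff \<phi>)
      have "(Ds2_norm s (\<lambda>x. \<phi> n x - \<phi> m x))\<^sup>2 < C * e"
      proof -
        have "Ds2_norm s (\<lambda>x. \<phi> n x - \<phi> m x) \<ge> 0"
          unfolding Ds2_norm_def using C_Ns_pos[OF s, of "DIM('a)"] by (auto intro!: mult_nonneg_nonneg integral_nonneg)
        then have "(Ds2_norm s (\<lambda>x. \<phi> n x - \<phi> m x))\<^sup>2 < (sqrt (C * e))\<^sup>2"
          using M[OF that(2,1)] by (intro power_strict_mono) auto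
        then show ?thesis using C e by simp
      qed
      then have "C * enn2real (energy s (\<lambda>x. \<phi> n x - \<phi> m x)) < C * e"
        unfolding Ds2_norm_sq[OF Cc_inf_measurable[OF d] s] C_def .
      then have "enn2real (energy s (\<lambda>x. \<phi> n x - \<phi> m x)) \<le> e" using C by simp
      then show ?thesis
        using Cc_inf_energy_finite[OF d s] e by (simp add: enn2real_le)
    qed
    have "energy s (\<lambda>x. \<phi> n x - u x) \<le> ennreal e" if n: "n \<ge> M" for n
    proof -
      have "energy s (\<lambda>x. \<phi> n x - u x) \<le> liminf (\<lambda>m. energy s (\<lambda>x. \<phi> n x - \<phi> m x))"
      proof (rule energy_Fatou)
        show "AE x in lborel. (\<lambda>m. \<phi> n x - \<phi> m x) \<longlonglongrightarrow> \<phi> n x - u x"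
          using \<phi>(3) by eventually_elim (intro tendsto_diff tendsto_const)
      qed measurable
      also have "\<dots> \<le> ennreal e"
      proof (rule Liminf_le)
        show "\<forall>\<^sub>F m in sequentially. energy s (\<lambda>x. \<phi> n x - \<phi> m x) \<le> ennreal e"
          using small n by (intro eventually_sequentiallyI[of M])
      qed simp
      finally show ?thesis .
    qed
    then show ?thesis by blast
  qed
  then show ?thesis using that \<phi>(1,3) by blast
qed

lemma Ds2_energy_finite:
  fixes u :: "'a::euclidean_space \<Rightarrow> real"
  assumes s: "0 < s" "s < 1" and u: "u \<in> Ds2 s"
  shows "energy s u < \<infinity>"
proof -
  have [measurable]: "u \<in> borel_measurable borel" using u unfolding Ds2_def by blast
  obtain \<phi> where \<phi>: "\<And>n::nat. \<phi> n \<in> Cc_inf" "AE x in lborel. (\<lambda>n. \<phi> n x) \<longlonglongrightarrow> u x"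
    "\<And>e. e > 0 \<Longrightarrow> \<exists>M. \<forall>n\<ge>M. energy s (\<lambda>x. \<phi> n x - u x) \<le> ennreal e"
    using Ds2_approx[OF s u] by blast
  have [measurable]: "\<phi> n \<in> borel_measurable borel" for n by (rule Cc_inf_measurable[OF \<phi>(1)])
  obtain M where M: "energy s (\<lambda>x. \<phi> M x - u x) \<le> ennreal 1" using \<phi>(3)[of 1] by auto
  have "energy s (\<lambda>x. \<phi> M x + (u x - \<phi> M x)) \<le> ennreal (1 + 1) * energy s (\<phi> M) + ennreal (1 + 1 / 1) * energy s (\<lambda>x. u x - \<phi> M x)"
    by (rule energy_add_le) auto
  also have "\<dots> < \<infinity>"
    using Cc_inf_energy_finite[OF \<phi>(1) s, of M] M unfolding energy_minus[of s u]
    by (auto simp: ennreal_mult_less_top intro: le_less_trans)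
  finally show ?thesis by simp
qed

text \<open>The inequality holds for the approximating functions, which are square integrable. On
  the left Fatou's lemma passes to \<open>u\<close>; on the right \<open>energy_add_le\<close>
  compares the energies of \<open>\<phi> n\<close> and \<open>u\<close>, and its parameter \<eta>
  then tends to 0, so that the constant stays sharp.\<close>

theorem hardy_inequality_Ds2:
  fixes u :: "'a::euclidean_space \<Rightarrow> real"
  assumes s: "0 < s" "s < 1" "2 * s < real DIM('a)" and u: "u \<in> Ds2 s"
  shows "ennreal (gamma_H DIM('a) s) * hardy_term s u a \<le> ennreal (C_Ns DIM('a) s / 2) * energy s u"
proof -
  define C where "C = C_Ns DIM('a) s / 2"
  have C: "C > 0" unfolding C_def using C_Ns_pos[OF s(1,2)] by simp
  define g where "g = gamma_H DIM('a) s"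
  have g: "g > 0" unfolding g_def using s by (intro gamma_H_pos)
  have [measurable]: "u \<in> borel_measurable borel" using u unfolding Ds2_def by blast
  obtain \<phi> where \<phi>: "\<And>n::nat. \<phi> n \<in> Cc_inf" "AE x in lborel. (\<lambda>n. \<phi> n x) \<longlonglongrightarrow> u x"
    "\<And>e. e > 0 \<Longrightarrow> \<exists>M. \<forall>n\<ge>M. energy s (\<lambda>x. \<phi> n x - u x) \<le> ennreal e"
    using Ds2_approx[OF s(1,2) u] by blast
  have [measurable]: "\<phi> n \<in> borel_measurable borel" for n by (rule Cc_inf_measurable[OF \<phi>(1)])
  define e where "e = enn2real (energy s u)"
  have e: "energy s u = ennreal e" "e \<ge> 0"
    using Ds2_energy_finite[OF s(1,2) u] unfolding e_def by (simp_all add: enn2real_nonneg)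
  have bound: "ennreal g * hardy_term s u a \<le> ennreal (C * ((1 + \<eta>) * e + (1 + 1 / \<eta>) * \<eta>\<^sup>2))" if \<eta>: "\<eta> > 0" for \<eta>
  proof -
    \<comment> \<open>The tolerance \<open>\<eta>\<^sup>2\<close> compensates the factor
      \<open>1 + 1 / \<eta>\<close>: the error becomes
      \<open>\<eta>\<^sup>2 + \<eta>\<close>.\<close>
    obtain M where M: "\<And>n. n \<ge> M \<Longrightarrow> energy s (\<lambda>x. \<phi> n x - u x) \<le> ennreal (\<eta>\<^sup>2)" using \<phi>(3)[of "\<eta>\<^sup>2"] \<eta> by auto
    have le: "ennreal g * hardy_term s (\<phi> n) a \<le> ennreal (C * ((1 + \<eta>) * e + (1 + 1 / \<eta>) * \<eta>\<^sup>2))" if n: "n \<ge> M" for n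
    proof -
      have "energy s (\<lambda>x. u x + (\<phi> n x - u x)) \<le> ennreal (1 + \<eta>) * energy s u + ennreal (1 + 1 / \<eta>) * energy s (\<lambda>x. \<phi> n x - u x)"
        by (rule energy_add_le[OF _ _ \<eta>]) measurable
      also have "\<dots> \<le> ennreal (1 + \<eta>) * ennreal e + ennreal (1 + 1 / \<eta>) * ennreal (\<eta>\<^sup>2)"
        unfolding e(1) by (intro add_left_mono mult_left_mono M n) simp
      also have "\<dots> = ennreal ((1 + \<eta>) * e) + ennreal ((1 + 1 / \<eta>) * \<eta>\<^sup>2)"
        using \<eta> by (intro arg_cong2[where f = "(+)"] ennreal_mult'[symmetric]) auto
      also have "\<dots> = ennreal ((1 + \<eta>) * e + (1 + 1 / \<eta>) * \<eta>\<^sup>2)"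
        using \<eta> e by (intro ennreal_plus[symmetric] mult_nonneg_nonneg) auto
      finally have E: "energy s (\<phi> n) \<le> ennreal ((1 + \<eta>) * e + (1 + 1 / \<eta>) * \<eta>\<^sup>2)" by simp
      have "ennreal g * hardy_term s (\<phi> n) a \<le> ennreal C * energy s (\<phi> n)"
        unfolding g_def C_def by (rule hardy_inequality_L2_pole) (use Cc_inf_L2[OF \<phi>(1)] s in auto)
      also have "\<dots> \<le> ennreal C * ennreal ((1 + \<eta>) * e + (1 + 1 / \<eta>) * \<eta>\<^sup>2)"
        by (rule mult_left_mono[OF E]) simp
      also have "\<dots> = ennreal (C * ((1 + \<eta>) * e + (1 + 1 / \<eta>) * \<eta>\<^sup>2))"
        using C by (intro ennreal_mult'[symmetric]) simp
      finally show ?thesis .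
    qed
    define B where "B = C * ((1 + \<eta>) * e + (1 + 1 / \<eta>) * \<eta>\<^sup>2)"
    have "hardy_term s u a \<le> liminf (\<lambda>n. hardy_term s (\<phi> n) a)"
      by (intro hardy_term_Fatou \<phi>(2)) auto
    also have "\<dots> \<le> ennreal (1 / g) * ennreal B"
    proof (rule Liminf_le)
      have "hardy_term s (\<phi> n) a \<le> ennreal (1 / g) * ennreal B" if "n \<ge> M" for n
      proof -
        have "hardy_term s (\<phi> n) a = ennreal (1 / g * g) * hardy_term s (\<phi> n) a" using g by simp
        also have "\<dots> = ennreal (1 / g) * (ennreal g * hardy_term s (\<phi> n) a)"
          using g by (subst ennreal_mult') (auto simp: mult.assoc)
        also have "\<dots> \<le> ennreal (1 / g) * ennreal B" unfolding B_def by (intro mult_left_mono le that) simp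
        finally show ?thesis .
      qed
      then show "\<forall>\<^sub>F n in sequentially. hardy_term s (\<phi> n) a \<le> ennreal (1 / g) * ennreal B"
        by (intro eventually_sequentiallyI[of M])
    qed simp
    finally have "ennreal g * hardy_term s u a \<le> ennreal g * (ennreal (1 / g) * ennreal B)"
      by (rule mult_left_mono) simp
    also have "\<dots> = ennreal (g * (1 / g)) * ennreal B"
      using g by (subst ennreal_mult') (auto simp: mult.assoc)
    also have "\<dots> = ennreal B" using g by simp
    finally show ?thesis unfolding B_def .
  qed
  have "((\<lambda>\<eta>. ennreal (C * ((1 + \<eta>) * e + (\<eta>\<^sup>2 + \<eta>)))) \<longlongrightarrow> ennreal (C * ((1 + 0) * e + (0\<^sup>2 + 0)))) (at_right 0)"
    by (intro tendsto_intros)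
  then have lim: "((\<lambda>\<eta>. ennreal (C * ((1 + \<eta>) * e + (\<eta>\<^sup>2 + \<eta>)))) \<longlongrightarrow> ennreal (C * e)) (at_right 0)" by simp
  have "ennreal g * hardy_term s u a \<le> ennreal (C * e)"
  proof (rule tendsto_lowerbound[OF lim])
    show "\<forall>\<^sub>F \<eta> in at_right 0. ennreal g * hardy_term s u a \<le> ennreal (C * ((1 + \<eta>) * e + (\<eta>\<^sup>2 + \<eta>)))"
      unfolding eventually_at_filter
    proof (intro always_eventually allI impI)
      fix \<eta> :: real assume "\<eta> \<in> {0<..}"
      then have \<eta>: "\<eta> > 0" by simp
      have "(1 + 1 / \<eta>) * \<eta>\<^sup>2 = \<eta>\<^sup>2 + \<eta>" using \<eta> by (simp add: field_simps power2_eq_square)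
      then show "ennreal g * hardy_term s u a \<le> ennreal (C * ((1 + \<eta>) * e + (\<eta>\<^sup>2 + \<eta>)))"
        using bound[OF \<eta>] by (simp only:)
    qed
  qed simp
  also have "ennreal (C * e) = ennreal C * energy s u" unfolding e(1) using C by (intro ennreal_mult') simp
  finally show ?thesis unfolding g_def C_def .
qed

section \<open>Positive parts below the Hardy constant\<close>

text \<open>Each Hardy integral is at most \<open>1 / g\<close> times the squared norm, wherever its
  pole lies, and terms with a negative coefficient can only increase the form. Hence the quotient is
  at least \<open>1 - L / g\<close>, uniformly in \<open>u\<close> and in the poles.\<close>

lemma Q_positive_definite_if_small:
  fixes a :: "nat \<Rightarrow> 'a::euclidean_space"
  assumes s: "0 < s" "s < 1" "2 * s < real DIM('a)" and small: "(\<Sum>i=1..k. max 0 (lam i)) < gamma_H DIM('a) s"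
  shows "Q_positive_definite s k lam a"
proof -
  define g where "g = gamma_H DIM('a) s"
  define L where "L = (\<Sum>i=1..k. max 0 (lam i))"
  have g: "g > 0" unfolding g_def using s by (intro gamma_H_pos)
  have Lg: "L < g" using small unfolding L_def g_def .
  define C where "C = C_Ns DIM('a) s / 2"
  have C: "C > 0" unfolding C_def using C_Ns_pos[OF s(1,2)] by simp
  have "ereal (1 - L / g) \<le> (INF u\<in>{u \<in> Ds2 s. \<not> (AE x in lborel. u x = 0)}. ereal (Q_form s k lam a u / (Ds2_norm s u)\<^sup>2))"
  proof (rule INF_greatest)
    fix u :: "'a \<Rightarrow> real" assume "u \<in> {u \<in> Ds2 s. \<not> (AE x in lborel. u x = 0)}"
    then have u: "u \<in> Ds2 s" and nz: "\<not> (AE x in lborel. u x = 0)" by auto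
    have m [measurable]: "u \<in> borel_measurable borel" using u unfolding Ds2_def by blast
    define D where "D = C * enn2real (energy s u)"
    have norm: "(Ds2_norm s u)\<^sup>2 = D" unfolding D_def C_def by (rule Ds2_norm_sq[OF m s(1,2)])
    have D: "ennreal C * energy s u = ennreal D" "D \<ge> 0"
      using Ds2_energy_finite[OF s(1,2) u] C unfolding D_def by (simp_all add: ennreal_mult' enn2real_nonneg)
    have H: "ennreal g * hardy_term s u b \<le> ennreal D" for b
      unfolding D(1)[symmetric] g_def C_def by (rule hardy_inequality_Ds2[OF s u])
    have Hfin: "hardy_term s u b < \<infinity>" for b
    proof -
      have "ennreal g * hardy_term s u b < \<infinity>" using H[of b] by (rule le_less_trans) simp
      then show ?thesis using g by (auto simp: ennreal_mult_less_top)
    qed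
    define h where "h b = enn2real (hardy_term s u b)" for b
    have h: "hardy_term s u b = ennreal (h b)" "h b \<ge> 0" for b
      using Hfin[of b] unfolding h_def by (simp_all add: enn2real_nonneg)
    have gh: "g * h b \<le> D" for b
    proof -
      have "ennreal (g * h b) \<le> ennreal D" using H[of b] g unfolding h(1) by (simp add: ennreal_mult')
      then show ?thesis using D(2) by (simp add: ennreal_le_iff)
    qed
    \<comment> \<open>If the norm were 0, the Hardy inequality at the pole 0 would make
      \<open>u\<close> vanish almost everywhere. The point matters: a quotient with denominator 0
      would be 0 and violate the bound.\<close>
    have Dpos: "D > 0"
    proof (rule ccontr)
      assume "\<not> D > 0"
      then have "g * h 0 \<le> 0" using gh[of 0] by linarith
      then have "h 0 \<le> 0" using g by (simp add: mult_le_0_iff)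
      then have "hardy_term s u 0 = 0" using h[of 0] by simp
      then have "AE x in lborel. ennreal ((u x)\<^sup>2 / norm (x - 0) powr (2 * s)) = 0"
        unfolding hardy_term_def by (subst (asm) nn_integral_0_iff_AE) auto
      then have "AE x in lborel. u x = 0"
        using AE_lborel_singleton[of "0::'a"]
      proof eventually_elim
        case (elim x)
        then have "norm (x - 0) powr (2 * s) > 0" by simp
        then have "\<not> (u x)\<^sup>2 > 0" using elim(1) by (auto simp: ennreal_eq_0_iff divide_le_0_iff)
        then show ?case by simp
      qed
      then show False using nz by contradiction
    qed
    have "(\<Sum>i=1..k. lam i * h (a i)) \<le> (\<Sum>i=1..k. max 0 (lam i) * (D / g))"
    proof (rule sum_mono)
      fix i
      have "lam i * h (a i) \<le> max 0 (lam i) * h (a i)" using h(2) by (intro mult_right_mono) auto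
      also have "\<dots> \<le> max 0 (lam i) * (D / g)" using gh[of "a i"] g by (intro mult_left_mono) (auto simp: field_simps)
      finally show "lam i * h (a i) \<le> max 0 (lam i) * (D / g)" .
    qed
    also have "\<dots> = L * (D / g)" unfolding L_def by (rule sum_distrib_right[symmetric])
    finally have le: "(\<Sum>i=1..k. lam i * h (a i)) \<le> L * (D / g)" .
    have "Q_form s k lam a u = D - (\<Sum>i=1..k. lam i * h (a i))"
      unfolding Q_form_def norm LINT_hardy_term[OF m] h_def ..
    then have "Q_form s k lam a u \<ge> (1 - L / g) * D" using le by (simp add: algebra_simps)
    then show "ereal (1 - L / g) \<le> ereal (Q_form s k lam a u / (Ds2_norm s u)\<^sup>2)"
      unfolding norm using Dpos by (simp add: field_simps)
  qed
  moreover have "ereal (1 - L / g) > 0" using Lg g by simp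
  ultimately show ?thesis unfolding Q_positive_definite_def by (rule less_le_trans[rotated])
qed

section \<open>Positive parts above the Hardy constant\<close>

lemma Cc_inf_subset_Ds2:
  assumes "u \<in> Cc_inf"
  shows "u \<in> Ds2 s"
proof -
  have "Ds2_norm s (\<lambda>x. u x - u x) = 0" unfolding Ds2_norm_def by simp
  then show ?thesis
    unfolding Ds2_def using assms Cc_inf_measurable[OF assms]
    by (auto intro!: exI[of _ "\<lambda>n. u"])
qed

text \<open>The triangle inequality keeps every point of the support at distance at least \<rho>
  from the pole. The bound tends to 0 as \<rho> grows, which makes the negative coefficients
  harmless.\<close>

lemma hardy_term_far:
  fixes u :: "'a::euclidean_space \<Rightarrow> real"
  assumes [measurable]: "u \<in> borel_measurable borel" and supp: "\<And>x. norm x > R \<Longrightarrow> u x = 0" and \<rho>: "\<rho> > 0" "R + \<rho> \<le> norm a" and s: "s > 0"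
  shows "hardy_term s u a \<le> ennreal (\<rho> powr (- (2 * s))) * (\<integral>\<^sup>+x. ennreal ((u x)\<^sup>2) \<partial>lborel)"
proof -
  have "hardy_term s u a \<le> (\<integral>\<^sup>+x. ennreal (\<rho> powr (- (2 * s))) * ennreal ((u x)\<^sup>2) \<partial>lborel)"
    unfolding hardy_term_def
  proof (rule nn_integral_mono)
    fix x
    show "ennreal ((u x)\<^sup>2 / norm (x - a) powr (2 * s)) \<le> ennreal (\<rho> powr (- (2 * s))) * ennreal ((u x)\<^sup>2)"
    proof (cases "norm x \<le> R")
      case True
      have "norm a \<le> norm x + norm (x - a)"
        using norm_triangle_ineq4[of x "x - a"] by simp
      then have "\<rho> \<le> norm (x - a)" using True \<rho>(2) by linarith
      then have "norm (x - a) powr (- (2 * s)) \<le> \<rho> powr (- (2 * s))"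
        using \<rho> s by (intro powr_mono2') auto
      then have "(u x)\<^sup>2 * norm (x - a) powr (- (2 * s)) \<le> (u x)\<^sup>2 * \<rho> powr (- (2 * s))"
        by (rule mult_left_mono) simp
      then have "(u x)\<^sup>2 / norm (x - a) powr (2 * s) \<le> \<rho> powr (- (2 * s)) * (u x)\<^sup>2"
        unfolding powr_minus_divide by (simp add: mult.commute)
      then show ?thesis by (subst ennreal_mult'[symmetric]) (simp, rule ennreal_leI)
    qed (use supp in auto)
  qed
  also have "\<dots> = ennreal (\<rho> powr (- (2 * s))) * (\<integral>\<^sup>+x. ennreal ((u x)\<^sup>2) \<partial>lborel)"
    by (rule nn_integral_cmult) measurable
  finally show ?thesis .
qed

text \<open>Clustering the poles with positive coefficients imitates a single pole of strength
  \<open>L\<close>, for which some \<open>u\<close> in \<open>Cc_inf\<close> makes the form negative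
  by a gap \<open>d\<close>. Half of \<open>d\<close> is spent on moving these poles off the origin,
  since they have to be distinct, and half on the remaining ones.\<close>

lemma ex_poles_not_positive_definite:
  assumes s: "0 < s" "s < 1" "2 * s < real DIM('a)" and large: "gamma_H DIM('a) s < (\<Sum>i=1..k. max 0 (lam i))"
  obtains a :: "nat \<Rightarrow> 'a::euclidean_space" where "inj_on a {1..k}" "\<not> Q_positive_definite s k lam a"
proof -
  define L where "L = (\<Sum>i=1..k. max 0 (lam i))"
  have L0: "L > 0" using large gamma_H_pos[of s "DIM('a)"] s unfolding L_def by linarith
  define C where "C = C_Ns DIM('a) s / 2"
  have C: "C > 0" unfolding C_def using C_Ns_pos[OF s(1,2)] by simp
  obtain u :: "'a \<Rightarrow> real" where u: "u \<in> Cc_inf"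
    and lt: "ennreal C * energy s u < ennreal L * (\<integral>\<^sup>+x. ennreal ((u x)\<^sup>2 / norm x powr (2 * s)) \<partial>lborel)"
    using hardy_constant_optimal_Cc_inf[OF s, of L] large unfolding L_def C_def by blast
  have m [measurable]: "u \<in> borel_measurable borel" by (rule Cc_inf_measurable[OF u])
  have uD: "u \<in> Ds2 s" by (rule Cc_inf_subset_Ds2[OF u])
  define D where "D = C * enn2real (energy s u)"
  have norm: "(Ds2_norm s u)\<^sup>2 = D" unfolding D_def C_def by (rule Ds2_norm_sq[OF m s(1,2)])
  have D: "ennreal C * energy s u = ennreal D" "D \<ge> 0"
    using Cc_inf_energy_finite[OF u s(1,2)] C unfolding D_def by (simp_all add: ennreal_mult' enn2real_nonneg)
  have Hfin: "hardy_term s u b < \<infinity>" for b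
  proof -
    have "ennreal (gamma_H DIM('a) s) * hardy_term s u b \<le> ennreal D"
      unfolding D(1)[symmetric] C_def by (rule hardy_inequality_Ds2[OF s uD])
    then have "ennreal (gamma_H DIM('a) s) * hardy_term s u b < \<infinity>" by (rule le_less_trans) simp
    then show ?thesis using gamma_H_pos[of s "DIM('a)"] s by (auto simp: ennreal_mult_less_top)
  qed
  define h where "h b = enn2real (hardy_term s u b)" for b
  have h: "hardy_term s u b = ennreal (h b)" "h b \<ge> 0" for b
    using Hfin[of b] unfolding h_def by (simp_all add: enn2real_nonneg)
  have Dh: "D < L * h 0"
  proof -
    have "ennreal D < ennreal L * hardy_term s u 0" using lt unfolding D(1) hardy_term_def by simp
    then have "ennreal D < ennreal (L * h 0)" unfolding h(1) using L0 by (simp add: ennreal_mult')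
    then show ?thesis using D(2) by (simp add: ennreal_less_iff)
  qed
  define d where "d = L * h 0 - D"
  have d: "d > 0" using Dh by (simp add: d_def)
  have h0: "h 0 > 0" using Dh D(2) L0 by (metis le_less_trans zero_less_mult_pos)
  obtain e :: 'a where e: "norm e = 1" using vector_choose_size[of 1] by auto
  \<comment> \<open>The candidates \<open>i / (n + 1)\<close> on the ray through \<open>e\<close>
    are distinct and tend to 0. A loss of \<open>d / (2 * L)\<close> per unit of positive
    coefficient adds up to \<open>d / 2\<close>.\<close>
  have near: "\<forall>\<^sub>F n in sequentially. \<forall>i\<in>{1..k}. h 0 - d / (2 * L) < h ((real i / real (Suc n)) *\<^sub>R e)"
  proof (intro eventually_ball_finite ballI)
    fix i
    have "(\<lambda>n. (real i * (1 / real (Suc n))) *\<^sub>R e) \<longlonglongrightarrow> (real i * 0) *\<^sub>R e"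
      by (intro tendsto_scaleR tendsto_mult tendsto_const) (use LIMSEQ_inverse_real_of_nat in \<open>simp add: inverse_eq_divide\<close>)
    then have "(\<lambda>n. (real i / real (Suc n)) *\<^sub>R e) \<longlonglongrightarrow> 0" by simp
    then have F: "hardy_term s u 0 \<le> liminf (\<lambda>n. hardy_term s u ((real i / real (Suc n)) *\<^sub>R e))"
      by (rule hardy_term_pole_Fatou[OF m])
    have "ennreal (h 0 - d / (2 * L)) < hardy_term s u 0"
      unfolding h(1)[of 0] using h0 d L0 by (intro ennreal_lessI) auto
    then have "ennreal (h 0 - d / (2 * L)) < liminf (\<lambda>n. hardy_term s u ((real i / real (Suc n)) *\<^sub>R e))"
      using F by (rule less_le_trans)
    then have "\<forall>\<^sub>F n in sequentially. ennreal (h 0 - d / (2 * L)) < hardy_term s u ((real i / real (Suc n)) *\<^sub>R e)"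
      by (rule less_LiminfD)
    then show "\<forall>\<^sub>F n in sequentially. h 0 - d / (2 * L) < h ((real i / real (Suc n)) *\<^sub>R e)"
    proof eventually_elim
      case (elim n)
      then show ?case unfolding h(1) using h(2) by (metis ennreal_leI not_le)
    qed
  qed simp
  then obtain n where n: "\<And>i. i \<in> {1..k} \<Longrightarrow> h 0 - d / (2 * L) < h ((real i / real (Suc n)) *\<^sub>R e)"
    using eventually_happens'[OF sequentially_bot] by blast
  obtain R where R: "\<And>x. norm x > R \<Longrightarrow> u x = 0" using Cc_inf_support[OF u] by blast
  define J where "J = enn2real (\<integral>\<^sup>+x. ennreal ((u x)\<^sup>2) \<partial>lborel)"
  have J: "(\<integral>\<^sup>+x. ennreal ((u x)\<^sup>2) \<partial>lborel) = ennreal J" "J \<ge> 0"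
    using Cc_inf_L2[OF u] unfolding J_def by (simp_all add: enn2real_nonneg)
  define N where "N = (\<Sum>i=1..k. \<bar>lam i\<bar>)"
  have N0: "N \<ge> 0" unfolding N_def by (simp add: sum_nonneg)
  have "((\<lambda>\<rho>. N * (\<rho> powr (- (2 * s)) * J)) \<longlongrightarrow> N * (0 * J)) at_top"
    using s by (intro tendsto_mult tendsto_const tendsto_neg_powr filterlim_ident) auto
  then have "\<forall>\<^sub>F \<rho> in at_top. N * (\<rho> powr (- (2 * s)) * J) < d / 2"
    using d by (intro order_tendstoD(2)[where y = "N * (0 * J)"]) auto
  then have "\<forall>\<^sub>F \<rho> in at_top. N * (\<rho> powr (- (2 * s)) * J) < d / 2 \<and> \<rho> > (0::real)"
    using eventually_gt_at_top by (rule eventually_conj)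
  then obtain \<rho> where \<rho>: "N * (\<rho> powr (- (2 * s)) * J) < d / 2" "\<rho> > 0"
    using eventually_happens'[OF trivial_limit_at_top_linorder] by blast
  \<comment> \<open>The first entry of the maximum leaves distance at least \<rho> between the
    support and the far poles. The second keeps the two families apart: near poles have norm at most
    \<open>k\<close>, far ones more than \<open>k\<close>.\<close>
  define S where "S = max (R + \<rho>) (real k + 1)"
  define c where "c i = (if lam i > 0 then real i / real (Suc n) else S * real i)" for i
  define a where "a i = c i *\<^sub>R e" for i
  have e0: "e \<noteq> 0" using e by auto
  have Sk: "S > real k" "S > 0" unfolding S_def by auto
  have small: "real i / real (Suc n) \<le> real k" if "i \<in> {1..k}" for i
  proof -
    have "real i / real (Suc n) \<le> real i / 1" by (intro divide_left_mono) auto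
    then show ?thesis using that by auto
  qed
  have big: "S * real i \<ge> S" if "i \<in> {1..k}" for i
    using mult_left_mono[of 1 "real i" S] that Sk by auto
  have inj: "inj_on a {1..k}"
  proof (rule inj_onI)
    fix i j assume ij: "i \<in> {1..k}" "j \<in> {1..k}" "a i = a j"
    then have "c i = c j" unfolding a_def using e0 by simp
    moreover have "c l > real k" if "\<not> lam l > 0" "l \<in> {1..k}" for l
      using less_le_trans[OF Sk(1) big[OF that(2)]] that(1) unfolding c_def by simp
    moreover have "c l \<le> real k" if "lam l > 0" "l \<in> {1..k}" for l
      using small[OF that(2)] that(1) unfolding c_def by simp
    ultimately have "lam i > 0 \<longleftrightarrow> lam j > 0" using ij by (metis not_le)
    then show "i = j"
      using \<open>c i = c j\<close> Sk unfolding c_def by (auto split: if_splits simp del: of_nat_Suc)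
  qed
  have term_le: "max 0 (lam i) * (h 0 - d / (2 * L)) - \<bar>lam i\<bar> * (\<rho> powr (- (2 * s)) * J) \<le> lam i * h (a i)" if i: "i \<in> {1..k}" for i
  proof (cases "lam i > 0")
    case True
    have "lam i * (h 0 - d / (2 * L)) \<le> lam i * h (a i)"
      using n[OF i] True unfolding a_def c_def by (intro mult_left_mono) auto
    moreover have "\<bar>lam i\<bar> * (\<rho> powr (- (2 * s)) * J) \<ge> 0" using J by simp
    moreover have "max 0 (lam i) = lam i" using True by simp
    ultimately show ?thesis by linarith
  next
    case False
    have "norm (a i) = S * real i" unfolding a_def c_def using False e Sk by simp
    then have "R + \<rho> \<le> norm (a i)" using big[OF i] unfolding S_def by linarith
    then have "hardy_term s u (a i) \<le> ennreal (\<rho> powr (- (2 * s))) * ennreal J"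
      unfolding J(1)[symmetric] using R \<rho> s by (intro hardy_term_far m) auto
    also have "\<dots> = ennreal (\<rho> powr (- (2 * s)) * J)" by (rule ennreal_mult'[symmetric]) simp
    finally have "h (a i) \<le> \<rho> powr (- (2 * s)) * J" unfolding h(1) using J by (simp add: ennreal_le_iff)
    then have "\<bar>lam i\<bar> * h (a i) \<le> \<bar>lam i\<bar> * (\<rho> powr (- (2 * s)) * J)" by (rule mult_left_mono) simp
    then show ?thesis using False by (simp add: abs_of_nonpos)
  qed
  have "L * (h 0 - d / (2 * L)) - N * (\<rho> powr (- (2 * s)) * J) \<le> (\<Sum>i=1..k. lam i * h (a i))"
    unfolding L_def N_def sum_distrib_right sum_subtractf[symmetric]
    by (rule sum_mono) (use term_le in \<open>simp add: L_def\<close>)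
  moreover have "L * (h 0 - d / (2 * L)) = L * h 0 - d / 2" using L0 by (simp add: right_diff_distrib)
  ultimately have "(\<Sum>i=1..k. lam i * h (a i)) > D" using \<rho>(1) d_def by linarith
  moreover have Q: "Q_form s k lam a u = D - (\<Sum>i=1..k. lam i * h (a i))"
    unfolding Q_form_def norm LINT_hardy_term[OF m] h_def ..
  \<comment> \<open>The form is negative at \<open>u\<close>; for the infimum a nonpositive quotient
    is enough, and this also covers the convention for division by 0.\<close>
  ultimately have "Q_form s k lam a u / (Ds2_norm s u)\<^sup>2 \<le> 0"
    by (intro divide_nonpos_nonneg) auto
  moreover have "\<not> (AE x in lborel. u x = 0)"
  proof
    assume "AE x in lborel. u x = 0"
    then have "hardy_term s u 0 = (\<integral>\<^sup>+(x::'a). 0 \<partial>lborel)"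
      unfolding hardy_term_def by (intro nn_integral_cong_AE) auto
    then show False using h0 unfolding h(1) by simp
  qed
  ultimately have "(INF u\<in>{u \<in> Ds2 s. \<not> (AE x in lborel. u x = 0)}. ereal (Q_form s k lam a u / (Ds2_norm s u)\<^sup>2)) \<le> 0"
    using uD by (intro INF_lower2[of u]) auto
  then have "\<not> Q_positive_definite s k lam a" unfolding Q_positive_definite_def by simp
  then show ?thesis using that inj by blast
qed

theorem theorem1p5:
  fixes s :: real and k :: nat and lam :: "nat \<Rightarrow> real"
  assumes "0 < s" and "s < 1" and "real CARD('n::finite) > 2 * s" and "k \<ge> 1"
  shows "((\<Sum>i=1..k. max 0 (lam i)) < gamma_H CARD('n) s \<longrightarrow>
           (\<forall>a :: nat \<Rightarrow> real ^ 'n. inj_on a {1..k} \<longrightarrow> Q_positive_definite s k lam a))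
       \<and> ((\<Sum>i=1..k. max 0 (lam i)) > gamma_H CARD('n) s \<longrightarrow>
           (\<exists>a :: nat \<Rightarrow> real ^ 'n. inj_on a {1..k} \<and> \<not> Q_positive_definite s k lam a))"
proof (intro conjI impI allI)
  have dim: "DIM(real ^ 'n) = CARD('n)" by simp
  show "Q_positive_definite s k lam a"
    if "(\<Sum>i=1..k. max 0 (lam i)) < gamma_H CARD('n) s" for a :: "nat \<Rightarrow> real ^ 'n"
    using that assms by (intro Q_positive_definite_if_small) (simp_all only: dim)
  assume "(\<Sum>i=1..k. max 0 (lam i)) > gamma_H CARD('n) s"
  then obtain a :: "nat \<Rightarrow> real ^ 'n" where "inj_on a {1..k}" "\<not> Q_positive_definite s k lam a"
    using ex_poles_not_positive_definite[where 'a = "real ^ 'n" and s = s and k = k and lam = lam] assms unfolding dim by blast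
  then show "\<exists>a :: nat \<Rightarrow> real ^ 'n. inj_on a {1..k} \<and> \<not> Q_positive_definite s k lam a" by blast
qed

end
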